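(* Let $\Omega\subseteq\mathbb{R}^3$ be a bounded domain and $\mathscr{C}=\Omega\times(0,\infty)$. Let $u:\mathscr{C}\to\mathbb{H}$ be a function in $C^{2,2}(\mathscr{C},\mathbb{H})$ with $(-\Delta+\partial_{tt})u=0$. Define $v:\mathscr{C}\to\mathbb{H}$ by $$v(x,t):=\int_0^tDu(x,s)\,ds-T_\Omega[\partial_tu](x,0)+\nabla\varphi(x),$$ where $\varphi$ is any harmonic function (on $\Omega$) independent of time. Then $u\pm iv\in\operatorname{Ker}(D\pm i\partial_t)$, i.e. $(D+i\partial_t)(u+iv)=0$ and $(D-i\partial_t)(u-iv)=0$ in $\mathscr{C}$.
   Context: $\mathbb{H}$ denotes the real quaternions with units $e_0=1,e_1,e_2,e_3$, and $\mathbb{B}=\mathbb{H}+i\mathbb{H}$ the biquaternions, where the complex imaginary unit $i$ commutes with $e_1,e_2,e_3$. Vectors $x\in\mathbb{R}^3$ are identified with $\sum_{j=1}^3x_je_j$, and $\nabla\varphi=\sum_{j=1}^3e_j\partial_j\varphi$. $C^{2,2}(\mathscr{C},\mathbb{H})$ is the space of $\mathbb{H}$-valued functions on $\mathscr{C}$ with continuous second-order spatial and temporal partial derivatives. $D=\sum_{j=1}^3e_j\partial_j$ acts by left multiplication in the spatial variables; $\Delta$ is the spatial Laplacian acting componentwise. The Cauchy kernel is $E(x)=\dfrac{-x}{4\pi|x|^3}$, $x\in\mathbb{R}^3\setminus\{0\}$, and the Teodorescu transform is $T_\Omega[w](x)=-\int_\Omega E(y-x)w(y)\,dy$. The expression $T_\Omega[\partial_tu](x,0)$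 denotes $T_\Omega$ applied to the function $y\mapsto\partial_tu(y,0)$, evaluated at $x$.
   Formalization: Since u is given only for t>0, it is additionally assumed that ∂_t u extends continuously to Ω×[0,∞) (giving ∂_t u(y,0)), that s↦Du(x,s) is integrable on [0,t], and that the integral defining T_Ω[∂_t u](x,0) converges absolutely for every x in Ω. *)

theory Defs
  imports "HOL-Analysis.Analysis"
begin

section \<open>Quaternions and biquaternions\<close>

text \<open>
  Quaternions are coordinate vectors with respect to the units $e_0, e_1, e_2, e_3$; the index
  type \<^typ>\<open>4\<close> has exactly the elements 0, 1, 2, 3. The product is defined over any commutative
  coefficient ring: over the reals it gives $H$ (type \<^typ>\<open>real^4\<close>), over the complex numbers
  the complexification $B = H + iH$ (type \<^typ>\<open>complex^4\<close>), in which the scalar $i$ commutes with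
  all $e_j$. Pitfall: the library product \<^term>\<open>(*)\<close> on these vectors is the componentwise one and
  is not used.
\<close>

definition quat :: "'a \<Rightarrow> 'a \<Rightarrow> 'a \<Rightarrow> 'a \<Rightarrow> 'a^4" where
  "quat a b c d = (\<chi> i. if i = 0 then a else if i = 1 then b else if i = 2 then c else d)"

definition qmult :: "'a::comm_ring_1^4 \<Rightarrow> 'a^4 \<Rightarrow> 'a^4" (infixl "\<odot>" 70) where
  "p \<odot> q = quat
     (p$0 * q$0 - p$1 * q$1 - p$2 * q$2 - p$3 * q$3)
     (p$0 * q$1 + p$1 * q$0 + p$2 * q$3 - p$3 * q$2)
     (p$0 * q$2 - p$1 * q$3 + p$2 * q$0 + p$3 * q$1)
     (p$0 * q$3 + p$1 * q$2 - p$2 * q$1 + p$3 * q$0)"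

abbreviation e0 :: "'a::comm_ring_1^4" where "e0 \<equiv> quat 1 0 0 0"
abbreviation e1 :: "'a::comm_ring_1^4" where "e1 \<equiv> quat 0 1 0 0"
abbreviation e2 :: "'a::comm_ring_1^4" where "e2 \<equiv> quat 0 0 1 0"
abbreviation e3 :: "'a::comm_ring_1^4" where "e3 \<equiv> quat 0 0 0 1"

lemma quat_nth [simp]:
  "quat a b c d $ 0 = a" "quat a b c d $ 1 = b" "quat a b c d $ 2 = c" "quat a b c d $ 3 = d"
  by (simp_all add: quat_def)

lemma UNIV_4_from_0: "(UNIV :: 4 set) = {0, 1, 2, 3}"
  using UNIV_4 by auto

lemma quat_eq_iff: "p = q \<longleftrightarrow> p$0 = q$0 \<and> p$1 = q$1 \<and> p$2 = q$2 \<and> p$3 = (q::'a^4)$3"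
  by (metis (full_types) UNIV_4_from_0 UNIV_I insertE singletonD vec_eq_iff)

lemma quat_units:
  "e0 \<odot> q = q" "q \<odot> e0 = q"
  "e1 \<odot> e1 = - e0" "e2 \<odot> e2 = - e0" "e3 \<odot> e3 = - e0"
  "e1 \<odot> e2 = e3" "e2 \<odot> e3 = e1" "e3 \<odot> e1 = e2"
  "e2 \<odot> e1 = - e3" "e3 \<odot> e2 = - e1" "e1 \<odot> e3 = - e2"
  by (simp_all add: qmult_def quat_eq_iff)

definition vec_quat :: "real^3 \<Rightarrow> real^4" where
  "vec_quat x = quat 0 (x$1) (x$2) (x$3)"

definition biquat :: "real^4 \<Rightarrow> complex^4" where
  "biquat q = (\<chi> k. complex_of_real (q$k))"


section \<open>Differential operators\<close>

definition pdiff :: "3 \<Rightarrow> (real^3 \<Rightarrow> 'b::real_normed_vector) \<Rightarrow> real^3 \<Rightarrow> bool" where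
  "pdiff j f x \<longleftrightarrow> (\<lambda>h. f (x + h *\<^sub>R axis j 1)) differentiable (at 0)"

definition pd :: "3 \<Rightarrow> (real^3 \<Rightarrow> 'b::real_normed_vector) \<Rightarrow> real^3 \<Rightarrow> 'b" where
  "pd j f x = vector_derivative (\<lambda>h. f (x + h *\<^sub>R axis j 1)) (at 0)"

definition td :: "(real^3 \<Rightarrow> real \<Rightarrow> 'b::real_normed_vector) \<Rightarrow> real^3 \<Rightarrow> real \<Rightarrow> 'b" where
  "td f x t = vector_derivative (f x) (at t)"

definition laplacian :: "(real^3 \<Rightarrow> 'b::real_normed_vector) \<Rightarrow> real^3 \<Rightarrow> 'b" where
  "laplacian f x = (\<Sum>j\<in>UNIV. pd j (pd j f) x)"

definition dirac :: "(real^3 \<Rightarrow> 'a::real_normed_field^4) \<Rightarrow> real^3 \<Rightarrow> 'a^4" where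
  "dirac f x = e1 \<odot> pd 1 f x + e2 \<odot> pd 2 f x + e3 \<odot> pd 3 f x"

definition grad :: "(real^3 \<Rightarrow> real) \<Rightarrow> real^3 \<Rightarrow> real^4" where
  "grad \<phi> x = quat 0 (pd 1 \<phi> x) (pd 2 \<phi> x) (pd 3 \<phi> x)"

definition C2_on :: "(real^3) set \<Rightarrow> (real^3 \<Rightarrow> 'b::real_normed_vector) \<Rightarrow> bool" where
  "C2_on \<Omega> f \<longleftrightarrow> continuous_on \<Omega> f \<and>
     (\<forall>j. (\<forall>x\<in>\<Omega>. pdiff j f x) \<and> continuous_on \<Omega> (pd j f) \<and>
       (\<forall>k. (\<forall>x\<in>\<Omega>. pdiff k (pd j f) x) \<and> continuous_on \<Omega> (pd k (pd j f))))"

definition harmonic_on :: "(real^3) set \<Rightarrow> (real^3 \<Rightarrow> real) \<Rightarrow> bool" where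
  "harmonic_on \<Omega> \<phi> \<longleftrightarrow> C2_on \<Omega> \<phi> \<and> (\<forall>x\<in>\<Omega>. laplacian \<phi> x = 0)"

text \<open>
  Functions on the cylinder $\Omega \times (0,\infty)$ are curried; their values elsewhere are irrelevant.
  In the following class the continuity is joint in $(x,t)$; mixed space-time derivatives
  are not required to exist.
\<close>

definition C22_on :: "(real^3) set \<Rightarrow> (real^3 \<Rightarrow> real \<Rightarrow> 'b::real_normed_vector) \<Rightarrow> bool" where
  "C22_on \<Omega> u \<longleftrightarrow>
     continuous_on (\<Omega> \<times> {0<..}) (\<lambda>(x, t). u x t) \<and>
     (\<forall>j. (\<forall>x\<in>\<Omega>. \<forall>t>0. pdiff j (\<lambda>y. u y t) x) \<and>
       continuous_on (\<Omega> \<times> {0<..}) (\<lambda>(x, t). pd j (\<lambda>y. u y t) x) \<and>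
       (\<forall>k. (\<forall>x\<in>\<Omega>. \<forall>t>0. pdiff k (pd j (\<lambda>y. u y t)) x) \<and>
         continuous_on (\<Omega> \<times> {0<..}) (\<lambda>(x, t). pd k (pd j (\<lambda>y. u y t)) x))) \<and>
     (\<forall>x\<in>\<Omega>. \<forall>t>0. u x differentiable (at t)) \<and>
     continuous_on (\<Omega> \<times> {0<..}) (\<lambda>(x, t). td u x t) \<and>
     (\<forall>x\<in>\<Omega>. \<forall>t>0. td u x differentiable (at t)) \<and>
     continuous_on (\<Omega> \<times> {0<..}) (\<lambda>(x, t). td (td u) x t)"

text \<open>
  A function on the open cylinder has values at $t = 0$ if it extends continuously to
  $\Omega \times [0,\infty)$; these values are then the limits for $t \to 0+$.
\<close>

definition has_initial_values ::
    "(real^3) set \<Rightarrow> (real^3 \<Rightarrow> real \<Rightarrow> 'b::real_normed_vector) \<Rightarrow> bool" where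
  "has_initial_values \<Omega> f \<longleftrightarrow>
     (\<exists>g. continuous_on (\<Omega> \<times> {0..}) g \<and> (\<forall>x\<in>\<Omega>. \<forall>t>0. g (x, t) = f x t))"

definition initial_value :: "(real^3 \<Rightarrow> real \<Rightarrow> 'b::real_normed_vector) \<Rightarrow> real^3 \<Rightarrow> 'b" where
  "initial_value f x = Lim (at_right 0) (f x)"

text \<open>
  For \<open>c = \<i>\<close> and \<open>c = - \<i>\<close> this is the kernel of $D + i \partial_t$ and of $D - i \partial_t$. Since
  \<^const>\<open>vector_derivative\<close> is total, existence of the derivatives is demanded explicitly.
\<close>

definition Ker_dirac_dt ::
    "(real^3) set \<Rightarrow> complex \<Rightarrow> (real^3 \<Rightarrow> real \<Rightarrow> complex^4) set" where
  "Ker_dirac_dt \<Omega> c = {f. \<forall>x\<in>\<Omega>. \<forall>t>0.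
     (\<forall>j. pdiff j (\<lambda>y. f y t) x) \<and> f x differentiable (at t) \<and>
     dirac (\<lambda>y. f y t) x + c *s td f x t = 0}"


section \<open>The Teodorescu transform\<close>

definition cauchy_kernel :: "real^3 \<Rightarrow> real^4" where
  "cauchy_kernel x = vec_quat (- (1 / (4 * pi * norm x ^ 3)) *\<^sub>R x)"

definition teodorescu_exists :: "(real^3) set \<Rightarrow> (real^3 \<Rightarrow> real^4) \<Rightarrow> real^3 \<Rightarrow> bool" where
  "teodorescu_exists \<Omega> w x \<longleftrightarrow>
     (\<lambda>y. cauchy_kernel (y - x) \<odot> w y) absolutely_integrable_on \<Omega>"

definition teodorescu :: "(real^3) set \<Rightarrow> (real^3 \<Rightarrow> real^4) \<Rightarrow> real^3 \<Rightarrow> real^4" where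
  "teodorescu \<Omega> w x = - integral \<Omega> (\<lambda>y. cauchy_kernel (y - x) \<odot> w y)"

end

theory Submission
  imports Defs
begin

text \<open>
  Write $w = \partial_t u(\cdot, 0)$. The fundamental theorem of calculus gives $\partial_t v = Du$, and
  $(D \pm i \partial_t)(u \pm i v) = Du - \partial_t v \pm i\,(Dv + \partial_t u)$, so everything rests on $Dv = - \partial_t u$ at each
  fixed time $t$. Formally $D \int_0^t Du\, ds = - \int_0^t \Delta u\, ds = w - \partial_t u$, $D\, T_\Omega[w] = w$ and
  $D \nabla \varphi = - \Delta \varphi = 0$, which add up to the claim.

  The formal computation differentiates term by term, and this is not legitimate: $w$ is merely
  continuous, so $T_\Omega[w]$ need not have classical partial derivatives, and nothing is assumed about the
  $x$-dependence of $Du(x, s)$ as $s \to 0$. Only the sum is differentiable, and its singular parts have to be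
  cancelled before differentiating.

  The cancellation uses a parametrix. Split the Cauchy kernel as $E = p + K$ where $p$ vanishes outside a
  small ball and $K$ is continuously differentiable on the whole space, and let $\rho = - \mathrm{div}\, K$, a bump.
  With $(a \star f)(x) = \int a(z) f(x + z)\, dz$ one has, for $g$ of class $C^1$,
  $p_k \star \partial_j g = p_j \star \partial_k g$ and $\sum_k p_k \star \partial_k g = g - \rho \star g$
  (\<open>parametrix_symmetric\<close>, \<open>parametrix_div\<close>), and therefore, for $f$ of class $C^2$,
  $\partial_j f = p_j \star \Delta f - \partial_j \rho \star f$ (\<open>parametrix_representation\<close>).

  Apply this to $U_\varepsilon = \int_\varepsilon^t u\, ds$, whose Laplacian is $\partial_t u(\cdot, t) - \partial_t u(\cdot, \varepsilon)$. As
  $\varepsilon \to 0$ this Laplacian and $U_\varepsilon$ itself converge boundedly on compact sets, to a limit $U_0$ in the case of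
  $U_\varepsilon$, and one obtains $\int_0^t Du\, ds = \sum_j e_j\,(p_j \star (\partial_t u - w) - \partial_j \rho \star U_0)$
  (\<open>dirac_time_integral_eq\<close>). The Teodorescu transform of $w$ contributes $\sum_j e_j\,(p_j \star w)$ and an
  integral with the smooth kernel $K$ (\<open>teodorescu_decomposition\<close>). So $p_j \star w$ cancels, and the only singular
  term left is $p_j \star \partial_t u$.

  Mixed space-time derivatives of $u$ are not assumed, so $\partial_t u$ is again only known to be continuous in
  space. But Taylor's formula in time and the wave equation give
  $\partial_t u(t) = u(t + 1) - u(t) - \Delta \int_t^{t+1} (t + 1 - s)\, u(s)\, ds$
  (\<open>wave_laplacian_integral\<close>), and the parametrix applied to a density of the form $g - \Delta G$ with $g$, $G$ of
  class $C^2$ is differentiable (\<open>parametrix_potential_partials\<close>). Hence $v = \sum_j e_j X_j$ with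
  differentiable fields $X_j$ whose Jacobian matrix is symmetric; on such sums $D$ acts as minus the
  divergence, and the divergences add up to $\partial_t u$ (\<open>dirac_conjugate_field\<close>).
\<close>

section \<open>Directional derivatives\<close>

text \<open>
  The line through $x$ in direction $e$ need not be a coordinate line: \<^const>\<open>pdiff\<close> and \<^const>\<open>pd\<close>
  are the case of the axes.
\<close>

definition has_dirderiv ::
    "('a::real_normed_vector \<Rightarrow> 'b::real_normed_vector) \<Rightarrow> 'a \<Rightarrow> 'a \<Rightarrow> 'b \<Rightarrow> bool" where
  "has_dirderiv f x e d \<longleftrightarrow> ((\<lambda>h. f (x + h *\<^sub>R e)) has_vector_derivative d) (at 0)"

lemma has_dirderiv_iff_tendsto:
  "has_dirderiv f x e d \<longleftrightarrow> ((\<lambda>s. (1 / s) *\<^sub>R (f (x + s *\<^sub>R e) - f x)) \<longlongrightarrow> d) (at 0)"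
proof -
  have eq: "norm (f (x + y *\<^sub>R e) - f (x + 0 *\<^sub>R e) - (y - 0) *\<^sub>R d) / norm (y - 0) =
      norm ((1 / y) *\<^sub>R (f (x + y *\<^sub>R e) - f x) - d)" if "y \<noteq> 0" for y
  proof -
    have "(1 / y) *\<^sub>R (f (x + y *\<^sub>R e) - f x) - d = (1 / y) *\<^sub>R (f (x + y *\<^sub>R e) - f x - y *\<^sub>R d)"
      using that by (simp add: scaleR_diff_right)
    then show ?thesis using that by simp
  qed
  have "has_dirderiv f x e d \<longleftrightarrow>
      ((\<lambda>y. norm (f (x + y *\<^sub>R e) - f (x + 0 *\<^sub>R e) - (y - 0) *\<^sub>R d) / norm (y - 0)) \<longlongrightarrow> 0) (at 0)"
    unfolding has_dirderiv_def has_vector_derivative_def has_derivative_iff_norm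
    by (simp add: bounded_linear_scaleR_left)
  also have "\<dots> \<longleftrightarrow>
      ((\<lambda>y. norm ((1 / y) *\<^sub>R (f (x + y *\<^sub>R e) - f x) - d)) \<longlongrightarrow> 0) (at 0)"
    by (rule filterlim_cong[OF refl refl]) (use eq in \<open>auto simp: eventually_at_filter\<close>)
  also have "\<dots> \<longleftrightarrow> ((\<lambda>y. (1 / y) *\<^sub>R (f (x + y *\<^sub>R e) - f x) - d) \<longlongrightarrow> 0) (at 0)"
    by (rule tendsto_norm_zero_iff)
  also have "\<dots> \<longleftrightarrow> ((\<lambda>y. (1 / y) *\<^sub>R (f (x + y *\<^sub>R e) - f x)) \<longlongrightarrow> d) (at 0)"
    by (rule LIM_zero_iff)
  finally show ?thesis .
qed

lemma has_dirderiv_along_line: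
  assumes "has_dirderiv f (x + h *\<^sub>R e) e d"
  shows "((\<lambda>s. f (x + s *\<^sub>R e)) has_vector_derivative d) (at h)"
proof -
  have "((\<lambda>s. f (x + h *\<^sub>R e + s *\<^sub>R e)) has_vector_derivative d) (at (h - h))"
    using assms by (simp add: has_dirderiv_def)
  then have "((\<lambda>s. f (x + h *\<^sub>R e + s *\<^sub>R e)) \<circ> (\<lambda>s. s - h) has_vector_derivative 1 *\<^sub>R d) (at h)"
    by (intro vector_diff_chain_at) (auto intro!: derivative_eq_intros)
  then show ?thesis by (simp add: o_def algebra_simps)
qed

lemma has_dirderiv_cong_open:
  assumes "has_dirderiv f x e d" "open S" "x \<in> S" "\<And>y. y \<in> S \<Longrightarrow> f y = g y"
  shows "has_dirderiv g x e d"
proof -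
  have "continuous (at 0) (\<lambda>h::real. x + h *\<^sub>R e)" by (intro continuous_intros)
  then have "((\<lambda>h::real. x + h *\<^sub>R e) \<longlongrightarrow> x) (at 0)" by (simp add: isCont_def)
  then have ev: "\<forall>\<^sub>F h::real in at 0. x + h *\<^sub>R e \<in> S"
    by (rule topological_tendstoD[OF _ assms(2,3)])
  show ?thesis
    using assms(1) unfolding has_dirderiv_iff_tendsto
    by (rule Lim_transform_eventually) (use ev assms(3,4) in \<open>auto elim!: eventually_mono\<close>)
qed

lemma has_dirderiv_bounded_linear:
  "bounded_linear T \<Longrightarrow> has_dirderiv f x e d \<Longrightarrow> has_dirderiv (\<lambda>y. T (f y)) x e (T d)"
  unfolding has_dirderiv_def by (rule bounded_linear.has_vector_derivative)

lemma has_dirderiv_add: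
  "has_dirderiv f x e d \<Longrightarrow> has_dirderiv g x e d' \<Longrightarrow> has_dirderiv (\<lambda>y. f y + g y) x e (d + d')"
  unfolding has_dirderiv_def by (rule has_vector_derivative_add)

lemma has_dirderiv_diff:
  "has_dirderiv f x e d \<Longrightarrow> has_dirderiv g x e d' \<Longrightarrow> has_dirderiv (\<lambda>y. f y - g y) x e (d - d')"
  unfolding has_dirderiv_def by (rule has_vector_derivative_diff)

lemma has_dirderiv_sum:
  "(\<And>i. i \<in> I \<Longrightarrow> has_dirderiv (f i) x e (d i)) \<Longrightarrow>
    has_dirderiv (\<lambda>y. \<Sum>i\<in>I. f i y) x e (\<Sum>i\<in>I. d i)"
  unfolding has_dirderiv_def by (rule has_vector_derivative_sum)

lemma has_dirderiv_scaleR: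
  assumes "has_dirderiv a x e a'" "has_dirderiv f x e d"
  shows "has_dirderiv (\<lambda>y. a y *\<^sub>R f y) x e (a' *\<^sub>R f x + a x *\<^sub>R d)"
  using has_vector_derivative_scaleR[OF assms(1)[unfolded has_dirderiv_def
      has_real_derivative_iff_has_vector_derivative[symmetric]] assms(2)[unfolded has_dirderiv_def]]
  by (simp add: has_dirderiv_def add.commute)

lemma has_dirderiv_bound:
  fixes f :: "'a::real_normed_vector \<Rightarrow> 'b::real_normed_vector"
  assumes der: "\<And>t. t \<in> closed_segment 0 s \<Longrightarrow> has_dirderiv f (x + t *\<^sub>R e) e (f' (x + t *\<^sub>R e))"
    and bound: "\<And>t. t \<in> closed_segment 0 s \<Longrightarrow> norm (f' (x + t *\<^sub>R e)) \<le> B"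
  shows "norm (f (x + s *\<^sub>R e) - f x) \<le> B * \<bar>s\<bar>"
proof -
  have "norm ((\<lambda>t. f (x + t *\<^sub>R e)) s - (\<lambda>t. f (x + t *\<^sub>R e)) 0) \<le> B * norm (s - 0)"
  proof (rule differentiable_bound)
    show "convex (closed_segment 0 s)" by simp
    fix t assume t: "t \<in> closed_segment 0 s"
    show "((\<lambda>t. f (x + t *\<^sub>R e)) has_derivative (\<lambda>h. h *\<^sub>R f' (x + t *\<^sub>R e)))
        (at t within closed_segment 0 s)"
      using has_dirderiv_along_line[OF der[OF t]]
      by (simp add: has_vector_derivative_def has_derivative_at_withinI)
    have "norm (h *\<^sub>R f' (x + t *\<^sub>R e)) \<le> B * norm h" for h
      using mult_right_mono[OF bound[OF t], of "\<bar>h\<bar>"] by (simp add: mult.commute)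
    then show "onorm (\<lambda>h. h *\<^sub>R f' (x + t *\<^sub>R e)) \<le> B"
      by (rule onorm_le)
  qed auto
  then show ?thesis by simp
qed

lemma pdiff_has_dirderiv:
  "pdiff j f x \<Longrightarrow> has_dirderiv f x (axis j 1) (pd j f x)"
  unfolding pdiff_def pd_def has_dirderiv_def by (simp add: vector_derivative_works)

lemma has_dirderiv_imp_pdiff:
  assumes "has_dirderiv f x (axis j 1) d"
  shows "pdiff j f x" "pd j f x = d"
  using assms unfolding pdiff_def pd_def has_dirderiv_def
  by (auto simp: vector_derivative_at intro: differentiableI_vector)

section \<open>Correlation with compactly supported kernels\<close>

lemma integrable_shift:
  fixes f :: "'a::euclidean_space \<Rightarrow> 'b::euclidean_space"
  assumes "integrable lborel f"
  shows "integrable lborel (\<lambda>z. f (c + z))"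
proof -
  have "integrable (distr lborel borel ((+) c)) f" using assms by (simp add: lborel_distr_plus)
  then show ?thesis by (rule integrable_distr[rotated]) simp
qed

lemma integral_shift:
  fixes f :: "'a::euclidean_space \<Rightarrow> 'b::euclidean_space"
  assumes [measurable]: "f \<in> borel_measurable borel"
  shows "(\<integral>z. f (c + z) \<partial>lborel) = integral\<^sup>L lborel f"
proof -
  have "integral\<^sup>L (distr lborel borel ((+) c)) f = (\<integral>z. f (c + z) \<partial>lborel)"
    by (rule integral_distr) simp_all
  then show ?thesis by (simp add: lborel_distr_plus)
qed

text \<open>
  Every difference quotient of $h$ has integral 0 because Lebesgue measure is translation invariant,
  and the Lipschitz bound carries this to the limit. This is the only form of the divergence theorem
  in the proof; the exceptional null set admits kernels with a kink along a sphere.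
\<close>

lemma integral_dirderiv_eq_0:
  fixes h :: "'a::euclidean_space \<Rightarrow> 'b::euclidean_space"
  assumes int: "integrable lborel h"
    and supp: "\<And>z. norm z > r \<Longrightarrow> h z = 0"
    and lip: "\<And>z s. \<bar>s\<bar> \<le> d \<Longrightarrow> norm (h (z + s *\<^sub>R e) - h z) \<le> L * \<bar>s\<bar>" and "d > 0"
    and [measurable]: "h' \<in> borel_measurable borel"
    and der: "AE z in lborel. has_dirderiv h z e (h' z)"
  shows "integral\<^sup>L lborel h' = 0"
proof -
  define s where "s n = d / real (Suc n)" for n
  have s0: "s n > 0" "s n \<le> d" for n
    using \<open>d > 0\<close> by (auto simp: s_def field_simps)
  have s: "s \<longlonglongrightarrow> 0"
    unfolding s_def by (rule LIMSEQ_Suc) (rule tendsto_divide_0, auto intro: tendsto_intros filterlim_real_sequentially filterlim_at_top_imp_at_infinity)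
  define q where "q n z = (1 / s n) *\<^sub>R (h (z + s n *\<^sub>R e) - h z)" for n z
  have [measurable]: "h \<in> borel_measurable borel" using int by auto
  have ints: "integrable lborel (\<lambda>z. h (z + s n *\<^sub>R e))" for n
    using integrable_shift[OF int, of "s n *\<^sub>R e"] by (simp add: add.commute)
  have q0: "integral\<^sup>L lborel (q n) = 0" for n
    using integral_shift[of h "s n *\<^sub>R e"] ints int
    by (simp add: q_def[abs_def] add.commute)
  let ?w = "\<lambda>z::'a. \<bar>L\<bar> * indicator (cball 0 (r + d * norm e)) z"
  have qw: "norm (q n z) \<le> ?w z" for n z
  proof (cases "norm z \<le> r + d * norm e")
    case True
    have "norm (q n z) \<le> (1 / s n) * (L * s n)"
      using lip[of "s n" z] s0[of n]
      unfolding q_def by (simp add: pos_divide_le_eq)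
    also have "\<dots> = L" using s0[of n] by simp
    finally show ?thesis using True by (auto simp: indicator_def)
  next
    case False
    have a: "h z = 0" using False \<open>d > 0\<close>
      by (intro supp) (smt (verit) mult_nonneg_nonneg norm_ge_zero)
    have "norm z - norm (s n *\<^sub>R e) \<le> norm (z + s n *\<^sub>R e)"
      by (metis add_diff_cancel norm_triangle_ineq2 norm_minus_cancel diff_conv_add_uminus
          add_uminus_conv_diff norm_diff_ineq)
    moreover have "norm (s n *\<^sub>R e) \<le> d * norm e" using s0[of n] by (simp add: mult_right_mono)
    ultimately have "h (z + s n *\<^sub>R e) = 0" using False by (intro supp) auto
    then show ?thesis using a by (simp add: q_def)
  qed
  have "(\<lambda>n. integral\<^sup>L lborel (q n)) \<longlonglongrightarrow> integral\<^sup>L lborel h'"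
  proof (rule integral_dominated_convergence[where w = ?w])
    show "q n \<in> borel_measurable lborel" for n unfolding q_def[abs_def] by measurable
    show "integrable lborel ?w" 
      by (intro integrable_mult_right integrable_real_indicator) (use emeasure_bounded_finite[OF bounded_cball, of 0 "r + d * norm e"] in auto)
    show "AE z in lborel. (\<lambda>n. q n z) \<longlonglongrightarrow> h' z"
      using der
    proof (rule AE_mp, intro AE_I2 impI)
      fix z assume "has_dirderiv h z e (h' z)"
      then show "(\<lambda>n. q n z) \<longlonglongrightarrow> h' z"
        unfolding has_dirderiv_iff_tendsto q_def
        by (rule filterlim_compose) (use s s0 in \<open>auto simp: filterlim_at less_imp_neq[symmetric]\<close>)
    qed
  qed (use qw in auto)
  then show ?thesis by (simp add: q0 LIMSEQ_const_iff)
qed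

lemma continuous_on_compact_norm_bound:
  fixes f :: "'a::topological_space \<Rightarrow> 'b::real_normed_vector"
  assumes "continuous_on K f" "compact K"
  obtains B where "B \<ge> 0" "\<And>y. y \<in> K \<Longrightarrow> norm (f y) \<le> B"
proof -
  have "bounded (f ` K)" using assms by (intro compact_imp_bounded compact_continuous_image)
  then obtain B where "B > 0" "\<forall>y\<in>f ` K. norm y \<le> B" by (auto simp: bounded_pos)
  then show ?thesis using that[of B] by auto
qed

text \<open>
  A correlation rather than a convolution: its kernel is $a(y - x)$, as in the Teodorescu transform,
  and the function $f$ enters without a reflection.
\<close>

definition corr :: "('a::euclidean_space \<Rightarrow> real) \<Rightarrow> ('a \<Rightarrow> 'b::euclidean_space) \<Rightarrow> 'a \<Rightarrow> 'b"  (infixl "\<star>" 75)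
  where "(a \<star> f) x = (\<integral>z. a z *\<^sub>R f (x + z) \<partial>lborel)"

lemma continuous_bounded_on_cball:
  fixes f :: "'a::euclidean_space \<Rightarrow> 'b::real_normed_vector"
  assumes "continuous_on UNIV f"
  obtains B where "B \<ge> 0" "\<And>y. y \<in> cball x r \<Longrightarrow> norm (f y) \<le> B"
  using continuous_on_compact_norm_bound[OF continuous_on_subset[OF assms subset_UNIV] compact_cball] by blast

lemma shift_mult_measurable:
  fixes f :: "'a::euclidean_space \<Rightarrow> 'b::euclidean_space"
  assumes [measurable]: "a \<in> borel_measurable borel" and supp: "\<And>z. norm z > r \<Longrightarrow> a z = 0"
    and f: "continuous_on (cball x r) f"
  shows "(\<lambda>z. a z *\<^sub>R f (x + z)) \<in> borel_measurable borel"
proof -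
  have cont: "continuous_on (cball 0 r) (\<lambda>z. f (x + z))"
    by (rule continuous_on_compose2[OF f]) (auto intro!: continuous_intros simp: dist_norm)
  have [measurable]: "(\<lambda>z. indicator (cball 0 r) z *\<^sub>R f (x + z)) \<in> borel_measurable borel"
    by (rule borel_measurable_continuous_on_indicator) (use cont in auto)
  have eq: "(\<lambda>z. a z *\<^sub>R f (x + z)) = (\<lambda>z. a z *\<^sub>R (indicator (cball 0 r) z *\<^sub>R f (x + z)))"
  proof
    fix z show "a z *\<^sub>R f (x + z) = a z *\<^sub>R (indicator (cball 0 r) z *\<^sub>R f (x + z))" 
      using supp[of z] by (cases "norm z \<le> r") (auto simp: indicator_def)
  qed
  show ?thesis unfolding eq by measurable
qed

lemma integrable_shift_mult:
  fixes f :: "'a::euclidean_space \<Rightarrow> 'b::euclidean_space"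
  assumes a: "integrable lborel a" and supp: "\<And>z. norm z > r \<Longrightarrow> a z = 0"
    and f: "continuous_on (cball x r) f"
  shows "integrable lborel (\<lambda>z. a z *\<^sub>R f (x + z))"
proof -
  obtain B where B: "B \<ge> 0" "\<And>y. y \<in> cball x r \<Longrightarrow> norm (f y) \<le> B"
    using continuous_on_compact_norm_bound[OF f compact_cball] by blast
  show ?thesis
  proof (rule Bochner_Integration.integrable_bound)
    show "integrable lborel (\<lambda>z. B * a z)" using a by simp
    show "(\<lambda>z. a z *\<^sub>R f (x + z)) \<in> borel_measurable lborel"
      using shift_mult_measurable[OF _ supp f] a by simp
    have "norm (a z *\<^sub>R f (x + z)) \<le> norm (B * a z)" for z
    proof (cases "norm z > r")
      case False
      then have "norm (f (x + z)) \<le> B" by (intro B(2)) (simp add: dist_norm)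
      then show ?thesis using B(1) mult_right_mono[of "norm (f (x + z))" B "\<bar>a z\<bar>"]
        by (simp add: abs_mult mult.commute)
    qed (use supp in simp)
    then show "AE z in lborel. norm (a z *\<^sub>R f (x + z)) \<le> norm (B * a z)" by simp
  qed
qed

lemma integrable_bounded_support:
  fixes a :: "'a::euclidean_space \<Rightarrow> real"
  assumes "a \<in> borel_measurable borel" "\<And>z. norm z > r \<Longrightarrow> a z = 0" "\<And>z. \<bar>a z\<bar> \<le> B"
  shows "integrable lborel a"
  by (rule integrableI_bounded_set[where A = "cball 0 r" and B = B])
    (use assms emeasure_bounded_finite[OF bounded_cball, of 0 r] in auto)

text \<open>
  The product $a(z) f(x+z)$ vanishes for $|z| \ge r$, so \<open>integral_dirderiv_eq_0\<close> applies to it although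
  $f$ is given only near $x$. Differentiability of the kernel almost everywhere is all that the
  field of a charged ball offers.
\<close>

lemma corr_by_parts:
  fixes f :: "'a::euclidean_space \<Rightarrow> 'b::euclidean_space"
  assumes "0 < r" "r < R"
    and [measurable]: "a \<in> borel_measurable borel"
    and supp: "\<And>z. norm z \<ge> r \<Longrightarrow> a z = 0"
    and lip: "\<And>z s. norm z < r \<Longrightarrow> \<bar>s\<bar> \<le> 1 \<Longrightarrow> \<bar>a (z + s *\<^sub>R e) - a z\<bar> \<le> L * \<bar>s\<bar>"
    and abound: "\<And>z. \<bar>a z\<bar> \<le> A"
    and [measurable]: "a' \<in> borel_measurable borel"
    and supp': "\<And>z. norm z \<ge> r \<Longrightarrow> a' z = 0"
    and bound': "\<And>z. \<bar>a' z\<bar> \<le> L"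
    and der: "AE z in lborel. has_dirderiv a z e (a' z)"
    and f: "\<And>y. y \<in> ball x R \<Longrightarrow> has_dirderiv f y e (f' y)"
    and cont: "continuous_on (ball x R) f" and cont': "continuous_on (ball x R) f'"
  shows "(a \<star> f') x = - (a' \<star> f) x"
proof -
  \<comment> \<open>A radius strictly between $r$ and $R$: its closed ball is compact, and it leaves room for
    small translations of the support of the kernel.\<close>
  define R1 where "R1 = (r + R) / 2"
  have R1: "r < R1" "R1 < R" "0 < R1" using assms(1,2) by (auto simp: R1_def)
  have sub: "cball x R1 \<subseteq> ball x R" using R1 by auto
  obtain B where B0: "0 \<le> B" and B: "\<And>y. y \<in> cball x R1 \<Longrightarrow> norm (f y) \<le> B"
    using continuous_on_compact_norm_bound[OF continuous_on_subset[OF cont sub] compact_cball] by blast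
  obtain B' where B'0: "0 \<le> B'" and B': "\<And>y. y \<in> cball x R1 \<Longrightarrow> norm (f' y) \<le> B'"
    using continuous_on_compact_norm_bound[OF continuous_on_subset[OF cont' sub] compact_cball] by blast
  have L0: "0 \<le> L" using bound'[of 0] by linarith
  have A0: "0 \<le> A" using abound[of 0] by linarith
  define d where "d = min 1 ((R1 - r) / (1 + norm e))"
  have d: "d > 0" "d \<le> 1" using R1 by (auto simp: d_def add_pos_nonneg)
  have "d * norm e \<le> (R1 - r) / (1 + norm e) * (1 + norm e)"
    using R1 by (intro mult_mono) (auto simp: d_def)
  also have "\<dots> = R1 - r" using add_pos_nonneg[OF zero_less_one norm_ge_zero[of e]] by simp
  finally have de: "d * norm e \<le> R1 - r" .
  define h where "h z = a z *\<^sub>R f (x + z)" for z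
  have cr: "cball x r \<subseteq> ball x R" using assms by auto
  have ia: "integrable lborel a"
    by (rule integrable_bounded_support[where r=r, OF _ _ abound]) (use supp in auto)
  have ia': "integrable lborel a'"
    by (rule integrable_bounded_support[where r=r, OF _ _ bound']) (use supp' in auto)
  have int: "integrable lborel h" 
    unfolding h_def[abs_def]
    by (rule integrable_shift_mult[where r=r]) (use ia supp continuous_on_subset[OF cont cr] in auto)
  have i1: "integrable lborel (\<lambda>z. a' z *\<^sub>R f (x + z))"
    by (rule integrable_shift_mult[where r=r]) (use ia' supp' continuous_on_subset[OF cont cr] in auto)
  have i2: "integrable lborel (\<lambda>z. a z *\<^sub>R f' (x + z))"
    by (rule integrable_shift_mult[where r=r]) (use ia supp continuous_on_subset[OF cont' cr] in auto)
  have lip_in: "norm (h (z + s *\<^sub>R e) - h z) \<le> (L * B + A * B') * \<bar>s\<bar>"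
    if s: "\<bar>s\<bar> \<le> d" and z: "norm z < r" for s z
  proof -
    have seg: "x + z + t *\<^sub>R e \<in> cball x R1" if "t \<in> closed_segment 0 s" for t
    proof -
      have "\<bar>t\<bar> \<le> d" using that s by (auto simp: closed_segment_eq_real_ivl split: if_splits)
      then have "norm (t *\<^sub>R e) \<le> R1 - r" using de mult_right_mono[of "\<bar>t\<bar>" d "norm e"] by simp
      then have "norm (z + t *\<^sub>R e) \<le> R1" using z norm_triangle_ineq[of z "t *\<^sub>R e"] by linarith
      then have "x + (z + t *\<^sub>R e) \<in> cball x R1" by (metis add_diff_cancel_left' dist_commute dist_norm mem_cball)
      then show ?thesis by (simp add: add.assoc)
    qed
    have "norm (f (x + z + s *\<^sub>R e) - f (x + z)) \<le> B' * \<bar>s\<bar>"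
    proof (rule has_dirderiv_bound[where f'=f'])
      fix t assume t: "t \<in> closed_segment 0 s"
      show "has_dirderiv f (x + z + t *\<^sub>R e) e (f' (x + z + t *\<^sub>R e))"
        using f seg[OF t] sub by blast
      show "norm (f' (x + z + t *\<^sub>R e)) \<le> B'" using B' seg[OF t] by blast
    qed
    moreover have "norm (f (x + z + s *\<^sub>R e)) \<le> B" using B[OF seg[of s]] by simp
    moreover have "h (z + s *\<^sub>R e) - h z = (a (z + s *\<^sub>R e) - a z) *\<^sub>R f (x + z + s *\<^sub>R e)
         + a z *\<^sub>R (f (x + z + s *\<^sub>R e) - f (x + z))"
      by (simp add: h_def algebra_simps)
    then have "norm (h (z + s *\<^sub>R e) - h z) \<le> \<bar>a (z + s *\<^sub>R e) - a z\<bar> * norm (f (x + z + s *\<^sub>R e))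
         + \<bar>a z\<bar> * norm (f (x + z + s *\<^sub>R e) - f (x + z))"
      by (metis norm_triangle_ineq norm_scaleR)
    moreover have "\<bar>a (z + s *\<^sub>R e) - a z\<bar> * norm (f (x + z + s *\<^sub>R e)) \<le> (L * \<bar>s\<bar>) * B"
      by (intro mult_mono lip) (use L0 calculation(2) s z d in auto)
    moreover have "\<bar>a z\<bar> * norm (f (x + z + s *\<^sub>R e) - f (x + z)) \<le> A * (B' * \<bar>s\<bar>)"
      by (intro mult_mono) (use A0 calculation(1) abound in auto)
    ultimately show ?thesis by (simp add: algebra_simps)
  qed
  have "integral\<^sup>L lborel (\<lambda>z. a' z *\<^sub>R f (x + z) + a z *\<^sub>R f' (x + z)) = 0"
  proof (rule integral_dirderiv_eq_0[where h = h and r = r and e = e, OF int _ _ d(1)])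
    show "h z = 0" if "norm z > r" for z using supp[of z] that by (simp add: h_def)
    show "norm (h (z + s *\<^sub>R e) - h z) \<le> (L * B + A * B') * \<bar>s\<bar>" if s: "\<bar>s\<bar> \<le> d" for s z
    proof -
      \<comment> \<open>If only the translated point lies in the support, translate back from it.\<close>
      consider "norm z < r" | "norm (z + s *\<^sub>R e) < r" | "norm z \<ge> r" "norm (z + s *\<^sub>R e) \<ge> r" by linarith
      then show ?thesis
      proof cases
        case 1 then show ?thesis using lip_in s by auto
      next
        case 2 then show ?thesis using lip_in[of "- s" "z + s *\<^sub>R e"] s by (simp add: norm_minus_commute)
      next
        case 3 then show ?thesis using supp L0 B0 A0 B'0 by (simp add: h_def)
      qed
    qed
    show "(\<lambda>z. a' z *\<^sub>R f (x + z) + a z *\<^sub>R f' (x + z)) \<in> borel_measurable borel"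
      using borel_measurable_integrable[OF i1] borel_measurable_integrable[OF i2] by simp
    show "AE z in lborel. has_dirderiv h z e (a' z *\<^sub>R f (x + z) + a z *\<^sub>R f' (x + z))"
      using der
    proof (rule AE_mp, intro AE_I2 impI)
      fix z assume der: "has_dirderiv a z e (a' z)"
      show "has_dirderiv h z e (a' z *\<^sub>R f (x + z) + a z *\<^sub>R f' (x + z))"
      proof (cases "norm z > r")
        case True
        have "has_dirderiv (\<lambda>z. 0) z e (0::'b)" by (simp add: has_dirderiv_def)
        moreover have "open {z::'a. norm z > r}" by (intro open_Collect_less continuous_intros)
        ultimately have "has_dirderiv h z e 0"
          by (rule has_dirderiv_cong_open) (use True supp in \<open>auto simp: h_def\<close>)
        then show ?thesis using True supp supp' by simp
      next
        case False
        then have "x + z \<in> ball x R" using assms(2) by (simp add: dist_norm)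
        from f[OF this] have "has_dirderiv (\<lambda>z. f (x + z)) z e (f' (x + z))"
          by (simp add: has_dirderiv_def add.assoc)
        from has_dirderiv_scaleR[OF der this] show ?thesis unfolding h_def[abs_def] .
      qed
    qed
  qed
  then show ?thesis using i1 i2 unfolding corr_def by (simp add: eq_neg_iff_add_eq_0 add.commute)
qed

lemma corr_by_parts_C1:
  fixes f :: "'a::euclidean_space \<Rightarrow> 'b::euclidean_space"
  assumes "0 < r" "r < R"
    and supp: "\<And>z. norm z \<ge> r \<Longrightarrow> a z = 0" and supp': "\<And>z. norm z \<ge> r \<Longrightarrow> a' z = 0"
    and der: "\<And>z. has_dirderiv a z e (a' z)"
    and ca: "continuous_on UNIV a" and ca': "continuous_on UNIV a'"
    and f: "\<And>y. y \<in> ball x R \<Longrightarrow> has_dirderiv f y e (f' y)"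
    and cont: "continuous_on (ball x R) f" and cont': "continuous_on (ball x R) f'"
  shows "(a \<star> f') x = - (a' \<star> f) x"
proof -
  obtain A where A: "A \<ge> 0" "\<And>z. z \<in> cball 0 r \<Longrightarrow> norm (a z) \<le> A"
    using continuous_bounded_on_cball[OF ca] by blast
  obtain L where L: "L \<ge> 0" "\<And>z. z \<in> cball 0 (r + norm e) \<Longrightarrow> norm (a' z) \<le> L"
    using continuous_bounded_on_cball[OF ca'] by blast
  show ?thesis
  proof (rule corr_by_parts[OF assms(1,2) _ supp _ _ _ supp' _ _ f cont cont'])
    show "a \<in> borel_measurable borel" "a' \<in> borel_measurable borel"
      using ca ca' by (auto intro: borel_measurable_continuous_onI)
    show "\<bar>a z\<bar> \<le> A" for z using A supp[of z] by (cases "norm z \<le> r") auto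
    show "\<bar>a' z\<bar> \<le> L" for z 
      using L(1) L(2)[of z] supp'[of z] norm_ge_zero[of e] by (cases "norm z \<le> r") auto
    show "AE z in lborel. has_dirderiv a z e (a' z)" using der by simp
    show "\<bar>a (z + s *\<^sub>R e) - a z\<bar> \<le> L * \<bar>s\<bar>" if z: "norm z < r" and s: "\<bar>s\<bar> \<le> 1" for z s
    proof -
      have "norm (a' (z + t *\<^sub>R e)) \<le> L" if "t \<in> closed_segment 0 s" for t
      proof (rule L(2))
        have "\<bar>t\<bar> \<le> 1" using that s by (auto simp: closed_segment_eq_real_ivl split: if_splits)
        then have "norm (t *\<^sub>R e) \<le> norm e" using mult_right_mono[of "\<bar>t\<bar>" 1 "norm e"] by simp
        then show "z + t *\<^sub>R e \<in> cball 0 (r + norm e)"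
          using z norm_triangle_ineq[of z "t *\<^sub>R e"] by simp
      qed
      then show ?thesis
        using has_dirderiv_bound[where f = a and f' = a' and s = s and x = z and e = e and B = L] der by simp
    qed
  qed
qed

section \<open>The Newton field and its smoothings\<close>

text \<open>
  In terms of $s = |z|^2$ the field $z / |z|^3$ has the profile $s^{-3/2}$. Inside the unit ball it is
  replaced by its Taylor polynomial at $s = 1$. The degree 3 makes the divergence of the smoothed
  field vanish to third order at the unit sphere, which is the smoothness that two derivatives of
  it require.
\<close>

definition profile :: "real \<Rightarrow> real" where
  "profile s = (if s \<in> {..1} then 1 + 3/2 * (1 - s) + 15/8 * (1 - s)^2 + 35/16 * (1 - s)^3
     else s powr (-3/2))"

definition profile' :: "real \<Rightarrow> real" where
  "profile' s = (if s \<in> {..1} then - (3/2 + 15/4 * (1 - s) + 105/16 * (1 - s)^2)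
     else (-3/2) * s powr (-5/2))"

lemma profile_deriv: "(profile has_real_derivative profile' s) (at s)"
proof -
  have "((\<lambda>s. if s \<in> {..1} then 1 + 3/2 * (1 - s) + 15/8 * (1 - s)^2 + 35/16 * (1 - s)^3
     else s powr (-3/2)) has_vector_derivative (if s \<in> {..1} then - (3/2 + 15/4 * (1 - s) + 105/16 * (1 - s)^2)
     else (-3/2) * s powr (-5/2))) (at s within UNIV)"
    apply (rule has_vector_derivative_If_within_closures[where T = "{1<..}"])
    subgoal by auto
    subgoal by auto
    subgoal unfolding has_real_derivative_iff_has_vector_derivative[symmetric]
      by (rule derivative_eq_intros refl)+ (simp add: field_simps power2_eq_square)
    subgoal unfolding has_real_derivative_iff_has_vector_derivative[symmetric]
      by (auto intro!: derivative_eq_intros)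
    by auto
  then show ?thesis
    by (simp add: has_real_derivative_iff_has_vector_derivative profile_def[abs_def] profile'_def)
qed

lemma continuous_profile': "continuous_on UNIV profile'"
proof -
  have "continuous_on ({..1} \<union> {1..}) profile'"
    unfolding profile'_def[abs_def]
    by (rule continuous_on_cases) (auto intro!: continuous_intros)
  moreover have "{..1} \<union> {1..} = (UNIV :: real set)" by auto
  ultimately show ?thesis by simp
qed

text \<open>
  The left side is the divergence of $z \mapsto f(|z|^2)\, z$ for the profile $f$. Outside the unit ball it
  is 0 since $z / |z|^3$ is divergence free; inside, the choice of the Taylor coefficients cancels all
  powers of $1 - s$ below the third.
\<close>

lemma profile_identity: "3 * profile s + 2 * s * profile' s = 315/16 * max 0 (1 - s) ^ 3"
proof (cases "s \<le> 1")
  case True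
  then show ?thesis by (simp add: profile_def profile'_def max_def field_simps power2_eq_square power3_eq_cube)
next
  case False
  then have "s * s powr (-5/2) = s powr (-3/2)"
    using powr_add[of s 1 "-5/2"] by simp
  then show ?thesis using False by (simp add: profile_def profile'_def max_def mult.assoc)
qed

lemma pos_part_power_deriv:
  assumes "n \<ge> 2"
  shows "((\<lambda>t::real. max 0 t ^ n) has_real_derivative real n * max 0 t ^ (n - 1)) (at t)"
proof -
  have "((\<lambda>t. if t \<in> {..0} then 0 else t ^ n) has_vector_derivative
      (if t \<in> {..0} then 0 else real n * t ^ (n - 1))) (at t within UNIV)"
    apply (rule has_vector_derivative_If_within_closures[where T = "{0<..}"])
    subgoal by auto
    subgoal by auto
    subgoal by simp
    subgoal unfolding has_real_derivative_iff_has_vector_derivative[symmetric]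
      by (rule derivative_eq_intros refl | simp)+
    using assms by auto
  moreover have "(\<lambda>t::real. if t \<in> {..0} then 0 else t ^ n) = (\<lambda>t. max 0 t ^ n)"
    using assms by (auto simp: fun_eq_iff max_def)
  moreover have "(if t \<in> {..0} then 0 else real n * t ^ (n - 1)) = real n * max 0 t ^ (n - 1)"
    using assms by (auto simp: max_def)
  ultimately show ?thesis by (simp add: has_real_derivative_iff_has_vector_derivative)
qed

definition kronecker :: "'n \<Rightarrow> 'n \<Rightarrow> real" where "kronecker j k = (if j = k then 1 else 0)"

lemma norm_sq_components: "norm (z::real^3) ^ 2 = z$1 * z$1 + z$2 * z$2 + z$3 * z$3"
  by (simp add: norm_eq_sqrt_inner inner_vec_def sum_3)

lemma norm_sq_dirderiv: "has_dirderiv (\<lambda>z::real^'n. norm z ^ 2) z (axis j 1) (2 * z$j)"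
proof -
  have "(\<lambda>h. norm (z + h *\<^sub>R axis j 1) ^ 2) = (\<lambda>h. norm z ^ 2 + 2 * h * z$j + h^2)"
    by (rule ext) (simp only: power2_norm_eq_inner, simp add: inner_add_left inner_add_right inner_axis inner_axis' power2_eq_square algebra_simps)
  then show ?thesis
    unfolding has_dirderiv_def has_real_derivative_iff_has_vector_derivative[symmetric]
    by (auto intro!: derivative_eq_intros)
qed

lemma component_dirderiv: "has_dirderiv (\<lambda>z::real^'n. z$k) z (axis j 1) (kronecker j k)"
proof -
  have "(\<lambda>h. (z + h *\<^sub>R axis j 1) $ k) = (\<lambda>h. z$k + h * kronecker j k)"
    by (auto simp: fun_eq_iff axis_def kronecker_def)
  then show ?thesis
    unfolding has_dirderiv_def has_real_derivative_iff_has_vector_derivative[symmetric]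
    by (auto intro!: derivative_eq_intros)
qed

lemma has_dirderiv_real_chain:
  assumes "(g has_real_derivative g') (at (f x))" "has_dirderiv f x e f'"
  shows "has_dirderiv (\<lambda>y. g (f y)) x e (g' * f')"
  using DERIV_chain2[of g g' "\<lambda>h. f (x + h *\<^sub>R e)" 0 f' UNIV] assms
  unfolding has_dirderiv_def has_real_derivative_iff_has_vector_derivative[symmetric] by simp

text \<open>
  The gradient of $1 / (4 \pi |z|)$, that is, the components of the Cauchy kernel.
\<close>

definition newton_field :: "3 \<Rightarrow> real^3 \<Rightarrow> real" where
  "newton_field k z = - z$k / (4 * pi * norm z ^ 3)"

text \<open>
  The Newton field with its singularity smoothed out inside the ball of radius $r$.
\<close>

definition smooth_field :: "real \<Rightarrow> 3 \<Rightarrow> real^3 \<Rightarrow> real" where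
  "smooth_field r k z = - (1 / (4 * pi * r^3)) * (z$k * profile (norm z ^ 2 / r^2))"

text \<open>
  In the derivatives of the kernels below, the first index is the direction of differentiation.
\<close>

definition smooth_field' :: "real \<Rightarrow> 3 \<Rightarrow> 3 \<Rightarrow> real^3 \<Rightarrow> real" where
  "smooth_field' r j k z = - (1 / (4 * pi * r^3)) *
     (kronecker j k * profile (norm z ^ 2 / r^2) + z$k * (profile' (norm z ^ 2 / r^2) * (2 * z$j / r^2)))"

text \<open>
  Minus the divergence of the smoothed field: the smooth charge density in the ball of radius $r$ that
  produces this field.
\<close>

definition bump :: "real \<Rightarrow> real^3 \<Rightarrow> real" where
  "bump r z = 315 / (64 * pi * r^3) * max 0 (1 - norm z ^ 2 / r^2) ^ 3"

definition bump' :: "real \<Rightarrow> 3 \<Rightarrow> real^3 \<Rightarrow> real" where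
  "bump' r k z = 315 / (64 * pi * r^3) * (3 * max 0 (1 - norm z ^ 2 / r^2) ^ 2 * (- (2 * z$k / r^2)))"

definition bump'' :: "real \<Rightarrow> 3 \<Rightarrow> 3 \<Rightarrow> real^3 \<Rightarrow> real" where
  "bump'' r j k z = 315 / (64 * pi * r^3) *
     (3 * (2 * max 0 (1 - norm z ^ 2 / r^2) * (- (2 * z$j / r^2))) * (- (2 * z$k / r^2))
      + 3 * max 0 (1 - norm z ^ 2 / r^2) ^ 2 * (- (2 * kronecker j k / r^2)))"

text \<open>
  The field of a uniformly charged ball of radius $d$. Its total charge is known from the volume of the
  ball alone, which fixes the normalization $1 / (4 \pi)$ in the limit $d \to 0$.
\<close>

definition reg_field :: "real \<Rightarrow> 3 \<Rightarrow> real^3 \<Rightarrow> real" where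
  "reg_field d k z = - z$k / (4 * pi * max (norm z) d ^ 3)"

definition reg_field' :: "real \<Rightarrow> 3 \<Rightarrow> 3 \<Rightarrow> real^3 \<Rightarrow> real" where
  "reg_field' d j k z = (if norm z < d then - kronecker j k / (4 * pi * d^3)
     else (3 * z$j * z$k - norm z ^ 2 * kronecker j k) / (4 * pi * norm z ^ 5))"

lemma smooth_field_dirderiv:
  "r > 0 \<Longrightarrow> has_dirderiv (smooth_field r k) z (axis j 1) (smooth_field' r j k z)"
proof -
  assume r: "r > 0"
  have 1: "has_dirderiv (\<lambda>z. norm z ^ 2 / r^2) z (axis j 1) (2 * z$j / r^2)"
    by (rule has_dirderiv_bounded_linear[OF bounded_linear_divide norm_sq_dirderiv])
  note 2 = has_dirderiv_real_chain[OF profile_deriv 1]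
  note 3 = has_dirderiv_scaleR[OF component_dirderiv[of k z j] 2]
  note 4 = has_dirderiv_bounded_linear[OF bounded_linear_mult_right 3, of "- (1 / (4 * pi * r^3))"]
  then show ?thesis by (simp add: smooth_field_def[abs_def] smooth_field'_def)
qed

lemma bump_dirderiv:
  "r > 0 \<Longrightarrow> has_dirderiv (bump r) z (axis k 1) (bump' r k z)"
proof -
  assume r: "r > 0"
  have 1: "has_dirderiv (\<lambda>z. 1 - norm z ^ 2 / r^2) z (axis k 1) (- (2 * z$k / r^2))"
    using has_dirderiv_diff[of "\<lambda>_. 1" z "axis k 1" 0,
        OF _ has_dirderiv_bounded_linear[OF bounded_linear_divide[of "r^2"] norm_sq_dirderiv]]
    by (simp add: has_dirderiv_def)
  note 2 = has_dirderiv_real_chain[OF pos_part_power_deriv[of 3] 1]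
  note 3 = has_dirderiv_bounded_linear[OF bounded_linear_mult_right 2, of "315 / (64 * pi * r^3)"]
  then show ?thesis unfolding bump_def[abs_def] bump'_def by simp
qed

lemma bump'_dirderiv:
  "r > 0 \<Longrightarrow> has_dirderiv (bump' r k) z (axis j 1) (bump'' r j k z)"
proof -
  assume r: "r > 0"
  have 1: "has_dirderiv (\<lambda>z. 1 - norm z ^ 2 / r^2) z (axis j 1) (- (2 * z$j / r^2))"
    using has_dirderiv_diff[of "\<lambda>_. 1" z "axis j 1" 0,
        OF _ has_dirderiv_bounded_linear[OF bounded_linear_divide[of "r^2"] norm_sq_dirderiv]]
    by (simp add: has_dirderiv_def)
  note 2 = has_dirderiv_bounded_linear[OF bounded_linear_mult_right
      has_dirderiv_real_chain[OF pos_part_power_deriv[of 2] 1], of 3]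
  have 3: "has_dirderiv (\<lambda>z. - (2 * z$k / r^2)) z (axis j 1) (- (2 * kronecker j k / r^2))"
    using has_dirderiv_bounded_linear[OF bounded_linear_mult_right component_dirderiv, of "- (2 / r^2)" k z j]
    by simp
  note 4 = has_dirderiv_bounded_linear[OF bounded_linear_mult_right
      has_dirderiv_scaleR[OF 2 3], of "315 / (64 * pi * r^3)"]
  then show ?thesis unfolding bump'_def[abs_def] bump''_def by simp
qed

lemma smooth_field_eq:
  assumes "r > 0" "norm z \<ge> r"
  shows "smooth_field r k z = newton_field k z"
proof -
  have p: "profile (norm z ^ 2 / r^2) = r^3 / norm z ^ 3"
  proof (cases "norm z = r")
    case True then show ?thesis using assms by (simp add: profile_def)
  next
    case False
    with assms have z: "norm z > r" "norm z > 0" by auto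
    then have gt: "norm z ^ 2 / r^2 > 1" using assms
      by (simp add: power_strict_mono)
    have "norm z ^ 2 / r^2 = (norm z / r) powr 2"
      using powr_numeral[of "norm z / r" "num.Bit0 num.One"] z assms by (simp add: power_divide)
    then have "profile (norm z ^ 2 / r^2) = ((norm z / r) powr 2) powr (-3/2)"
      using gt by (simp add: profile_def)
    also have "\<dots> = (norm z / r) powr (-3)" by (simp add: powr_powr)
    also have "\<dots> = 1 / (norm z / r) ^ 3"
      using z assms by (simp add: powr_minus_divide flip: powr_numeral)
    also have "\<dots> = r^3 / norm z ^ 3" by (simp add: power_divide)
    finally show ?thesis .
  qed
  show ?thesis unfolding smooth_field_def newton_field_def p using assms by simp
qed

lemma smooth_field'_sym: "smooth_field' r j k z = smooth_field' r k j z"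
  by (simp add: smooth_field'_def kronecker_def algebra_simps)

lemma reg_field'_sym: "reg_field' d j k z = reg_field' d k j z"
  by (simp add: reg_field'_def kronecker_def algebra_simps)

lemma bump''_sym: "bump'' r j k z = bump'' r k j z"
  by (simp add: bump''_def kronecker_def algebra_simps)

lemma smooth_field_div:
  assumes "r > 0" shows "(\<Sum>k\<in>UNIV. smooth_field' r k k z) = - bump r z"
proof -
  define s where "s = norm z ^ 2 / r^2"
  have n3: "norm z ^ 2 = z$1 * z$1 + z$2 * z$2 + z$3 * z$3" by (rule norm_sq_components)
  have "(\<Sum>k\<in>UNIV. smooth_field' r k k z) = - (1 / (4 * pi * r^3)) *
      (3 * profile s + 2 * ((z$1 * z$1 + z$2 * z$2 + z$3 * z$3) / r^2) * profile' s)"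
    unfolding smooth_field'_def sum_3 s_def[symmetric] kronecker_def
    by (simp add: algebra_simps add_divide_distrib)
  also have "\<dots> = - (1 / (4 * pi * r^3)) * (315/16 * max 0 (1 - s) ^ 3)"
    unfolding n3[symmetric] s_def[symmetric] profile_identity ..
  also have "\<dots> = - bump r z" by (simp add: bump_def s_def)
  finally show ?thesis .
qed

lemma reg_field_div:
  assumes "d > 0" shows "(\<Sum>k\<in>UNIV. reg_field' d k k z) = (if norm z < d then - 3 / (4 * pi * d^3) else 0)"
proof (cases "norm z < d")
  case True then show ?thesis using assms by (simp add: reg_field'_def sum_3 kronecker_def)
next
  case False
  have "(\<Sum>k\<in>UNIV. reg_field' d k k z) = (3 * (z$1 * z$1 + z$2 * z$2 + z$3 * z$3) - 3 * norm z ^ 2) / (4 * pi * norm z ^ 5)"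
    using False by (simp add: reg_field'_def sum_3 kronecker_def flip: add_divide_distrib)
  then show ?thesis using False by (simp add: norm_sq_components)
qed

lemma reg_field_dirderiv:
  assumes "d > 0" "norm z \<noteq> d"
  shows "has_dirderiv (reg_field d k) z (axis j 1) (reg_field' d j k z)"
proof (cases "norm z < d")
  case True
  have "has_dirderiv (\<lambda>z. - z$k / (4 * pi * d^3)) z (axis j 1) (- kronecker j k / (4 * pi * d^3))"
    using has_dirderiv_bounded_linear[OF bounded_linear_mult_right component_dirderiv, of "- 1 / (4 * pi * d^3)" k z j]
    by simp
  then have "has_dirderiv (reg_field d k) z (axis j 1) (- kronecker j k / (4 * pi * d^3))"
    by (rule has_dirderiv_cong_open[where S = "{z. norm z < d}"])
      (use True in \<open>auto simp: reg_field_def max_def intro!: open_Collect_less continuous_intros\<close>)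
  then show ?thesis using True by (simp add: reg_field'_def)
next
  case False
  with assms have z: "norm z > d" "norm z > 0" by auto
  have p: "((\<lambda>s. s powr (-3/2)) has_real_derivative (-3/2) * (norm z ^ 2) powr (-5/2)) (at (norm z ^ 2))"
    using z by (auto intro!: derivative_eq_intros)
  have pw: "(w ^ 2) powr (-3/2) = 1 / w ^ 3" "(w ^ 2) powr (-5/2) = 1 / w ^ 5" if "w > 0" for w :: real
  proof -
    have "(w ^ 2) powr (-3/2) = w powr (-3)" "(w ^ 2) powr (-5/2) = w powr (-5)"
      using that powr_powr[of w 2 "-3/2"] powr_powr[of w 2 "-5/2"] by simp_all
    then show "(w ^ 2) powr (-3/2) = 1 / w ^ 3" "(w ^ 2) powr (-5/2) = 1 / w ^ 5"
      using that by (simp_all add: powr_minus_divide)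
  qed
  note 1 = has_dirderiv_real_chain[OF p norm_sq_dirderiv[of z j]]
  note 2 = has_dirderiv_bounded_linear[OF bounded_linear_mult_right
      has_dirderiv_scaleR[OF component_dirderiv[of k z j] 1], of "- 1 / (4 * pi)"]
  have "has_dirderiv (reg_field d k) z (axis j 1) (- 1 / (4 * pi) * (kronecker j k *\<^sub>R (norm z ^ 2) powr (-3/2)
      + z$k *\<^sub>R (-3/2 * (norm z ^ 2) powr (-5/2) * (2 * z$j))))"
  proof (rule has_dirderiv_cong_open[OF 2, where S = "{z. norm z > d}"])
    show "open {z::real^3. norm z > d}" by (intro open_Collect_less continuous_intros)
    show "z \<in> {z. norm z > d}" using z by simp
    fix y :: "real^3" assume "y \<in> {z. norm z > d}"
    then show "- 1 / (4 * pi) * (y$k *\<^sub>R (norm y ^ 2) powr (-3/2)) = reg_field d k y"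
      using assms(1) pw(1)[of "norm y"] by (cases "y = 0") (simp_all add: reg_field_def max_def)
  qed
  moreover have "- 1 / (4 * pi) * (kronecker j k *\<^sub>R (norm z ^ 2) powr (-3/2)
      + z$k *\<^sub>R (-3/2 * (norm z ^ 2) powr (-5/2) * (2 * z$j))) = reg_field' d j k z"
    unfolding pw[OF z(2)] using z False by (simp add: reg_field'_def divide_simps) (simp add: algebra_simps eval_nat_numeral)
  ultimately show ?thesis by simp
qed

lemma kernel_continuous:
  "r > 0 \<Longrightarrow> continuous_on UNIV (smooth_field r k)"
  "r > 0 \<Longrightarrow> continuous_on UNIV (smooth_field' r j k)"
  "r > 0 \<Longrightarrow> continuous_on UNIV (bump r)"
  "r > 0 \<Longrightarrow> continuous_on UNIV (bump' r k)"
  "r > 0 \<Longrightarrow> continuous_on UNIV (bump'' r j k)"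
proof -
  assume r: "r > 0"
  have cp: "continuous_on UNIV profile"
    using profile_deriv by (intro continuous_at_imp_continuous_on) (auto intro: DERIV_isCont)
  have sq: "continuous_on UNIV (\<lambda>z::real^3. norm z ^ 2 / r^2)"
    using r by (intro continuous_intros) auto
  note c1 = continuous_on_compose2[OF cp sq, simplified]
    and c2 = continuous_on_compose2[OF continuous_profile' sq, simplified]
  show "continuous_on UNIV (smooth_field r k)"
    unfolding smooth_field_def[abs_def] by (intro continuous_intros c1)
  show "continuous_on UNIV (smooth_field' r j k)"
    unfolding smooth_field'_def[abs_def] by (intro continuous_intros c1 c2) (use r in auto)
  show "continuous_on UNIV (bump r)" "continuous_on UNIV (bump' r k)" "continuous_on UNIV (bump'' r j k)"
    unfolding bump_def[abs_def] bump'_def[abs_def] bump''_def[abs_def]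
    by (intro continuous_intros; use r in simp)+
qed

lemma AE_norm_neq: "AE z in lborel. norm (z::'a::euclidean_space) \<noteq> c"
proof -
  have "sphere (0::'a) c \<in> null_sets lebesgue"
    using negligible_sphere negligible_iff_null_sets by blast
  then have "sphere (0::'a) c \<in> null_sets lborel"
    by (simp add: null_sets_completion_iff)
  then show ?thesis by (rule AE_I') auto
qed

text \<open>
  With $m = \max(|y|, d)$ and $n = \max(|z|, d)$, the difference of $y / m^3$ and $z / n^3$ splits into
  $(y - z) / m^3$ and $z\,(m^{-3} - n^{-3})$; in the second part $|z| \le n$ cancels one power of $n$, so that
  every term is at most $|y - z| / d^3$.
\<close>

lemma reg_field_lipschitz:
  assumes "d > 0"
  shows "\<bar>reg_field d k y - reg_field d k z\<bar> \<le> 1 / (pi * d^3) * norm (y - z)"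
proof -
  define m where "m = max (norm y) d"
  define n where "n = max (norm z) d"
  have m: "m \<ge> d" "m > 0" "norm y \<le> m" and n: "n \<ge> d" "n > 0" "norm z \<le> n" using assms by (auto simp: m_def n_def)
  have mn: "\<bar>m - n\<bar> \<le> norm (y - z)"
    using norm_triangle_ineq3[of y z] by (auto simp: m_def n_def)
  have c: "\<bar>y$k - z$k\<bar> \<le> norm (y - z)" "\<bar>z$k\<bar> \<le> n"
    using component_le_norm_cart[of "y - z" k] component_le_norm_cart[of z k] n by auto
  have "y$k / m^3 - z$k / n^3 = (y$k - z$k) / m^3 - z$k * ((m - n) * (m^2 + m * n + n^2) / (m^3 * n^3))"
    using m n by (simp add: divide_simps) (simp add: algebra_simps eval_nat_numeral)
  also have "\<bar>\<dots>\<bar> \<le> \<bar>y$k - z$k\<bar> / m^3 + \<bar>z$k\<bar> * (\<bar>m - n\<bar> * (m^2 + m * n + n^2) / (m^3 * n^3))"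
    using m n by (intro order_trans[OF abs_triangle_ineq4]) (simp add: abs_mult)
  also have "\<dots> \<le> norm (y - z) / m^3 + n * (norm (y - z) * (m^2 + m * n + n^2) / (m^3 * n^3))"
    using m n c mn by (intro add_mono mult_mono divide_right_mono) auto
  also have "\<dots> = norm (y - z) * (1 / m^3 + (1 / (m * n^2) + 1 / (m^2 * n) + 1 / m^3))"
    using m n by (simp add: divide_simps) (simp add: algebra_simps eval_nat_numeral)
  also have "\<dots> \<le> norm (y - z) * (1 / d^3 + (1 / (d * d^2) + 1 / (d^2 * d) + 1 / d^3))"
    using m n assms by (intro mult_left_mono add_mono divide_left_mono mult_mono power_mono mult_pos_pos) auto
  also have "\<dots> = 4 * norm (y - z) / d^3"
    by (simp add: field_simps eval_nat_numeral)
  finally have *: "\<bar>y$k / m^3 - z$k / n^3\<bar> \<le> 4 * norm (y - z) / d^3" .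
  have "reg_field d k y - reg_field d k z = - (1 / (4 * pi)) * (y$k / m^3 - z$k / n^3)"
    unfolding reg_field_def m_def[symmetric] n_def[symmetric] using m n by (simp add: field_simps)
  then have "\<bar>reg_field d k y - reg_field d k z\<bar> = 1 / (4 * pi) * \<bar>y$k / m^3 - z$k / n^3\<bar>"
    by (simp add: abs_mult)
  also have "\<dots> \<le> 1 / (4 * pi) * (4 * norm (y - z) / d^3)"
    using * by (intro mult_left_mono) auto
  finally show ?thesis by (simp add: field_simps)
qed

text \<open>
  Dyadic balls: where $r / 2^{n+1} < |z| \le r / 2^n$ the integrand is at most $4^{n+1} / r^2$, while the ball of
  radius $r / 2^n$ has volume of order $8^{-n}$.
\<close>

lemma integrable_inverse_square:
  "integrable lborel (\<lambda>z::real^3. indicator (cball 0 r) z / norm z ^ 2)"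
proof (cases "r > 0")
  case False
  then have "(\<lambda>z::real^3. indicator (cball 0 r) z / norm z ^ 2) = (\<lambda>_. 0)"
    by (auto simp: fun_eq_iff indicator_def not_less) (metis norm_le_zero_iff order_trans)
  then show ?thesis by simp
next
  case True
  define f where "f n z = 4 ^ Suc n / r^2 * indicator (cball 0 (r / 2^n)) z" for n and z :: "real^3"
  have int: "integrable lborel (f n)" for n
    unfolding f_def[abs_def]
    by (intro integrable_mult_right integrable_real_indicator)
      (use emeasure_bounded_finite[OF bounded_cball] in auto)
  have intv: "(\<integral>z. norm (f n z) \<partial>lborel) = 16 / 3 * pi * r * (1/2) ^ n" for n
  proof -
    have "(\<integral>z. norm (f n z) \<partial>lborel) = 4 ^ Suc n / r^2 * measure lborel (cball (0::real^3) (r / 2^n))"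
      by (simp add: f_def abs_mult)
    also have "measure lborel (cball (0::real^3) (r / 2^n)) = 4 / 3 * pi * (r / 2^n) ^ 3"
      using content_cball[of "r / 2^n" "0::real^3"] True by (simp add: unit_ball_vol_3)
    also have "4 ^ Suc n / r^2 * (4 / 3 * pi * (r / 2^n) ^ 3) = 16 / 3 * pi * r * (4 ^ n / (2^n)^3)"
      using True by (simp add: power_divide eval_nat_numeral)
    also have "(4::real) ^ n / (2^n)^3 = (1/2) ^ n"
    proof -
      have "(4::real) ^ n / (2^n)^3 = (4 / 2^3) ^ n"
        by (simp only: power_divide power_mult[symmetric] mult.commute)
      then show ?thesis by simp
    qed
    finally show ?thesis .
  qed
  have summ: "summable (\<lambda>n. norm (f n z))" if "z \<noteq> 0" for z
  proof -
    have "(\<lambda>n. r / 2^n) \<longlonglongrightarrow> 0"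
      using LIMSEQ_divide_realpow_zero[of 2 r] by simp
    then have "\<forall>\<^sub>F n in sequentially. r / 2^n < norm z"
      using that by (intro order_tendstoD) auto
    then obtain N where "\<And>n. n \<ge> N \<Longrightarrow> r / 2^n < norm z" by (auto simp: eventually_sequentially)
    then have "f n z = 0" if "n \<notin> {..<N}" for n using that by (auto simp: f_def indicator_def not_le not_less)
    then show ?thesis by (intro summable_finite[of "{..<N}"]) auto
  qed
  have "integrable lborel (\<lambda>z. \<Sum>n. f n z)"
  proof (rule integrable_suminf[OF int])
    show "AE z in lborel. summable (\<lambda>n. norm (f n z))"
      using AE_norm_neq[of 0] by eventually_elim (use summ in auto)
    show "summable (\<lambda>n. \<integral>z. norm (f n z) \<partial>lborel)"
      unfolding intv by (intro summable_mult summable_geometric) simp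
  qed
  then show ?thesis
  proof (rule Bochner_Integration.integrable_bound)
    show "(\<lambda>z::real^3. indicator (cball 0 r) z / norm z ^ 2) \<in> borel_measurable lborel"
      by (intro borel_measurable_divide borel_measurable_indicator)
        (auto intro!: borel_measurable_continuous_onI continuous_intros)
    have le: "norm (indicator (cball 0 r) z / norm z ^ 2 :: real) \<le> norm (\<Sum>n. f n z)" if "z \<noteq> 0" for z
    proof (cases "norm z \<le> r")
      case zr: True
      have "\<exists>n. r / 2^n < norm z"
      proof -
        have "(\<lambda>n. r / 2^n) \<longlonglongrightarrow> 0" using LIMSEQ_divide_realpow_zero[of 2 r] by simp
        then have "\<forall>\<^sub>F n in sequentially. r / 2^n < norm z"
          using that by (intro order_tendstoD) auto
        then show ?thesis by (auto simp: eventually_sequentially)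
      qed
      define N where "N = (LEAST n. r / 2^n < norm z)"
      have N: "r / 2^N < norm z" unfolding N_def by (rule LeastI_ex) fact
      \<comment> \<open>The least index is positive, so its predecessor still satisfies the opposite inequality.\<close>
      have "N \<noteq> 0" using N zr by (cases "N = 0") auto
      then obtain n where n: "N = Suc n" using not0_implies_Suc by blast
      then have n1: "norm z \<le> r / 2^n" using not_less_Least[of n "\<lambda>n. r / 2^n < norm z"] by (auto simp: N_def)
      have "r < norm z * 2 ^ Suc n" using N n by (simp add: field_simps)
      then have "r^2 \<le> (norm z * 2 ^ Suc n)^2" using True by (intro power_mono) auto
      also have "\<dots> = norm z ^ 2 * 4 ^ Suc n"
        by (simp add: power_mult_distrib power_mult power2_eq_square flip: power_mult_distrib)
      finally have "1 / norm z ^ 2 \<le> 4 ^ Suc n / r^2" using that True by (simp add: field_simps)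
      also have "\<dots> = f n z" using n1 by (simp add: f_def)
      also have "\<dots> \<le> (\<Sum>n. f n z)"
        using sum_le_suminf[of "\<lambda>n. f n z" "{n}"] summ[OF that] by (simp add: f_def summable_rabs_cancel)
      finally show ?thesis using zr by simp
    qed auto
    show "AE z in lborel. norm (indicator (cball 0 r) z / norm z ^ 2 :: real) \<le> norm (\<Sum>n. f n z)"
      using AE_norm_neq[of 0] by eventually_elim (use le in auto)
  qed
qed

section \<open>The parametrix\<close>

definition has_C1_partials ::
    "(real^3) set \<Rightarrow> (real^3 \<Rightarrow> 'b::real_normed_vector) \<Rightarrow> (3 \<Rightarrow> real^3 \<Rightarrow> 'b) \<Rightarrow> bool" where
  "has_C1_partials S g g' \<longleftrightarrow> continuous_on S g \<and>
     (\<forall>j. continuous_on S (g' j) \<and> (\<forall>y\<in>S. has_dirderiv g y (axis j 1) (g' j y)))"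

lemma has_C1_partialsD:
  assumes "has_C1_partials S g g'"
  shows "continuous_on S g" "continuous_on S (g' j)" "y \<in> S \<Longrightarrow> has_dirderiv g y (axis j 1) (g' j y)"
  using assms by (auto simp: has_C1_partials_def)

text \<open>
  The part of the Newton field that carries the singularity. It vanishes for $|z| \ge r$, so it can be
  correlated with functions known only near $x$.
\<close>

definition parametrix :: "real \<Rightarrow> 3 \<Rightarrow> real^3 \<Rightarrow> real" where
  "parametrix r k z = newton_field k z - smooth_field r k z"

definition reg_parametrix :: "real \<Rightarrow> real \<Rightarrow> 3 \<Rightarrow> real^3 \<Rightarrow> real" where
  "reg_parametrix r d k z = reg_field d k z - smooth_field r k z"

definition reg_parametrix' :: "real \<Rightarrow> real \<Rightarrow> 3 \<Rightarrow> 3 \<Rightarrow> real^3 \<Rightarrow> real" where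
  "reg_parametrix' r d j k z =
     (if norm z \<ge> r then 0 else reg_field' d j k z - smooth_field' r j k z)"

lemma nth_measurable [measurable]: "(\<lambda>z::real^3. z$k) \<in> borel_measurable borel"
  by (intro borel_measurable_continuous_onI continuous_intros)

lemma reg_field_eq: "norm z \<ge> d \<Longrightarrow> reg_field d k z = newton_field k z"
  by (simp add: reg_field_def newton_field_def)

lemma parametrix_support:
  "r > 0 \<Longrightarrow> norm z \<ge> r \<Longrightarrow> parametrix r k z = 0"
  "r > 0 \<Longrightarrow> d < r \<Longrightarrow> norm z \<ge> r \<Longrightarrow> reg_parametrix r d k z = 0"
  by (simp_all add: parametrix_def reg_parametrix_def smooth_field_eq reg_field_eq)

lemma bump_support:
  assumes "r > 0" "norm z \<ge> r"
  shows "bump r z = 0" "bump' r k z = 0" "bump'' r j k z = 0"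
proof -
  have "r^2 \<le> norm z ^ 2" using assms by (intro power_mono) auto
  then have "max 0 (1 - norm z ^ 2 / r^2) = 0" using assms by simp
  then show "bump r z = 0" "bump' r k z = 0" "bump'' r j k z = 0"
    by (simp_all add: bump_def bump'_def bump''_def)
qed

lemma kernel_measurable [measurable]:
  "newton_field k \<in> borel_measurable borel" 
  "reg_field d k \<in> borel_measurable borel" 
  "reg_field' d j k \<in> borel_measurable borel" 
  "r > 0 \<Longrightarrow> smooth_field r k \<in> borel_measurable borel" 
  "r > 0 \<Longrightarrow> smooth_field' r j k \<in> borel_measurable borel" 
  "r > 0 \<Longrightarrow> bump r \<in> borel_measurable borel"
  "r > 0 \<Longrightarrow> bump' r k \<in> borel_measurable borel"
  "r > 0 \<Longrightarrow> bump'' r j k \<in> borel_measurable borel"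
  unfolding newton_field_def[abs_def] reg_field_def[abs_def] reg_field'_def[abs_def]
  by (measurable; use kernel_continuous in \<open>auto intro!: borel_measurable_continuous_onI\<close>)+

lemma parametrix_measurable [measurable]:
  "r > 0 \<Longrightarrow> parametrix r k \<in> borel_measurable borel"
  "r > 0 \<Longrightarrow> reg_parametrix r d k \<in> borel_measurable borel"
  "r > 0 \<Longrightarrow> reg_parametrix' r d j k \<in> borel_measurable borel"
  unfolding parametrix_def[abs_def] reg_parametrix_def[abs_def] reg_parametrix'_def[abs_def]
  by measurable

lemma reg_field'_bound:
  assumes "d > 0" shows "\<bar>reg_field' d j k z\<bar> \<le> 1 / (pi * d^3)"
proof (cases "norm z < d")
  case True
  have "\<bar>reg_field' d j k z\<bar> \<le> 1 / (4 * pi * d^3)"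
    using True assms by (simp add: reg_field'_def kronecker_def)
  also have "\<dots> \<le> 1 / (pi * d^3)" using assms by (simp add: field_simps)
  finally show ?thesis .
next
  case False
  with assms have z: "norm z \<ge> d" "norm z > 0" by auto
  have aux: "\<bar>3 * p - N * c\<bar> \<le> 4 * N" if "\<bar>p\<bar> \<le> N" "0 \<le> N" "c = 0 \<or> c = 1" for p N c :: real
    using that by auto
  have "\<bar>z$j * z$k\<bar> \<le> norm z * norm z"
    unfolding abs_mult by (intro mult_mono component_le_norm_cart) auto
  then have "\<bar>3 * (z$j * z$k) - norm z * norm z * kronecker j k\<bar> \<le> 4 * (norm z * norm z)"
    using aux[of "z$j * z$k" "norm z * norm z" "kronecker j k"] by (simp add: kronecker_def)
  then have "\<bar>3 * z$j * z$k - norm z ^ 2 * kronecker j k\<bar> \<le> 4 * norm z ^ 2"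
    by (simp add: power2_eq_square mult.assoc)
  then have "\<bar>3 * z$j * z$k - norm z ^ 2 * kronecker j k\<bar> / (4 * pi * norm z ^ 5)
      \<le> 4 * norm z ^ 2 / (4 * pi * norm z ^ 5)"
    by (rule divide_right_mono) simp
  then have "\<bar>reg_field' d j k z\<bar> \<le> 4 * norm z ^ 2 / (4 * pi * norm z ^ 5)"
    using False by (simp only: reg_field'_def if_False abs_divide) simp
  also have "\<dots> = 1 / (pi * norm z ^ 3)" using z by (simp add: divide_simps eval_nat_numeral)
  also have "\<dots> \<le> 1 / (pi * d^3)"
    using z assms by (intro divide_left_mono mult_left_mono power_mono) auto
  finally show ?thesis .
qed

lemma reg_parametrix_by_parts:
  fixes g :: "real^3 \<Rightarrow> 'b::euclidean_space"
  assumes "0 < d" "d < r" "r < R" and g: "has_C1_partials (ball x R) g g'"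
  shows "(reg_parametrix r d k \<star> g' j) x = - (reg_parametrix' r d j k \<star> g) x"
proof -
  have r: "r > 0" using assms by simp
  obtain A where A: "A \<ge> 0" "\<And>z. z \<in> cball 0 r \<Longrightarrow> norm (smooth_field r k z) \<le> A"
    using continuous_bounded_on_cball[OF kernel_continuous(1)[OF r]]
    by blast
  obtain L where L: "L \<ge> 0" "\<And>z. z \<in> cball 0 (r + 1) \<Longrightarrow> norm (smooth_field' r j k z) \<le> L"
    using continuous_bounded_on_cball[OF kernel_continuous(2)[OF r]]
    by blast
  let ?L = "1 / (pi * d^3) + L"
  have rf0: "reg_field d k 0 = 0" by (simp add: reg_field_def)
  show ?thesis
  proof (rule corr_by_parts[OF r \<open>r < R\<close>, where e = "axis j 1" and L = ?L and A = "1 / (pi * d^3) * r + A" and f' = "g' j" and a' = "reg_parametrix' r d j k"])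
    show "reg_parametrix r d k \<in> borel_measurable borel" using r by simp
    show "reg_parametrix' r d j k \<in> borel_measurable borel" using r by simp
    show "reg_parametrix r d k z = 0" if "norm z \<ge> r" for z
      using that r assms by (simp add: parametrix_support)
    show "reg_parametrix' r d j k z = 0" if "norm z \<ge> r" for z
      using that by (simp add: reg_parametrix'_def)
    show "\<bar>reg_parametrix r d k z\<bar> \<le> 1 / (pi * d^3) * r + A" for z
    proof (cases "norm z \<ge> r")
      case True
      then show ?thesis using A r assms by (simp add: parametrix_support)
    next
      case False
      have "\<bar>reg_field d k z\<bar> \<le> 1 / (pi * d^3) * norm z"
        using reg_field_lipschitz[OF assms(1), of k z 0] rf0 by simp
      also have "\<dots> \<le> 1 / (pi * d^3) * r" using False assms by (intro mult_left_mono) auto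
      finally show ?thesis using A(2)[of z] False unfolding reg_parametrix_def by auto
    qed
    show "\<bar>reg_parametrix' r d j k z\<bar> \<le> ?L" for z
      using reg_field'_bound[OF assms(1), of j k z] L(1) L(2)[of z] assms(1)
      unfolding reg_parametrix'_def by auto
    show "\<bar>reg_parametrix r d k (z + s *\<^sub>R axis j 1) - reg_parametrix r d k z\<bar> \<le> ?L * \<bar>s\<bar>"
      if z: "norm z < r" and s: "\<bar>s\<bar> \<le> 1" for z s
    proof -
      have "norm (smooth_field r k (z + s *\<^sub>R axis j 1) - smooth_field r k z) \<le> L * \<bar>s\<bar>"
      proof (rule has_dirderiv_bound[OF smooth_field_dirderiv[OF r]])
        fix t assume "t \<in> closed_segment 0 s"
        then have "\<bar>t\<bar> \<le> 1" using s by (auto simp: closed_segment_eq_real_ivl split: if_splits)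
        then show "norm (smooth_field' r j k (z + t *\<^sub>R axis j 1)) \<le> L"
          using z norm_triangle_ineq[of z "t *\<^sub>R axis j 1"] by (intro L(2)) simp
      qed
      moreover have "\<bar>reg_field d k (z + s *\<^sub>R axis j 1) - reg_field d k z\<bar> \<le> 1 / (pi * d^3) * \<bar>s\<bar>"
        using reg_field_lipschitz[OF assms(1), of k "z + s *\<^sub>R axis j 1" z] by simp
      ultimately show ?thesis
        unfolding reg_parametrix_def ring_distribs by (simp add: abs_le_iff)
    qed
    show "AE z in lborel. has_dirderiv (reg_parametrix r d k) z (axis j 1) (reg_parametrix' r d j k z)"
      using AE_norm_neq[of d] AE_norm_neq[of r]
    proof eventually_elim
      case (elim z)
      show ?case
      proof (cases "norm z < r")
        case True
        then show ?thesis
          using has_dirderiv_diff[OF reg_field_dirderiv[OF assms(1) elim(1), of k j] smooth_field_dirderiv[OF r, of k z j]]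
          by (simp add: reg_parametrix_def[abs_def] reg_parametrix'_def)
      next
        case False
        have "has_dirderiv (\<lambda>z. 0) z (axis j 1) (0::real)" by (simp add: has_dirderiv_def)
        moreover have "open {z::real^3. norm z > r}" by (intro open_Collect_less continuous_intros)
        ultimately have "has_dirderiv (reg_parametrix r d k) z (axis j 1) 0"
          by (rule has_dirderiv_cong_open) (use False elim r assms in \<open>auto simp: parametrix_support\<close>)
        then show ?thesis using False by (simp add: reg_parametrix'_def)
      qed
    qed
  qed (use has_C1_partialsD[OF g] in blast)+
qed

lemma integrable_reg_parametrix':
  assumes "0 < d" "d < r"
  shows "integrable lborel (reg_parametrix' r d j k)"
proof -
  have r: "r > 0" using assms by simp
  obtain L where L: "L \<ge> 0" "\<And>z. z \<in> cball 0 r \<Longrightarrow> norm (smooth_field' r j k z) \<le> L"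
    using continuous_bounded_on_cball[OF kernel_continuous(2)[OF r]]
    by blast
  have "\<bar>reg_parametrix' r d j k z\<bar> \<le> 1 / (pi * d^3) + L" for z
    using reg_field'_bound[OF assms(1), of j k z] L(1) L(2)[of z] assms(1)
    unfolding reg_parametrix'_def by auto
  moreover have "reg_parametrix' r d j k \<in> borel_measurable borel" using r by simp
  ultimately show ?thesis
    by (intro integrable_bounded_support[where r = r and B = "1 / (pi * d^3) + L"])
      (auto simp: reg_parametrix'_def[of _ _ _ _ "z::real^3" for z])
qed

lemma reg_field_le: "\<bar>reg_field d k z\<bar> \<le> 1 / norm z ^ 2"
proof (cases "z = 0")
  case False
  have "\<bar>reg_field d k z\<bar> = \<bar>z$k\<bar> / (4 * pi * max (norm z) d ^ 3)"
    using False by (simp add: reg_field_def abs_mult power_abs abs_of_nonneg[of "max (norm z) d"] le_max_iff_disj)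
  also have "\<dots> \<le> norm z / (1 * norm z ^ 3)"
    using False pi_ge_two component_le_norm_cart[of z k]
    by (intro frac_le mult_mono power_mono mult_pos_pos) auto
  also have "\<dots> = 1 / norm z ^ 2" using False by (simp add: eval_nat_numeral)
  finally show ?thesis .
qed (simp add: reg_field_def)

lemma newton_field_le: "\<bar>newton_field k z\<bar> \<le> 1 / norm z ^ 2"
  using reg_field_le[of "norm z" k z] by (simp add: reg_field_eq)

text \<open>
  One integrable majorant for all $d$ is what permits the limit $d \to 0$.
\<close>

lemma reg_parametrix_dominated:
  assumes "r > 0"
  obtains w where "integrable lborel w" "\<And>z. w z \<ge> 0"
    "\<And>z d k. d < r \<Longrightarrow> \<bar>reg_parametrix r d k z\<bar> \<le> w z" "\<And>z k. \<bar>parametrix r k z\<bar> \<le> w z"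
proof -
  have "\<exists>A. A \<ge> 0 \<and> (\<forall>z\<in>cball 0 r. norm (smooth_field r k z) \<le> A)" for k
    using continuous_bounded_on_cball[OF kernel_continuous(1)[OF assms]]
    by metis
  then obtain A where A: "\<And>k. A k \<ge> 0" "\<And>k z. z \<in> cball 0 r \<Longrightarrow> norm (smooth_field r k z) \<le> A k" by metis
  define C where "C = (\<Sum>k\<in>UNIV. A k)"
  have AC: "A k \<le> C" for k unfolding C_def using A(1) by (intro member_le_sum) auto
  define w where "w z = indicator (cball 0 r) z / norm z ^ 2 + C * indicator (cball 0 r) z" for z :: "real^3"
  show ?thesis
  proof (rule that[of w])
    show "integrable lborel w"
      unfolding w_def[abs_def]
      by (intro Bochner_Integration.integrable_add integrable_inverse_square integrable_mult_right integrable_real_indicator)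
        (use emeasure_bounded_finite[OF bounded_cball] in auto)
    show w0: "w z \<ge> 0" for z using A(1)[of 0] AC[of 0] by (simp add: w_def)
    fix z k
    have s: "\<bar>smooth_field r k z\<bar> \<le> C" if "norm z \<le> r" using A(2)[of z k] AC[of k] that by auto
    show "\<bar>reg_parametrix r d k z\<bar> \<le> w z" if "d < r" for d
    proof (cases "norm z \<le> r")
      case True
      then show ?thesis using s reg_field_le[of d k z] by (auto simp: w_def reg_parametrix_def)
    qed (use that assms w0 in \<open>auto simp: parametrix_support\<close>)
    show "\<bar>parametrix r k z\<bar> \<le> w z"
    proof (cases "norm z \<le> r")
      case True
      then show ?thesis using s newton_field_le[of k z] by (auto simp: w_def parametrix_def)
    qed (use assms w0 in \<open>auto simp: parametrix_support\<close>)
  qed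
qed

lemma integrable_parametrix: "r > 0 \<Longrightarrow> integrable lborel (parametrix r k)"
proof -
  assume r: "r > 0"
  obtain w where w: "integrable lborel w" "\<And>z. w z \<ge> 0"
    "\<And>z d k. d < r \<Longrightarrow> \<bar>reg_parametrix r d k z\<bar> \<le> w z" "\<And>z k. \<bar>parametrix r k z\<bar> \<le> w z"
    by (rule reg_parametrix_dominated[OF r]) blast
  have "parametrix r k \<in> borel_measurable lborel" using r by simp
  then show ?thesis
    by (rule Bochner_Integration.integrable_bound[OF w(1)]) (use w in \<open>auto simp: abs_of_nonneg\<close>)
qed

text \<open>
  Regularization radii and initial times run through $r / (n + 2)$: the offset 2 keeps all of them strictly
  below $r$.
\<close>

lemma shrinking_scale:
  assumes "0 < (r::real)" shows "0 < r / real (n + 2)" "r / real (n + 2) < r"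
proof -
  show "0 < r / real (n + 2)" using assms by simp
  have "r / real (n + 2) < r / 1" using assms by (intro divide_strict_left_mono) auto
  then show "r / real (n + 2) < r" by simp
qed

lemma shrinking_scale_tendsto: "(\<lambda>n. t / real (n + 2)) \<longlonglongrightarrow> 0"
  by (rule LIMSEQ_ignore_initial_segment[OF lim_const_over_n])

lemma reg_parametrix_tendsto:
  fixes g :: "real^3 \<Rightarrow> 'b::euclidean_space"
  assumes "0 < r" and g: "continuous_on (cball x r) g"
  shows "(\<lambda>n. (reg_parametrix r (r / real (n + 2)) k \<star> g) x) \<longlonglongrightarrow> (parametrix r k \<star> g) x"
proof -
  obtain w where w: "integrable lborel w" "\<And>z. w z \<ge> 0"
    "\<And>z d k. d < r \<Longrightarrow> \<bar>reg_parametrix r d k z\<bar> \<le> w z" "\<And>z k. \<bar>parametrix r k z\<bar> \<le> w z"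
    by (rule reg_parametrix_dominated[OF assms(1)]) blast
  obtain B where B: "B \<ge> 0" "\<And>y. y \<in> cball x r \<Longrightarrow> norm (g y) \<le> B"
    using continuous_on_compact_norm_bound[OF g compact_cball] by blast
  define d where "d n = r / real (n + 2)" for n
  have d: "0 < d n" "d n < r" for n using shrinking_scale[OF assms(1)] by (simp_all only: d_def)
  have dlim: "d \<longlonglongrightarrow> 0" unfolding d_def by (rule shrinking_scale_tendsto)
  have meas: "(\<lambda>z. a z *\<^sub>R g (x + z)) \<in> borel_measurable lborel"
    if "a \<in> borel_measurable borel" "\<And>z. norm z \<ge> r \<Longrightarrow> a z = 0" for a
    using shift_mult_measurable[where r = r, OF that(1) _ g] that(2) by simp
  show ?thesis
    unfolding corr_def d_def[symmetric]
  proof (rule integral_dominated_convergence[where w = "\<lambda>z. w z * B"])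
    show "(\<lambda>z. parametrix r k z *\<^sub>R g (x + z)) \<in> borel_measurable lborel"
      by (rule meas) (use assms in \<open>auto simp: parametrix_support\<close>)
    show "(\<lambda>z. reg_parametrix r (d n) k z *\<^sub>R g (x + z)) \<in> borel_measurable lborel" for n
      by (rule meas) (use assms d in \<open>auto simp: parametrix_support\<close>)
    show "integrable lborel (\<lambda>z. w z * B)" using w(1) by simp
    show "AE z in lborel. (\<lambda>n. reg_parametrix r (d n) k z *\<^sub>R g (x + z)) \<longlonglongrightarrow> parametrix r k z *\<^sub>R g (x + z)"
      using AE_norm_neq[of 0]
    proof eventually_elim
      case (elim z)
      have "\<forall>\<^sub>F n in sequentially. d n < norm z" using dlim elim by (intro order_tendstoD) auto
      then have "\<forall>\<^sub>F n in sequentially. reg_parametrix r (d n) k z *\<^sub>R g (x + z) = parametrix r k z *\<^sub>R g (x + z)"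
        by eventually_elim (simp add: reg_parametrix_def parametrix_def reg_field_eq)
      then show ?case by (rule tendsto_eventually)
    qed
    show "AE z in lborel. norm (reg_parametrix r (d n) k z *\<^sub>R g (x + z)) \<le> w z * B" for n
    proof (intro AE_I2)
      fix z
      show "norm (reg_parametrix r (d n) k z *\<^sub>R g (x + z)) \<le> w z * B"
      proof (cases "norm z \<ge> r")
        case True then show ?thesis using w(2)[of z] B(1) d assms by (simp add: parametrix_support)
      next
        case False
        then show ?thesis using w(2,3) d B by (auto intro!: mult_mono simp: dist_norm)
      qed
    qed
  qed
qed

text \<open>
  The kernel has total mass 1 and its support shrinks to the origin.
\<close>

lemma average_tendsto:
  fixes g :: "real^3 \<Rightarrow> 'b::euclidean_space"
  assumes "0 < r" and g: "continuous_on (cball x r) g"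
  shows "(\<lambda>n. ((\<lambda>z. 3 / (4 * pi * (r / real (n + 2))^3) * indicator (ball 0 (r / real (n + 2))) z) \<star> g) x)
    \<longlonglongrightarrow> g x"
proof (rule LIMSEQ_I)
  fix e :: real assume e: "e > 0"
  define a :: "real \<Rightarrow> real^3 \<Rightarrow> real" where "a d = (\<lambda>z. 3 / (4 * pi * d^3) * indicator (ball 0 d) z)" for d
  define d where "d n = r / real (n + 2)" for n
  have d: "0 < d n" "d n < r" for n using shrinking_scale[OF assms(1)] by (simp_all only: d_def)
  have dlim: "d \<longlonglongrightarrow> 0" unfolding d_def by (rule shrinking_scale_tendsto)
  have "continuous (at x within cball x r) g" using g assms(1) by (auto simp: continuous_on_eq_continuous_within)
  then obtain \<delta> where \<delta>: "\<delta> > 0" "\<And>y. y \<in> cball x r \<Longrightarrow> dist y x < \<delta> \<Longrightarrow> dist (g y) (g x) < e / 2"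
    unfolding continuous_within_eps_delta using e by (metis half_gt_zero)
  have "\<forall>\<^sub>F n in sequentially. d n < \<delta>" using dlim \<delta> by (intro order_tendstoD) auto
  then obtain N where N: "\<And>n. n \<ge> N \<Longrightarrow> d n < \<delta>" by (auto simp: eventually_sequentially)
  show "\<exists>no. \<forall>n\<ge>no. norm (((\<lambda>z. 3 / (4 * pi * (r / real (n + 2))^3) * indicator (ball 0 (r / real (n + 2))) z) \<star> g) x - g x) < e"
    unfolding d_def[symmetric] a_def[symmetric]
  proof (intro exI[of _ N] allI impI)
    fix n assume n: "n \<ge> N"
    have ia: "integrable lborel (a (d n))"
      unfolding a_def by (intro integrable_mult_right integrable_real_indicator)
        (use emeasure_bounded_finite[OF bounded_ball] in auto)
    have a0: "a (d n) z = 0" if "norm z > r" for z using that d[of n] by (auto simp: a_def indicator_def)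
    have mass: "integral\<^sup>L lborel (a (d n)) = 1"
      using content_ball[of "d n" "0::real^3"] d[of n] by (simp add: a_def unit_ball_vol_3)
    have i: "integrable lborel (\<lambda>z. a (d n) z *\<^sub>R g (x + z))"
      by (rule integrable_shift_mult[OF ia a0 g])
    have "(a (d n) \<star> g) x - g x = (\<integral>z. a (d n) z *\<^sub>R g (x + z) \<partial>lborel) - (\<integral>z. a (d n) z *\<^sub>R g x \<partial>lborel)"
      using ia mass by (simp add: corr_def)
    also have "\<dots> = (\<integral>z. a (d n) z *\<^sub>R (g (x + z) - g x) \<partial>lborel)"
      using i ia by (simp add: scaleR_diff_right Bochner_Integration.integral_diff)
    also have "norm \<dots> \<le> (\<integral>z. a (d n) z * (e / 2) \<partial>lborel)"
    proof (rule Bochner_Integration.integral_norm_bound_integral)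
      show "integrable lborel (\<lambda>z. a (d n) z *\<^sub>R (g (x + z) - g x))"
        using i ia by (simp add: scaleR_diff_right)
      show "integrable lborel (\<lambda>z. a (d n) z * (e / 2))" using ia by simp
      fix z
      show "norm (a (d n) z *\<^sub>R (g (x + z) - g x)) \<le> a (d n) z * (e / 2)"
      proof (cases "norm z < d n")
        case True
        then have "norm (g (x + z) - g x) \<le> e / 2"
          using \<delta>(2)[of "x + z"] N[OF n] d[of n] by (auto simp: dist_norm)
        moreover have "a (d n) z \<ge> 0" using d[of n] by (simp add: a_def)
        ultimately show ?thesis using mult_left_mono[of _ "e / 2" "a (d n) z"] by simp
      qed (simp add: a_def)
    qed
    also have "\<dots> = e / 2" using mass by simp
    finally show "norm ((a (d n) \<star> g) x - g x) < e" using e by simp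
  qed
qed

lemma integrable_bump:
  assumes "r > 0"
  shows "integrable lborel (bump r)" "integrable lborel (bump' r k)" "integrable lborel (bump'' r j k)"
proof -
  have "integrable lborel a" if c: "continuous_on UNIV a" and s: "\<And>z. norm z \<ge> r \<Longrightarrow> a z = 0" for a :: "real^3 \<Rightarrow> real"
  proof -
    obtain C where C: "C \<ge> 0" "\<And>z. z \<in> cball 0 r \<Longrightarrow> norm (a z) \<le> C"
      using continuous_bounded_on_cball[OF c] by blast
    have "\<bar>a z\<bar> \<le> C" for z using C(1) C(2)[of z] s[of z] by (cases "norm z \<le> r") auto
    then show ?thesis
      by (intro integrable_bounded_support[of a r C]) (use c s in \<open>auto intro: borel_measurable_continuous_onI\<close>)
  qed
  then show "integrable lborel (bump r)" "integrable lborel (bump' r k)" "integrable lborel (bump'' r j k)"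
    using kernel_continuous[OF assms] bump_support[OF assms] by blast+
qed

text \<open>
  The parametrix is a gradient field, so its Jacobian matrix is symmetric. For the regularized field
  this is an identity between the kernels after integration by parts, and it survives the limit.
\<close>

lemma parametrix_symmetric:
  fixes g :: "real^3 \<Rightarrow> 'b::euclidean_space"
  assumes "0 < r" "r < R" and g: "has_C1_partials (ball x R) g g'"
  shows "(parametrix r k \<star> g' j) x = (parametrix r j \<star> g' k) x"
proof -
  have c: "continuous_on (cball x r) (g' i)" for i
    by (rule continuous_on_subset[OF has_C1_partialsD(2)[OF g]]) (use assms in auto)
  have "(reg_parametrix r d k \<star> g' j) x = (reg_parametrix r d j \<star> g' k) x" if "0 < d" "d < r" for d
  proof -
    have "reg_parametrix' r d j k = reg_parametrix' r d k j"
      unfolding fun_eq_iff reg_parametrix'_def by (metis reg_field'_sym smooth_field'_sym)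
    then show ?thesis
      using reg_parametrix_by_parts[OF that assms(2) g, of k j] reg_parametrix_by_parts[OF that assms(2) g, of j k]
      by simp
  qed
  then have "(reg_parametrix r (r / real (n + 2)) k \<star> g' j) x = (reg_parametrix r (r / real (n + 2)) j \<star> g' k) x" for n
    using shrinking_scale[OF assms(1)] by blast
  then show ?thesis
    using reg_parametrix_tendsto[OF assms(1) c, of k j] reg_parametrix_tendsto[OF assms(1) c, of j k]
    by (auto intro: LIMSEQ_unique)
qed

text \<open>
  The divergence of the parametrix is the bump minus a unit point mass at the origin. The point mass
  appears as the limit of uniformly charged balls.
\<close>

lemma parametrix_div:
  fixes g :: "real^3 \<Rightarrow> 'b::euclidean_space"
  assumes "0 < r" "r < R" and g: "has_C1_partials (ball x R) g g'"
  shows "(\<Sum>k\<in>UNIV. (parametrix r k \<star> g' k) x) = g x - (bump r \<star> g) x"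
proof -
  have c: "continuous_on (cball x r) (g' i)" for i
    by (rule continuous_on_subset[OF has_C1_partialsD(2)[OF g]]) (use assms in auto)
  have cg: "continuous_on (cball x r) g"
    by (rule continuous_on_subset[OF has_C1_partialsD(1)[OF g]]) (use assms in auto)
  define a :: "real \<Rightarrow> real^3 \<Rightarrow> real" where "a d = (\<lambda>z. 3 / (4 * pi * d^3) * indicator (ball 0 d) z)" for d
  have reg: "(\<Sum>k\<in>UNIV. (reg_parametrix r d k \<star> g' k) x) = (a d \<star> g) x - (bump r \<star> g) x"
    if d: "0 < d" "d < r" for d
  proof -
    have ia: "integrable lborel (a d)"
      unfolding a_def by (intro integrable_mult_right integrable_real_indicator)
        (use emeasure_bounded_finite[OF bounded_ball] in auto)
    have i1: "integrable lborel (\<lambda>z. a d z *\<^sub>R g (x + z))"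
      by (rule integrable_shift_mult[OF ia _ cg]) (use d in \<open>auto simp: a_def indicator_def\<close>)
    have i2: "integrable lborel (\<lambda>z. bump r z *\<^sub>R g (x + z))"
      by (rule integrable_shift_mult[OF integrable_bump(1)[OF assms(1)] _ cg])
        (use assms in \<open>auto simp: bump_support\<close>)
    have ik: "integrable lborel (\<lambda>z. reg_parametrix' r d k k z *\<^sub>R g (x + z))" for k
      by (rule integrable_shift_mult[OF integrable_reg_parametrix'[OF d] _ cg]) (simp add: reg_parametrix'_def)
    have "(\<Sum>k\<in>UNIV. (reg_parametrix r d k \<star> g' k) x) = (\<Sum>k\<in>UNIV. - (reg_parametrix' r d k k \<star> g) x)"
      using reg_parametrix_by_parts[OF d assms(2) g] by simp
    also have "\<dots> = - (\<integral>z. (\<Sum>k\<in>UNIV. reg_parametrix' r d k k z *\<^sub>R g (x + z)) \<partial>lborel)"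
      unfolding corr_def sum_negf using ik by (subst Bochner_Integration.integral_sum) auto
    also have "\<dots> = - (\<integral>z. bump r z *\<^sub>R g (x + z) - a d z *\<^sub>R g (x + z) \<partial>lborel)"
    proof -
      have "(\<Sum>k\<in>UNIV. reg_parametrix' r d k k z) = bump r z - a d z" for z
      proof (cases "norm z \<ge> r")
        case True then show ?thesis using d assms by (simp add: reg_parametrix'_def bump_support a_def)
      next
        case False
        then have "(\<Sum>k\<in>UNIV. reg_parametrix' r d k k z)
            = (\<Sum>k\<in>UNIV. reg_field' d k k z) - (\<Sum>k\<in>UNIV. smooth_field' r k k z)"
          by (simp add: reg_parametrix'_def sum_subtractf)
        then show ?thesis using d(1) assms(1) by (simp add: smooth_field_div reg_field_div a_def)
      qed
      then show ?thesis by (simp add: scaleR_sum_left[symmetric] scaleR_diff_left)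
    qed
    also have "\<dots> = (a d \<star> g) x - (bump r \<star> g) x"
      using i1 i2 by (simp add: corr_def)
    finally show ?thesis .
  qed
  have "(\<lambda>n. \<Sum>k\<in>UNIV. (reg_parametrix r (r / real (n + 2)) k \<star> g' k) x)
      \<longlonglongrightarrow> (\<Sum>k\<in>UNIV. (parametrix r k \<star> g' k) x)"
    by (intro tendsto_sum reg_parametrix_tendsto assms c)
  moreover have "(\<lambda>n. (a (r / real (n + 2)) \<star> g) x - (bump r \<star> g) x) \<longlonglongrightarrow> g x - (bump r \<star> g) x"
    unfolding a_def by (intro tendsto_diff tendsto_const average_tendsto assms cg)
  moreover have "(\<Sum>k\<in>UNIV. (reg_parametrix r (r / real (n + 2)) k \<star> g' k) x)
     = (a (r / real (n + 2)) \<star> g) x - (bump r \<star> g) x" for n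
    using shrinking_scale[OF assms(1)] by (intro reg)
  ultimately show ?thesis by (auto intro: LIMSEQ_unique)
qed

section \<open>Representation of gradients and differentiation of correlations\<close>

lemma second_difference_bound:
  fixes f :: "'a::real_normed_vector \<Rightarrow> 'b::real_normed_vector"
  assumes "h > 0"
    and fa: "\<And>s t. \<lbrakk>0 \<le> s; s \<le> h; 0 \<le> t; t \<le> h\<rbrakk> \<Longrightarrow> has_dirderiv f (x + s *\<^sub>R a + t *\<^sub>R b) a (fa (x + s *\<^sub>R a + t *\<^sub>R b))"
    and fab: "\<And>s t. \<lbrakk>0 \<le> s; s \<le> h; 0 \<le> t; t \<le> h\<rbrakk> \<Longrightarrow> has_dirderiv fa (x + s *\<^sub>R a + t *\<^sub>R b) b (fab (x + s *\<^sub>R a + t *\<^sub>R b))"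
    and near: "\<And>s t. \<lbrakk>0 \<le> s; s \<le> h; 0 \<le> t; t \<le> h\<rbrakk> \<Longrightarrow> norm (fab (x + s *\<^sub>R a + t *\<^sub>R b) - c) \<le> \<epsilon>"
  shows "norm (f (x + h *\<^sub>R a + h *\<^sub>R b) - f (x + h *\<^sub>R a) - f (x + h *\<^sub>R b) + f x - (h * h) *\<^sub>R c) \<le> \<epsilon> * h * h"
proof -
  have inner: "norm (fa (x + s *\<^sub>R a + h *\<^sub>R b) - fa (x + s *\<^sub>R a) - h *\<^sub>R c) \<le> \<epsilon> * h" if s: "0 \<le> s" "s \<le> h" for s
  proof -
    have "norm ((\<lambda>t. fa (x + s *\<^sub>R a + t *\<^sub>R b) - t *\<^sub>R c) h - (\<lambda>t. fa (x + s *\<^sub>R a + t *\<^sub>R b) - t *\<^sub>R c) 0) \<le> \<epsilon> * norm (h - 0)"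
    proof (rule differentiable_bound[where S = "{0..h}"])
      fix t assume t: "t \<in> {0..h}"
      have "((\<lambda>t. fa (x + s *\<^sub>R a + t *\<^sub>R b)) has_vector_derivative fab (x + s *\<^sub>R a + t *\<^sub>R b)) (at t)"
        using has_dirderiv_along_line[OF fab] s t by simp
      then have "((\<lambda>t. fa (x + s *\<^sub>R a + t *\<^sub>R b) - t *\<^sub>R c) has_vector_derivative
          fab (x + s *\<^sub>R a + t *\<^sub>R b) - c) (at t)"
        by (auto intro!: derivative_eq_intros)
      then show "((\<lambda>t. fa (x + s *\<^sub>R a + t *\<^sub>R b) - t *\<^sub>R c) has_derivative
          (\<lambda>k. k *\<^sub>R (fab (x + s *\<^sub>R a + t *\<^sub>R b) - c))) (at t within {0..h})"
        by (simp add: has_vector_derivative_def has_derivative_at_withinI)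
      have "norm (k *\<^sub>R (fab (x + s *\<^sub>R a + t *\<^sub>R b) - c)) \<le> \<epsilon> * norm k" for k
        using mult_right_mono[OF near[of s t], of "\<bar>k\<bar>"] s t by (simp add: mult.commute)
      then show "onorm (\<lambda>k. k *\<^sub>R (fab (x + s *\<^sub>R a + t *\<^sub>R b) - c)) \<le> \<epsilon>" by (rule onorm_le)
    qed (use \<open>h > 0\<close> in auto)
    then show ?thesis using \<open>h > 0\<close> by (simp add: algebra_simps)
  qed
  have "norm ((\<lambda>s. f (x + s *\<^sub>R a + h *\<^sub>R b) - f (x + s *\<^sub>R a) - (s * h) *\<^sub>R c) h
      - (\<lambda>s. f (x + s *\<^sub>R a + h *\<^sub>R b) - f (x + s *\<^sub>R a) - (s * h) *\<^sub>R c) 0) \<le> (\<epsilon> * h) * norm (h - 0)"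
  proof (rule differentiable_bound[where S = "{0..h}"])
    fix s assume s: "s \<in> {0..h}"
    have "((\<lambda>s. f ((x + h *\<^sub>R b) + s *\<^sub>R a)) has_vector_derivative fa ((x + h *\<^sub>R b) + s *\<^sub>R a)) (at s)"
      by (rule has_dirderiv_along_line) (use fa[of s h] s \<open>h > 0\<close> in \<open>simp add: add.commute add.left_commute\<close>)
    moreover have "((\<lambda>s. f (x + s *\<^sub>R a)) has_vector_derivative fa (x + s *\<^sub>R a)) (at s)"
      by (rule has_dirderiv_along_line) (use fa[of s 0] s \<open>h > 0\<close> in simp)
    ultimately have "((\<lambda>s. f (x + s *\<^sub>R a + h *\<^sub>R b) - f (x + s *\<^sub>R a) - (s * h) *\<^sub>R c) has_vector_derivative
        fa (x + s *\<^sub>R a + h *\<^sub>R b) - fa (x + s *\<^sub>R a) - h *\<^sub>R c) (at s)"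
      by (auto intro!: derivative_eq_intros simp: add.commute add.left_commute)
    then show "((\<lambda>s. f (x + s *\<^sub>R a + h *\<^sub>R b) - f (x + s *\<^sub>R a) - (s * h) *\<^sub>R c) has_derivative
        (\<lambda>k. k *\<^sub>R (fa (x + s *\<^sub>R a + h *\<^sub>R b) - fa (x + s *\<^sub>R a) - h *\<^sub>R c))) (at s within {0..h})"
      by (simp add: has_vector_derivative_def has_derivative_at_withinI)
    have "norm (k *\<^sub>R (fa (x + s *\<^sub>R a + h *\<^sub>R b) - fa (x + s *\<^sub>R a) - h *\<^sub>R c)) \<le> \<epsilon> * h * norm k" for k
      using mult_right_mono[OF inner[of s], of "\<bar>k\<bar>"] s by (simp add: mult.commute)
    then show "onorm (\<lambda>k. k *\<^sub>R (fa (x + s *\<^sub>R a + h *\<^sub>R b) - fa (x + s *\<^sub>R a) - h *\<^sub>R c)) \<le> \<epsilon> * h"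
      by (rule onorm_le)
  qed (use \<open>h > 0\<close> in auto)
  then show ?thesis using \<open>h > 0\<close> by (simp add: algebra_simps)
qed

text \<open>
  Both mixed derivatives are limits of the same second difference quotient, by
  \<open>second_difference_bound\<close> with the roles of $a$ and $b$ exchanged.
\<close>

lemma mixed_dirderivs_commute:
  fixes f :: "'a::real_normed_vector \<Rightarrow> 'b::real_normed_vector"
  assumes "open S" "x \<in> S"
    and fa: "\<And>y. y \<in> S \<Longrightarrow> has_dirderiv f y a (fa y)" and fb: "\<And>y. y \<in> S \<Longrightarrow> has_dirderiv f y b (fb y)"
    and fab: "\<And>y. y \<in> S \<Longrightarrow> has_dirderiv fa y b (fab y)" and fba: "\<And>y. y \<in> S \<Longrightarrow> has_dirderiv fb y a (fba y)"
    and ca: "continuous_on S fab" and cb: "continuous_on S fba"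
  shows "fab x = fba x"
proof (rule ccontr)
  assume ne: "fab x \<noteq> fba x"
  define \<epsilon> where "\<epsilon> = norm (fab x - fba x) / 3"
  have \<epsilon>: "\<epsilon> > 0" using ne by (simp add: \<epsilon>_def)
  have "\<forall>\<^sub>F y in nhds x. y \<in> S \<and> dist (fab y) (fab x) < \<epsilon> \<and> dist (fba y) (fba x) < \<epsilon>"
  proof -
    have "isCont fab x" "isCont fba x"
      using ca cb assms(1,2) by (auto simp: continuous_on_eq_continuous_at)
    then show ?thesis
      using assms(1,2) \<epsilon> unfolding continuous_at_eps_delta
      by (intro eventually_conj eventually_nhds_in_open)
        (auto simp: eventually_nhds_metric)
  qed
  then obtain \<delta> where \<delta>: "\<delta> > 0"
    "\<And>y. dist y x < \<delta> \<Longrightarrow> y \<in> S \<and> dist (fab y) (fab x) < \<epsilon> \<and> dist (fba y) (fba x) < \<epsilon>"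
    by (auto simp: eventually_nhds_metric)
  \<comment> \<open>Small enough that the parallelogram spanned by $h a$ and $h b$ at $x$ stays within distance $\delta$.\<close>
  define h where "h = \<delta> / (2 * (1 + norm a + norm b))"
  have pos: "1 + norm a + norm b > 0" by (simp add: add_pos_nonneg)
  have h: "h > 0" using \<delta>(1) pos by (simp add: h_def)
  have near: "dist (x + s *\<^sub>R a + t *\<^sub>R b) x < \<delta>" if "0 \<le> s" "s \<le> h" "0 \<le> t" "t \<le> h" for s t
  proof -
    have "dist (x + s *\<^sub>R a + t *\<^sub>R b) x = norm (s *\<^sub>R a + t *\<^sub>R b)" by (simp add: dist_norm add.assoc)
    also have "\<dots> \<le> s * norm a + t * norm b" using norm_triangle_ineq[of "s *\<^sub>R a" "t *\<^sub>R b"] that by simp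
    also have "\<dots> \<le> h * norm a + h * norm b" using that by (intro add_mono mult_right_mono) auto
    also have "\<dots> \<le> h * (1 + norm a + norm b)" using h by (simp add: algebra_simps)
    also have "\<dots> = \<delta> / 2"
    proof -
      have "\<delta> / (2 * P) * P = \<delta> / 2" if "P > 0" for P :: real using that by simp
      from this[OF pos] show ?thesis by (simp only: h_def)
    qed
    finally show ?thesis using \<delta>(1) by simp
  qed
  note n2 = near[THEN \<delta>(2)]
  have 1: "norm (f (x + h *\<^sub>R a + h *\<^sub>R b) - f (x + h *\<^sub>R a) - f (x + h *\<^sub>R b) + f x - (h * h) *\<^sub>R fab x) \<le> \<epsilon> * h * h"
    by (rule second_difference_bound[OF h, where fa = fa and fab = fab])
      (use n2 fa fab in \<open>auto simp: dist_norm less_imp_le\<close>)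
  have 2: "norm (f (x + h *\<^sub>R b + h *\<^sub>R a) - f (x + h *\<^sub>R b) - f (x + h *\<^sub>R a) + f x - (h * h) *\<^sub>R fba x) \<le> \<epsilon> * h * h"
  proof (rule second_difference_bound[OF h, where fa = fb and fab = fba])
    fix s t :: real assume st: "0 \<le> s" "s \<le> h" "0 \<le> t" "t \<le> h"
    have e: "x + s *\<^sub>R b + t *\<^sub>R a = x + t *\<^sub>R a + s *\<^sub>R b" by simp
    show "has_dirderiv f (x + s *\<^sub>R b + t *\<^sub>R a) b (fb (x + s *\<^sub>R b + t *\<^sub>R a))"
      "has_dirderiv fb (x + s *\<^sub>R b + t *\<^sub>R a) a (fba (x + s *\<^sub>R b + t *\<^sub>R a))"
      "norm (fba (x + s *\<^sub>R b + t *\<^sub>R a) - fba x) \<le> \<epsilon>"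
      unfolding e using n2[OF st(3,4,1,2)] fb fba by (auto simp: dist_norm less_imp_le)
  qed
  define Z where "Z = f (x + h *\<^sub>R a + h *\<^sub>R b) - f (x + h *\<^sub>R a) - f (x + h *\<^sub>R b) + f x"
  have "norm ((h * h) *\<^sub>R (fab x - fba x)) \<le> norm (Z - (h * h) *\<^sub>R fab x) + norm (Z - (h * h) *\<^sub>R fba x)"
    using norm_triangle_ineq4[of "Z - (h * h) *\<^sub>R fba x" "Z - (h * h) *\<^sub>R fab x"]
    by (simp add: scaleR_diff_right norm_minus_commute)
  also have "\<dots> \<le> 2 * \<epsilon> * (h * h)"
    using 1 2 by (simp add: Z_def algebra_simps)
  finally have "(h * h) * norm (fab x - fba x) \<le> (h * h) * (2 * \<epsilon>)"
    by (simp add: mult.commute mult.left_commute)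
  then have "(h * h) * (3 * \<epsilon>) \<le> (h * h) * (2 * \<epsilon>)" by (simp add: \<epsilon>_def)
  then show False using h \<epsilon> by simp
qed

lemma C2_on_has_dirderiv:
  assumes "C2_on S f" "x \<in> S"
  shows "has_dirderiv f x (axis j 1) (pd j f x)" "has_dirderiv (pd j f) x (axis k 1) (pd k (pd j f) x)"
  using assms by (auto simp: C2_on_def intro: pdiff_has_dirderiv)

lemma C2_on_C1_partials:
  assumes "C2_on S f"
  shows "has_C1_partials S f (\<lambda>j. pd j f)" "has_C1_partials S (pd j f) (\<lambda>k. pd k (pd j f))"
  using assms by (auto simp: C2_on_def has_C1_partials_def intro: pdiff_has_dirderiv)

lemma C2_on_commute:
  assumes "C2_on S f" "open S" "x \<in> S"
  shows "pd j (pd k f) x = pd k (pd j f) x"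
  by (rule mixed_dirderivs_commute[where f = f and S = S and a = "axis k 1" and b = "axis j 1" and fa = "pd k f" and fb = "pd j f"])
    (use assms C2_on_has_dirderiv[OF assms(1)] in \<open>auto simp: C2_on_def\<close>)

lemma corr_bump_by_parts:
  fixes g :: "real^3 \<Rightarrow> 'b::euclidean_space"
  assumes "0 < r" "r < R" and g: "has_C1_partials (ball x R) g g'"
  shows "(bump r \<star> g' j) x = - (bump' r j \<star> g) x" "(bump' r k \<star> g' j) x = - (bump'' r j k \<star> g) x"
proof -
  note r = assms(1)
  show "(bump r \<star> g' j) x = - (bump' r j \<star> g) x"
    by (rule corr_by_parts_C1[OF assms(1,2) bump_support(1)[OF r] bump_support(2)[OF r] bump_dirderiv[OF r]
          kernel_continuous(3)[OF r] kernel_continuous(4)[OF r]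
          has_C1_partialsD(3)[OF g] has_C1_partialsD(1)[OF g] has_C1_partialsD(2)[OF g]])
  show "(bump' r k \<star> g' j) x = - (bump'' r j k \<star> g) x"
    by (rule corr_by_parts_C1[OF assms(1,2) bump_support(2)[OF r] bump_support(3)[OF r] bump'_dirderiv[OF r]
          kernel_continuous(4)[OF r] kernel_continuous(5)[OF r]
          has_C1_partialsD(3)[OF g] has_C1_partialsD(1)[OF g] has_C1_partialsD(2)[OF g]])
qed

text \<open>
  By symmetry $\sum_k p_j \star \partial_k \partial_k f = \sum_k p_k \star \partial_k \partial_j f$, and \<open>parametrix_div\<close> for $\partial_j f$ evaluates
  the right side. The gradient of $f$ is thereby expressed by $\Delta f$ and $f$ alone, a form that is stable under
  limits in which only these two are controlled.
\<close>

lemma parametrix_representation: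
  fixes f :: "real^3 \<Rightarrow> 'b::euclidean_space"
  assumes "0 < r" "r < R" and f: "C2_on (ball x R) f"
  shows "pd j f x = (parametrix r j \<star> laplacian f) x - (bump' r j \<star> f) x"
proof -
  have Rx: "x \<in> ball x R" using assms by simp
  have sub: "cball x r \<subseteq> ball x R" using assms by auto
  have int: "integrable lborel (\<lambda>z. parametrix r j z *\<^sub>R pd k (pd k f) (x + z))" for j k
    by (rule integrable_shift_mult[OF integrable_parametrix])
      (use assms parametrix_support(1)[OF assms(1), OF less_imp_le] continuous_on_subset[OF has_C1_partialsD(2)[OF C2_on_C1_partials(2)[OF f]] sub] in auto)
  have "(parametrix r j \<star> laplacian f) x = (\<Sum>k\<in>UNIV. (parametrix r j \<star> pd k (pd k f)) x)"
    unfolding corr_def laplacian_def scaleR_sum_right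
    by (rule Bochner_Integration.integral_sum) (use int in auto)
  also have "\<dots> = (\<Sum>k\<in>UNIV. (parametrix r k \<star> pd j (pd k f)) x)"
    by (intro sum.cong refl parametrix_symmetric[OF assms(1,2) C2_on_C1_partials(2)[OF f]])
  also have "\<dots> = (\<Sum>k\<in>UNIV. (parametrix r k \<star> pd k (pd j f)) x)"
  proof (intro sum.cong refl)
    fix k
    have "parametrix r k z *\<^sub>R pd j (pd k f) (x + z) = parametrix r k z *\<^sub>R pd k (pd j f) (x + z)" for z
    proof (cases "norm z \<ge> r")
      case False
      then show ?thesis using C2_on_commute[OF f open_ball, of "x + z" j k] assms by (simp add: dist_norm)
    qed (use assms in \<open>simp add: parametrix_support\<close>)
    then show "(parametrix r k \<star> pd j (pd k f)) x = (parametrix r k \<star> pd k (pd j f)) x"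
      by (simp only: corr_def)
  qed
  also have "\<dots> = pd j f x - (bump r \<star> pd j f) x"
    by (rule parametrix_div[OF assms(1,2) C2_on_C1_partials(2)[OF f]])
  also have "(bump r \<star> pd j f) x = - (bump' r j \<star> f) x"
    by (rule corr_bump_by_parts(1)[OF assms(1,2) C2_on_C1_partials(1)[OF f]])
  finally show ?thesis by simp
qed

text \<open>
  Here the derivative falls on $f$, and the kernel may be singular.
\<close>

lemma corr_has_dirderiv:
  fixes f :: "'a::euclidean_space \<Rightarrow> 'b::euclidean_space"
  assumes "0 < r" "r < R" and a: "integrable lborel a" and supp: "\<And>z. norm z > r \<Longrightarrow> a z = 0"
    and f: "\<And>y. y \<in> ball x R \<Longrightarrow> has_dirderiv f y e (f' y)"
    and cont: "continuous_on (ball x R) f" and cont': "continuous_on (ball x R) f'"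
  shows "has_dirderiv (a \<star> f) x e ((a \<star> f') x)"
proof -
  define R1 where "R1 = (r + R) / 2"
  have R1: "r < R1" "R1 < R" "0 < R1" using assms(1,2) by (auto simp: R1_def)
  have sub: "cball x R1 \<subseteq> ball x R" using R1 by auto
  obtain B where B: "0 \<le> B" "\<And>y. y \<in> cball x R1 \<Longrightarrow> norm (f' y) \<le> B"
    using continuous_on_compact_norm_bound[OF continuous_on_subset[OF cont' sub] compact_cball] by blast
  define \<delta> where "\<delta> = (R1 - r) / (1 + norm e)"
  have pos: "1 + norm e > 0" by (simp add: add_pos_nonneg)
  have \<delta>: "\<delta> > 0" using R1 pos by (simp add: \<delta>_def)
  have \<delta>e: "norm (t *\<^sub>R e) \<le> R1 - r" if "\<bar>t\<bar> < \<delta>" for t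
  proof -
    have "norm (t *\<^sub>R e) \<le> \<delta> * (1 + norm e)" using that \<delta> by (auto intro!: mult_mono)
    then show ?thesis using pos by (simp add: \<delta>_def)
  qed
  have inb: "x + z + t *\<^sub>R e \<in> cball x R1" if "norm z \<le> r" "\<bar>t\<bar> < \<delta>" for z t
  proof -
    have "norm (z + t *\<^sub>R e) \<le> R1" using norm_triangle_ineq[of z "t *\<^sub>R e"] \<delta>e[OF that(2)] that(1) by linarith
    then have "x + (z + t *\<^sub>R e) \<in> cball x R1" by (metis add_diff_cancel_left' dist_commute dist_norm mem_cball)
    then show ?thesis by (simp add: add.assoc)
  qed
  have int: "integrable lborel (\<lambda>z. a z *\<^sub>R f (x + t *\<^sub>R e + z))" if "\<bar>t\<bar> < \<delta>" for t
  proof (rule integrable_shift_mult[OF a supp])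
    have "cball (x + t *\<^sub>R e) r \<subseteq> ball x R"
    proof
      fix y assume "y \<in> cball (x + t *\<^sub>R e) r"
      then have "x + (y - (x + t *\<^sub>R e)) + t *\<^sub>R e \<in> cball x R1"
        using that by (intro inb) (auto simp: dist_norm norm_minus_commute)
      then show "y \<in> ball x R" using sub by auto
    qed
    then show "continuous_on (cball (x + t *\<^sub>R e) r) f" by (rule continuous_on_subset[OF cont])
  qed
  have [measurable]: "a \<in> borel_measurable borel" using a by auto
  have int': "integrable lborel (\<lambda>z. a z *\<^sub>R f' (x + z))"
    by (rule integrable_shift_mult[OF a supp continuous_on_subset[OF cont']]) (use assms in auto)
  show ?thesis
    unfolding has_dirderiv_iff_tendsto tendsto_at_iff_sequentially
  proof (intro allI impI, unfold o_def)
    fix s :: "nat \<Rightarrow> real" assume s0: "\<forall>n. s n \<in> UNIV - {0}" and s: "s \<longlonglongrightarrow> 0"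
    have "\<forall>\<^sub>F n in sequentially. dist (s n) 0 < \<delta>" using s \<delta> by (rule tendstoD)
    then obtain N where N: "\<And>n. n \<ge> N \<Longrightarrow> \<bar>s n\<bar> < \<delta>" by (auto simp: eventually_sequentially)
    define q where "q n z = a z *\<^sub>R ((1 / s n) *\<^sub>R (f (x + z + s n *\<^sub>R e) - f (x + z)))" for n z
    have qint: "integrable lborel (q n)" "integral\<^sup>L lborel (q n) = (1 / s n) *\<^sub>R ((a \<star> f) (x + s n *\<^sub>R e) - (a \<star> f) x)"
      if "n \<ge> N" for n
    proof -
      have i: "integrable lborel (\<lambda>z. a z *\<^sub>R f (x + s n *\<^sub>R e + z))" "integrable lborel (\<lambda>z. a z *\<^sub>R f (x + z))"
        using int[OF N[OF that]] int[of 0] \<delta> by auto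
      have q: "q n = (\<lambda>z. (1 / s n) *\<^sub>R (a z *\<^sub>R f (x + s n *\<^sub>R e + z) - a z *\<^sub>R f (x + z)))"
        by (auto simp: q_def fun_eq_iff algebra_simps)
      show "integrable lborel (q n)" unfolding q using i by simp
      show "integral\<^sup>L lborel (q n) = (1 / s n) *\<^sub>R ((a \<star> f) (x + s n *\<^sub>R e) - (a \<star> f) x)"
        unfolding q corr_def using i by simp
    qed
    have "(\<lambda>n. integral\<^sup>L lborel (q (n + N))) \<longlonglongrightarrow> (a \<star> f') x"
      unfolding corr_def
    proof (rule integral_dominated_convergence[where w = "\<lambda>z. \<bar>a z\<bar> * B"])
      show "(\<lambda>z. a z *\<^sub>R f' (x + z)) \<in> borel_measurable lborel" using borel_measurable_integrable[OF int'] .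
      show "q (n + N) \<in> borel_measurable lborel" for n using qint(1)[of "n + N"] by auto
      show "integrable lborel (\<lambda>z. \<bar>a z\<bar> * B)" using a by simp
      show "AE z in lborel. (\<lambda>n. q (n + N) z) \<longlonglongrightarrow> a z *\<^sub>R f' (x + z)"
      proof (intro AE_I2)
        fix z
        show "(\<lambda>n. q (n + N) z) \<longlonglongrightarrow> a z *\<^sub>R f' (x + z)"
        proof (cases "norm z \<le> r")
          case True
          then have "has_dirderiv f (x + z) e (f' (x + z))" using assms(2) by (intro f) (simp add: dist_norm)
          then have "(\<lambda>n. (1 / s n) *\<^sub>R (f (x + z + s n *\<^sub>R e) - f (x + z))) \<longlonglongrightarrow> f' (x + z)"
            unfolding has_dirderiv_iff_tendsto tendsto_at_iff_sequentially o_def using s0 s by blast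
          then show ?thesis unfolding q_def
            by (intro tendsto_scaleR tendsto_const) (rule LIMSEQ_ignore_initial_segment)
        next
          case False then show ?thesis using supp[of z] by (simp add: q_def)
        qed
      qed
      show "AE z in lborel. norm (q (n + N) z) \<le> \<bar>a z\<bar> * B" for n
      proof (intro AE_I2)
        fix z
        show "norm (q (n + N) z) \<le> \<bar>a z\<bar> * B"
        proof (cases "norm z \<le> r")
          case True
          have "norm (f (x + z + s (n + N) *\<^sub>R e) - f (x + z)) \<le> B * \<bar>s (n + N)\<bar>"
          proof (rule has_dirderiv_bound[where f' = f'])
            fix t assume t: "t \<in> closed_segment 0 (s (n + N))"
            then have "\<bar>t\<bar> < \<delta>" using N[of "n + N"] by (auto simp: closed_segment_eq_real_ivl split: if_splits)
            note seg = inb[OF True this]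
            show "has_dirderiv f (x + z + t *\<^sub>R e) e (f' (x + z + t *\<^sub>R e))" using f seg sub by blast
            show "norm (f' (x + z + t *\<^sub>R e)) \<le> B" using B seg by blast
          qed
          then have "norm ((1 / s (n + N)) *\<^sub>R (f (x + z + s (n + N) *\<^sub>R e) - f (x + z))) \<le> B"
            using s0 by (simp add: pos_divide_le_eq)
          then show ?thesis unfolding q_def norm_scaleR[of "a z"] by (intro mult_left_mono) auto
        next
          case False then show ?thesis using supp[of z] by (simp add: q_def)
        qed
      qed
    qed
    then have "(\<lambda>n. integral\<^sup>L lborel (q n)) \<longlonglongrightarrow> (a \<star> f') x" by (rule LIMSEQ_offset)
    then show "(\<lambda>n. (1 / s n) *\<^sub>R ((a \<star> f) (x + s n *\<^sub>R e) - (a \<star> f) x)) \<longlonglongrightarrow> (a \<star> f') x"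
      by (rule Lim_transform_eventually) (use qint(2) in \<open>auto simp: eventually_sequentially\<close>)
  qed
qed

lemma smooth_kernel_integrable:
  fixes w :: "'a::euclidean_space \<Rightarrow> 'b::euclidean_space"
  assumes w: "integrable lborel w" and supp: "\<And>y. norm y > M \<Longrightarrow> w y = 0"
    and ck: "continuous_on UNIV k"
  shows "integrable lborel (\<lambda>y. k (y - x) *\<^sub>R w y)"
proof -
  obtain B where B: "0 \<le> B" "\<And>z. z \<in> cball 0 (M + norm x) \<Longrightarrow> norm (k z) \<le> B"
    using continuous_bounded_on_cball[OF ck] by blast
  have [measurable]: "k \<in> borel_measurable borel" "w \<in> borel_measurable borel"
    using ck w by (auto intro: borel_measurable_continuous_onI)
  show ?thesis
  proof (rule Bochner_Integration.integrable_bound[where f = "\<lambda>y. B *\<^sub>R w y"])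
    show "integrable lborel (\<lambda>y. B *\<^sub>R w y)" using w by simp
    have "norm (k (y - x) *\<^sub>R w y) \<le> norm (B *\<^sub>R w y)" for y
    proof (cases "norm y \<le> M")
      case True
      then have "norm (k (y - x)) \<le> B" using norm_triangle_ineq4[of y x] by (intro B(2)) simp
      then show ?thesis using B(1) by (simp add: mult_right_mono)
    qed (use supp in simp)
    then show "AE y in lborel. norm (k (y - x) *\<^sub>R w y) \<le> norm (B *\<^sub>R w y)" by simp
  qed measurable
qed

text \<open>
  Here the derivative falls on the kernel, and the density is merely integrable.
\<close>

lemma smooth_kernel_has_dirderiv:
  fixes w :: "'a::euclidean_space \<Rightarrow> 'b::euclidean_space"
  assumes w: "integrable lborel w" and supp: "\<And>y. norm y > M \<Longrightarrow> w y = 0"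
    and k: "\<And>z. has_dirderiv k z e (k' z)" and ck: "continuous_on UNIV k" and ck': "continuous_on UNIV k'"
  shows "has_dirderiv (\<lambda>x. \<integral>y. k (y - x) *\<^sub>R w y \<partial>lborel) x e (- (\<integral>y. k' (y - x) *\<^sub>R w y \<partial>lborel))"
proof -
  define K where "K = M + norm x + norm e"
  obtain B where B: "0 \<le> B" "\<And>z. z \<in> cball 0 K \<Longrightarrow> norm (k' z) \<le> B"
    using continuous_bounded_on_cball[OF ck'] by blast
  have inb: "y - x - t *\<^sub>R e \<in> cball 0 K" if "norm y \<le> M" "\<bar>t\<bar> \<le> 1" for y t
  proof -
    have "norm (t *\<^sub>R e) \<le> norm e" using that(2) mult_right_mono[of "\<bar>t\<bar>" 1 "norm e"] by simp
    then show ?thesis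
      using norm_triangle_ineq4[of "y - x" "t *\<^sub>R e"] norm_triangle_ineq4[of y x] that(1) by (simp add: K_def)
  qed
  have [measurable]: "k \<in> borel_measurable borel" "k' \<in> borel_measurable borel" "w \<in> borel_measurable borel"
    using ck ck' w by (auto intro: borel_measurable_continuous_onI)
  have int: "integrable lborel (\<lambda>y. k (y - x - t *\<^sub>R e) *\<^sub>R w y)" for t
    using smooth_kernel_integrable[OF w supp ck, where x = "x + t *\<^sub>R e"] by (simp add: diff_diff_add)
  show ?thesis
    unfolding has_dirderiv_iff_tendsto tendsto_at_iff_sequentially
  proof (intro allI impI, unfold o_def)
    fix s :: "nat \<Rightarrow> real" assume s0: "\<forall>n. s n \<in> UNIV - {0}" and s: "s \<longlonglongrightarrow> 0"
    have "\<forall>\<^sub>F n in sequentially. dist (s n) 0 < 1" using s by (rule tendstoD) simp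
    then obtain N where N: "\<And>n. n \<ge> N \<Longrightarrow> \<bar>s n\<bar> \<le> 1" by (force simp: eventually_sequentially)
    define q where "q n y = ((1 / s n) * (k (y - x - s n *\<^sub>R e) - k (y - x))) *\<^sub>R w y" for n y
    have qint: "integral\<^sup>L lborel (q n) = (1 / s n) *\<^sub>R ((\<integral>y. k (y - (x + s n *\<^sub>R e)) *\<^sub>R w y \<partial>lborel) - (\<integral>y. k (y - x) *\<^sub>R w y \<partial>lborel))"
      if "n \<ge> N" for n
    proof -
      have i: "integrable lborel (\<lambda>y. k (y - x - s n *\<^sub>R e) *\<^sub>R w y)" "integrable lborel (\<lambda>y. k (y - x) *\<^sub>R w y)"
        using int[of "s n"] int[of 0] by auto
      have q: "q n = (\<lambda>y. (1 / s n) *\<^sub>R (k (y - x - s n *\<^sub>R e) *\<^sub>R w y - k (y - x) *\<^sub>R w y))"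
        by (auto simp: q_def fun_eq_iff algebra_simps)
      show ?thesis
        unfolding q using i by (simp add: diff_diff_add)
    qed
    have "(\<lambda>n. integral\<^sup>L lborel (q (n + N))) \<longlonglongrightarrow> (\<integral>y. - k' (y - x) *\<^sub>R w y \<partial>lborel)"
    proof (rule integral_dominated_convergence[where w = "\<lambda>y. B * norm (w y)"])
      show "(\<lambda>y. - k' (y - x) *\<^sub>R w y) \<in> borel_measurable lborel" by measurable
      show "q (n + N) \<in> borel_measurable lborel" for n unfolding q_def[abs_def] by measurable
      show "integrable lborel (\<lambda>y. B * norm (w y))" using w by simp
      show "AE y in lborel. (\<lambda>n. q (n + N) y) \<longlonglongrightarrow> - k' (y - x) *\<^sub>R w y"
      proof (intro AE_I2)
        fix y
        have "(\<lambda>n. - s n) \<longlonglongrightarrow> 0" using tendsto_minus[OF s] by simp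
        then have "(\<lambda>n. (1 / (- s n)) *\<^sub>R (k (y - x + (- s n) *\<^sub>R e) - k (y - x))) \<longlonglongrightarrow> k' (y - x)"
          using k[of "y - x", unfolded has_dirderiv_iff_tendsto tendsto_at_iff_sequentially o_def,
              rule_format, of "\<lambda>n. - s n"] s0 by auto
        then have "(\<lambda>n. - ((1 / (- s n)) *\<^sub>R (k (y - x + (- s n) *\<^sub>R e) - k (y - x)))) \<longlonglongrightarrow> - k' (y - x)"
          by (rule tendsto_minus)
        then have "(\<lambda>n. (1 / s n) * (k (y - x - s n *\<^sub>R e) - k (y - x))) \<longlonglongrightarrow> - k' (y - x)"
          by simp
        then show "(\<lambda>n. q (n + N) y) \<longlonglongrightarrow> - k' (y - x) *\<^sub>R w y"
          unfolding q_def by (intro tendsto_scaleR tendsto_const) (rule LIMSEQ_ignore_initial_segment)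
      qed
      show "AE y in lborel. norm (q (n + N) y) \<le> B * norm (w y)" for n
      proof (intro AE_I2)
        fix y
        show "norm (q (n + N) y) \<le> B * norm (w y)"
        proof (cases "norm y \<le> M")
          case True
          have "norm (k (y - x + (- s (n + N)) *\<^sub>R e) - k (y - x)) \<le> B * \<bar>- s (n + N)\<bar>"
          proof (rule has_dirderiv_bound[where f' = k', OF k])
            fix t assume "t \<in> closed_segment 0 (- s (n + N))"
            then have "\<bar>- t\<bar> \<le> 1" using N[of "n + N"] by (auto simp: closed_segment_eq_real_ivl split: if_splits)
            from inb[OF True this] show "norm (k' (y - x + t *\<^sub>R e)) \<le> B" by (intro B(2)) simp
          qed
          then have "\<bar>(1 / s (n + N)) * (k (y - x - s (n + N) *\<^sub>R e) - k (y - x))\<bar> \<le> B"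
            using s0 by (simp add: pos_divide_le_eq abs_mult)
          then show ?thesis unfolding q_def norm_scaleR by (intro mult_right_mono) auto
        next
          case False then show ?thesis using supp[of y] by (simp add: q_def)
        qed
      qed
    qed
    then have "(\<lambda>n. integral\<^sup>L lborel (q n)) \<longlonglongrightarrow> - (\<integral>y. k' (y - x) *\<^sub>R w y \<partial>lborel)"
      by (simp add: LIMSEQ_offset)
    then show "(\<lambda>n. (1 / s n) *\<^sub>R ((\<integral>y. k (y - (x + s n *\<^sub>R e)) *\<^sub>R w y \<partial>lborel) - (\<integral>y. k (y - x) *\<^sub>R w y \<partial>lborel)))
       \<longlonglongrightarrow> - (\<integral>y. k' (y - x) *\<^sub>R w y \<partial>lborel)"
      by (rule Lim_transform_eventually) (use qint in \<open>auto simp: eventually_sequentially\<close>)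
  qed
qed

section \<open>Time integrals of solutions of the wave equation\<close>

lemma continuous_on_slices:
  assumes c: "continuous_on (S \<times> T) (\<lambda>(y, s). f y s)"
  shows "y \<in> S \<Longrightarrow> continuous_on T (\<lambda>s. f y s)" "s \<in> T \<Longrightarrow> continuous_on S (\<lambda>y. f y s)"
proof -
  have p: "continuous_on T (\<lambda>s. (y, s))" "continuous_on S (\<lambda>y. (y, s))"
    by (intro continuous_on_Pair continuous_on_const continuous_on_id)+
  show "y \<in> S \<Longrightarrow> continuous_on T (\<lambda>s. f y s)" "s \<in> T \<Longrightarrow> continuous_on S (\<lambda>y. f y s)"
    using continuous_on_compose2[OF c p(1)] continuous_on_compose2[OF c p(2)] by auto
qed

lemma parametric_integral_has_dirderiv:
  fixes f f' :: "'a::euclidean_space \<Rightarrow> real \<Rightarrow> 'b::euclidean_space"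
  assumes "open S" "x \<in> S"
    and der: "\<And>y s. y \<in> S \<Longrightarrow> s \<in> {a..b} \<Longrightarrow> has_dirderiv (\<lambda>y. f y s) y e (f' y s)"
    and c: "continuous_on (S \<times> {a..b}) (\<lambda>(y, s). f y s)"
    and c': "continuous_on (S \<times> {a..b}) (\<lambda>(y, s). f' y s)"
  shows "has_dirderiv (\<lambda>y. integral {a..b} (f y)) x e (integral {a..b} (f' x))"
proof -
  obtain \<rho> where \<rho>: "\<rho> > 0" "ball x \<rho> \<subseteq> S" using assms(1,2) open_contains_ball by blast
  define \<delta> where "\<delta> = \<rho> / (1 + norm e)"
  have pos: "1 + norm e > 0" by (simp add: add_pos_nonneg)
  have \<delta>: "\<delta> > 0" using \<rho> pos by (simp add: \<delta>_def)
  have inS: "x + h *\<^sub>R e \<in> S" if "h \<in> {-\<delta><..<\<delta>}" for h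
  proof -
    have "norm (h *\<^sub>R e) \<le> \<bar>h\<bar> * (1 + norm e)" by (simp add: algebra_simps)
    also have "\<dots> < \<delta> * (1 + norm e)" using that pos by (intro mult_strict_right_mono) auto
    also have "\<dots> = \<rho>" using pos by (simp add: \<delta>_def)
    finally show ?thesis using \<rho>(2) by (auto simp: dist_norm)
  qed
  have cont_slice: "continuous_on {a..b} (f y)" if "y \<in> S" for y
    using continuous_on_slices(1)[OF c that] .
  have "((\<lambda>h. integral (cbox a b) (f (x + h *\<^sub>R e))) has_vector_derivative
      integral (cbox a b) (f' (x + 0 *\<^sub>R e))) (at 0 within {-\<delta><..<\<delta>})"
  proof (rule leibniz_rule_vector_derivative[where fx = "\<lambda>h. f' (x + h *\<^sub>R e)"])
    fix h s assume h: "h \<in> {-\<delta><..<\<delta>}" and s: "s \<in> cbox a b"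
    show "((\<lambda>h. f (x + h *\<^sub>R e) s) has_vector_derivative f' (x + h *\<^sub>R e) s) (at h within {-\<delta><..<\<delta>})"
      using has_dirderiv_along_line[of "\<lambda>y. f y s" x h e "f' (x + h *\<^sub>R e) s"] der[OF inS[OF h], of s] s
      by (simp add: has_vector_derivative_at_within)
  next
    fix h assume "h \<in> {-\<delta><..<\<delta>}"
    then show "f (x + h *\<^sub>R e) integrable_on cbox a b"
      using integrable_continuous_real[OF cont_slice[OF inS]] by simp
  next
    show "continuous_on ({-\<delta><..<\<delta>} \<times> cbox a b) (\<lambda>(h, s). f' (x + h *\<^sub>R e) s)"
    proof -
      have "continuous_on ({-\<delta><..<\<delta>} \<times> {a..b}) (\<lambda>p. (x + fst p *\<^sub>R e, snd p))"
        by (intro continuous_intros)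
      from continuous_on_compose2[OF c' this]
      have "(\<lambda>p. (x + fst p *\<^sub>R e, snd p)) ` ({-\<delta><..<\<delta>} \<times> {a..b}) \<subseteq> S \<times> {a..b}
          \<Longrightarrow> ?thesis" by (simp add: case_prod_beta)
      moreover have "(\<lambda>p. (x + fst p *\<^sub>R e, snd p)) ` ({-\<delta><..<\<delta>} \<times> {a..b}) \<subseteq> S \<times> {a..b}"
        using inS by auto
      ultimately show ?thesis by blast
    qed
  qed (use \<delta> in auto)
  moreover have "at 0 within {-\<delta><..<\<delta>} = at 0" using \<delta> by (intro at_within_open) auto
  ultimately show ?thesis by (simp add: has_dirderiv_def)
qed

lemma parametric_integral_continuous:
  fixes f :: "'a::euclidean_space \<Rightarrow> real \<Rightarrow> 'b::euclidean_space"
  assumes "continuous_on (S \<times> {a..b}) (\<lambda>(y, s). f y s)"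
  shows "continuous_on S (\<lambda>y. integral {a..b} (f y))"
  using integral_continuous_on_param[of S a b f] assms by simp

lemma C22_on_slice:
  assumes "C22_on \<Omega> u" "t > 0"
  shows "C2_on \<Omega> (\<lambda>y. u y t)"
proof -
  have s: "continuous_on \<Omega> (\<lambda>y. f y t)" if "continuous_on (\<Omega> \<times> {0<..}) (\<lambda>(y, s). f y s)" for f :: "real^3 \<Rightarrow> real \<Rightarrow> 'a"
    by (rule continuous_on_slices(2)[OF that]) (use assms(2) in simp)
  show ?thesis
    unfolding C2_on_def
  proof (intro conjI allI ballI)
    show "continuous_on \<Omega> (\<lambda>y. u y t)" by (rule s) (use assms(1) in \<open>simp add: C22_on_def\<close>)
    show "continuous_on \<Omega> (pd j (\<lambda>y. u y t))" for j
      using s[of "\<lambda>y s. pd j (\<lambda>y. u y s) y"] assms(1) by (simp add: C22_on_def)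
    show "continuous_on \<Omega> (pd k (pd j (\<lambda>y. u y t)))" for j k
      using s[of "\<lambda>y s. pd k (pd j (\<lambda>y. u y s)) y"] assms(1) by (simp add: C22_on_def)
  qed (use assms in \<open>simp_all add: C22_on_def\<close>)
qed

lemma C2_on_parametric_integral:
  fixes u :: "real^3 \<Rightarrow> real \<Rightarrow> 'b::euclidean_space"
  assumes "open \<Omega>" and u: "C22_on \<Omega> u" and "0 < a" and \<theta>: "continuous_on {a..b} \<theta>"
  defines "U \<equiv> \<lambda>y. integral {a..b} (\<lambda>s. \<theta> s *\<^sub>R u y s)"
  shows "C2_on \<Omega> U"
    and "\<And>x j. x \<in> \<Omega> \<Longrightarrow> pd j U x = integral {a..b} (\<lambda>s. \<theta> s *\<^sub>R pd j (\<lambda>y. u y s) x)"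
    and "\<And>x. x \<in> \<Omega> \<Longrightarrow> laplacian U x = integral {a..b} (\<lambda>s. \<theta> s *\<^sub>R laplacian (\<lambda>y. u y s) x)"
proof -
  have weight: "continuous_on (\<Omega> \<times> {a..b}) (\<lambda>(y, s). \<theta> s *\<^sub>R f y s)"
    if "continuous_on (\<Omega> \<times> {0<..}) (\<lambda>(y, s). f y s)" for f :: "real^3 \<Rightarrow> real \<Rightarrow> 'b"
  proof -
    have "continuous_on (\<Omega> \<times> {a..b}) (\<lambda>(y, s). f y s)"
      by (rule continuous_on_subset[OF that]) (use \<open>0 < a\<close> in auto)
    moreover have "continuous_on (\<Omega> \<times> {a..b}) (\<lambda>p. \<theta> (snd p))"
      by (rule continuous_on_compose2[OF \<theta>]) (auto intro!: continuous_intros)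
    ultimately show ?thesis by (auto simp: case_prod_beta intro!: continuous_intros)
  qed
  have wder: "has_dirderiv (\<lambda>y. \<theta> s *\<^sub>R f y) x e (\<theta> s *\<^sub>R d)" if "has_dirderiv f x e d" for f :: "real^3 \<Rightarrow> 'b" and x e d s
    by (rule has_dirderiv_bounded_linear[OF bounded_linear_scaleR_right that])
  have pos: "s > 0" if "s \<in> {a..b}" for s using that \<open>0 < a\<close> by auto
  have c0: "continuous_on (\<Omega> \<times> {a..b}) (\<lambda>(y, s). \<theta> s *\<^sub>R u y s)"
    using u by (intro weight) (simp add: C22_on_def)
  have c1: "continuous_on (\<Omega> \<times> {a..b}) (\<lambda>(y, s). \<theta> s *\<^sub>R pd j (\<lambda>y. u y s) y)" for j
    using u by (intro weight) (simp add: C22_on_def)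
  have c2: "continuous_on (\<Omega> \<times> {a..b}) (\<lambda>(y, s). \<theta> s *\<^sub>R pd k (pd j (\<lambda>y. u y s)) y)" for j k
    using u by (intro weight) (simp add: C22_on_def)
  define U1 where "U1 j y = integral {a..b} (\<lambda>s. \<theta> s *\<^sub>R pd j (\<lambda>y. u y s) y)" for j y
  define U2 where "U2 k j y = integral {a..b} (\<lambda>s. \<theta> s *\<^sub>R pd k (pd j (\<lambda>y. u y s)) y)" for k j y
  have d1: "has_dirderiv U x (axis j 1) (U1 j x)" if "x \<in> \<Omega>" for x j
    unfolding U_def U1_def
    by (rule parametric_integral_has_dirderiv[OF assms(1) that _ c0 c1])
      (rule wder[OF C2_on_has_dirderiv(1)[OF C22_on_slice[OF u pos]]])
  then have p1: "pd j U x = U1 j x" if "x \<in> \<Omega>" for x j using has_dirderiv_imp_pdiff(2) that by blast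
  have d2: "has_dirderiv (U1 j) x (axis k 1) (U2 k j x)" if "x \<in> \<Omega>" for x j k
    unfolding U1_def[abs_def] U2_def
    by (rule parametric_integral_has_dirderiv[OF assms(1) that _ c1 c2])
      (rule wder[OF C2_on_has_dirderiv(2)[OF C22_on_slice[OF u pos]]])
  have d2': "has_dirderiv (pd j U) x (axis k 1) (U2 k j x)" if "x \<in> \<Omega>" for x j k
    by (rule has_dirderiv_cong_open[OF d2[OF that] assms(1) that]) (simp add: p1)
  then have p2: "pd k (pd j U) x = U2 k j x" if "x \<in> \<Omega>" for x j k using has_dirderiv_imp_pdiff(2) that by blast
  show "C2_on \<Omega> U"
    unfolding C2_on_def
  proof (intro conjI allI ballI)
    show "continuous_on \<Omega> U" unfolding U_def by (rule parametric_integral_continuous[OF c0])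
    show "pdiff j U x" if "x \<in> \<Omega>" for j x using has_dirderiv_imp_pdiff(1)[OF d1[OF that]] .
    show "continuous_on \<Omega> (pd j U)" for j
      using parametric_integral_continuous[OF c1] p1 by (simp add: U1_def cong: continuous_on_cong)
    show "pdiff k (pd j U) x" if "x \<in> \<Omega>" for j k x using has_dirderiv_imp_pdiff(1)[OF d2'[OF that]] .
    show "continuous_on \<Omega> (pd k (pd j U))" for j k
      using parametric_integral_continuous[OF c2] p2 by (simp add: U2_def cong: continuous_on_cong)
  qed
  show "pd j U x = integral {a..b} (\<lambda>s. \<theta> s *\<^sub>R pd j (\<lambda>y. u y s) x)" if "x \<in> \<Omega>" for x j
    using p1[OF that] by (simp add: U1_def)
  show "laplacian U x = integral {a..b} (\<lambda>s. \<theta> s *\<^sub>R laplacian (\<lambda>y. u y s) x)" if "x \<in> \<Omega>" for x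
  proof -
    have "(\<lambda>s. \<theta> s *\<^sub>R pd j (pd j (\<lambda>y. u y s)) x) integrable_on {a..b}" for j
      using integrable_continuous_real[OF continuous_on_slices(1)[OF c2 that]] .
    then show ?thesis
      unfolding laplacian_def scaleR_sum_right using that
      by (subst Henstock_Kurzweil_Integration.integral_sum) (auto simp: p2 U2_def)
  qed
qed

lemma C22_on_td:
  assumes "C22_on \<Omega> u" "x \<in> \<Omega>" "t > 0"
  shows "(u x has_vector_derivative td u x t) (at t)"
    "(td u x has_vector_derivative td (td u) x t) (at t)"
proof -
  have "u x differentiable (at t)" "td u x differentiable (at t)"
    using assms(1)[unfolded C22_on_def, THEN conjunct2, THEN conjunct2] assms(2,3) by simp_all
  then show "(u x has_vector_derivative td u x t) (at t)"
    "(td u x has_vector_derivative td (td u) x t) (at t)"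
    by (simp_all add: vector_derivative_works td_def)
qed

text \<open>
  By the wave equation these are the fundamental theorem of calculus for $\partial_t u$ and Taylor's formula for
  $u$ with integral remainder. The second one exhibits $\partial_t u(\cdot, a)$, which is only known to be continuous
  in space, up to the factor $b - a$ as a $C^2$ function minus the Laplacian of another one.
\<close>

lemma wave_laplacian_integral:
  fixes u :: "real^3 \<Rightarrow> real \<Rightarrow> 'b::euclidean_space"
  assumes "open \<Omega>" and u: "C22_on \<Omega> u" and x: "x \<in> \<Omega>" and "0 < a" "a \<le> b"
    and wave: "\<And>x t. x \<in> \<Omega> \<Longrightarrow> t > 0 \<Longrightarrow> laplacian (\<lambda>y. u y t) x = td (td u) x t"
  shows "laplacian (\<lambda>y. integral {a..b} (\<lambda>s. u y s)) x = td u x b - td u x a"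
    and "laplacian (\<lambda>y. integral {a..b} (\<lambda>s. (b - s) *\<^sub>R u y s)) x = u x b - u x a - (b - a) *\<^sub>R td u x a"
proof -
  have pos: "s > 0" if "s \<in> {a..b}" for s using that \<open>0 < a\<close> by auto
  have "laplacian (\<lambda>y. integral {a..b} (\<lambda>s. u y s)) x = integral {a..b} (\<lambda>s. laplacian (\<lambda>y. u y s) x)"
    using C2_on_parametric_integral(3)[OF assms(1) u \<open>0 < a\<close> _ x, of b "\<lambda>_. 1"] by simp
  also have "\<dots> = integral {a..b} (td (td u) x)"
    by (rule Henstock_Kurzweil_Integration.integral_cong) (use wave x pos in auto)
  also have "(td (td u) x has_integral td u x b - td u x a) {a..b}"
    by (rule fundamental_theorem_of_calculus[OF \<open>a \<le> b\<close>])
      (use C22_on_td(2)[OF u x] pos in \<open>auto intro: has_vector_derivative_at_within\<close>)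
  then have "integral {a..b} (td (td u) x) = td u x b - td u x a" by (rule integral_unique)
  finally show "laplacian (\<lambda>y. integral {a..b} (\<lambda>s. u y s)) x = td u x b - td u x a" .
  have "laplacian (\<lambda>y. integral {a..b} (\<lambda>s. (b - s) *\<^sub>R u y s)) x = integral {a..b} (\<lambda>s. (b - s) *\<^sub>R laplacian (\<lambda>y. u y s) x)"
    by (rule C2_on_parametric_integral(3)[OF assms(1) u \<open>0 < a\<close> _ x]) (intro continuous_intros)
  also have "\<dots> = integral {a..b} (\<lambda>s. (b - s) *\<^sub>R td (td u) x s)"
    by (rule Henstock_Kurzweil_Integration.integral_cong) (use wave x pos in auto)
  also have "((\<lambda>s. (b - s) *\<^sub>R td (td u) x s) has_integral
      (((b - b) *\<^sub>R td u x b + u x b) - ((b - a) *\<^sub>R td u x a + u x a))) {a..b}"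
  proof (rule fundamental_theorem_of_calculus[OF \<open>a \<le> b\<close>])
    fix s assume s: "s \<in> {a..b}"
    have "((\<lambda>s. (b - s) *\<^sub>R td u x s + u x s) has_vector_derivative
       ((b - s) *\<^sub>R td (td u) x s + (- 1) *\<^sub>R td u x s) + td u x s) (at s)"
      by (intro has_vector_derivative_add has_vector_derivative_scaleR C22_on_td[OF u x pos[OF s]])
        (auto intro!: derivative_eq_intros)
    then show "((\<lambda>s. (b - s) *\<^sub>R td u x s + u x s) has_vector_derivative (b - s) *\<^sub>R td (td u) x s) (at s within {a..b})"
      by (simp add: has_vector_derivative_at_within)
  qed
  then have "integral {a..b} (\<lambda>s. (b - s) *\<^sub>R td (td u) x s)
      = ((b - b) *\<^sub>R td u x b + u x b) - ((b - a) *\<^sub>R td u x a + u x a)" by (rule integral_unique)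
  finally show "laplacian (\<lambda>y. integral {a..b} (\<lambda>s. (b - s) *\<^sub>R u y s)) x = u x b - u x a - (b - a) *\<^sub>R td u x a"
    by simp
qed

lemma integral_lower_limit:
  fixes f :: "real \<Rightarrow> 'b::banach"
  assumes "f integrable_on {0..t}" "\<epsilon> \<longlonglongrightarrow> 0" "\<And>n::nat. 0 < \<epsilon> n" "\<And>n. \<epsilon> n < t"
  shows "(\<lambda>n. integral {\<epsilon> n..t} f) \<longlonglongrightarrow> integral {0..t} f"
proof -
  have t: "0 \<le> t" using assms(3,4)[of 0] by simp
  show ?thesis
    by (rule continuous_on_tendsto_compose[OF indefinite_integral_continuous_1'[OF assms(1)] assms(2)])
      (use assms(3,4) t in \<open>auto intro!: always_eventually simp: less_imp_le\<close>)
qed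

text \<open>
  The continuous extension of $\partial_t u$ bounds it on compact sets down to time 0, and integrating from time
  $t$ backwards bounds $u$ as well.
\<close>

lemma bounded_near_initial_time:
  fixes u :: "real^3 \<Rightarrow> real \<Rightarrow> 'b::euclidean_space"
  assumes u: "C22_on \<Omega> u" and "compact K" "K \<subseteq> \<Omega>" "0 < t"
    and gc: "continuous_on (\<Omega> \<times> {0..}) g" and g: "\<And>x t. x \<in> \<Omega> \<Longrightarrow> t > 0 \<Longrightarrow> g (x, t) = td u x t"
  obtains B where "B \<ge> 0" "\<And>y s. y \<in> K \<Longrightarrow> 0 \<le> s \<Longrightarrow> s \<le> t \<Longrightarrow> norm (g (y, s)) \<le> B"
    "\<And>y s. y \<in> K \<Longrightarrow> 0 < s \<Longrightarrow> s \<le> t \<Longrightarrow> norm (u y s) \<le> B"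
proof -
  have "continuous_on (K \<times> {0..t}) g" by (rule continuous_on_subset[OF gc]) (use assms in auto)
  then obtain A where A: "A \<ge> 0" "\<And>p. p \<in> K \<times> {0..t} \<Longrightarrow> norm (g p) \<le> A"
    using continuous_on_compact_norm_bound[of "K \<times> {0..t}" g] compact_Times[OF assms(2) compact_Icc] by blast
  have "continuous_on K (\<lambda>y. u y t)"
    using C22_on_slice[OF u \<open>0 < t\<close>] assms(3) continuous_on_subset unfolding C2_on_def by blast
  then obtain A1 where A1: "A1 \<ge> 0" "\<And>y. y \<in> K \<Longrightarrow> norm (u y t) \<le> A1"
    using continuous_on_compact_norm_bound[of K "\<lambda>y. u y t"] assms(2) by blast
  show ?thesis
  proof (rule that[of "A + A1 + A * t"])
    show "A + A1 + A * t \<ge> 0" using A A1 \<open>0 < t\<close> by simp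
    show "norm (g (y, s)) \<le> A + A1 + A * t" if "y \<in> K" "0 \<le> s" "s \<le> t" for y s
      using A(2)[of "(y, s)"] A(1) A1(1) that \<open>0 < t\<close> by (smt (verit) SigmaI atLeastAtMost_iff mult_nonneg_nonneg)
    show "norm (u y s) \<le> A + A1 + A * t" if y: "y \<in> K" and s: "0 < s" "s \<le> t" for y s
    proof -
      have "norm (u y t - u y s) \<le> A * norm (t - s)"
      proof (rule differentiable_bound[where S = "{s..t}"])
        fix q assume q: "q \<in> {s..t}"
        then have q0: "q > 0" using s by simp
        have yO: "y \<in> \<Omega>" using y assms(3) by auto
        show "(u y has_derivative (\<lambda>h. h *\<^sub>R td u y q)) (at q within {s..t})"
          using C22_on_td(1)[OF u yO q0] by (simp add: has_vector_derivative_def has_derivative_at_withinI)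
        have "norm (td u y q) \<le> A" using A(2)[of "(y, q)"] g[OF yO q0] y q q0 by auto
        then have "norm (h *\<^sub>R td u y q) \<le> A * norm h" for h
          using mult_right_mono[of "norm (td u y q)" A "\<bar>h\<bar>"] by (simp add: mult.commute)
        then show "onorm (\<lambda>h. h *\<^sub>R td u y q) \<le> A" by (rule onorm_le)
      qed (use s in auto)
      also have "\<dots> \<le> A * t" using A(1) s by (intro mult_left_mono) auto
      finally show ?thesis using A1(2)[OF y] A(1) norm_triangle_ineq2[of "u y s" "u y t"]
        by (simp add: norm_minus_commute)
    qed
  qed
qed

text \<open>
  Integration by parts in time trades $u$ for $s\, \partial_t u$, whose extension to time 0 is given; so the limit
  is visibly continuous in space.
\<close>

lemma time_integral_initial_limit:
  fixes u :: "real^3 \<Rightarrow> real \<Rightarrow> 'b::euclidean_space"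
  assumes u: "C22_on \<Omega> u" and "0 < t"
    and gc: "continuous_on (\<Omega> \<times> {0..}) g" and g: "\<And>x t. x \<in> \<Omega> \<Longrightarrow> t > 0 \<Longrightarrow> g (x, t) = td u x t"
    and \<epsilon>: "\<epsilon> \<longlonglongrightarrow> 0" "\<And>n::nat. 0 < \<epsilon> n" "\<And>n. \<epsilon> n < t"
  defines "U0 \<equiv> \<lambda>y. t *\<^sub>R u y t - integral {0..t} (\<lambda>s. s *\<^sub>R g (y, s))"
  shows "continuous_on \<Omega> U0"
    and "y \<in> \<Omega> \<Longrightarrow> (\<lambda>n. integral {\<epsilon> n..t} (u y)) \<longlonglongrightarrow> U0 y"
proof -
  have c: "continuous_on (\<Omega> \<times> {0..t}) (\<lambda>(y, s). s *\<^sub>R g (y, s))"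
  proof -
    have "continuous_on (\<Omega> \<times> {0..t}) g" by (rule continuous_on_subset[OF gc]) auto
    then have "continuous_on (\<Omega> \<times> {0..t}) (\<lambda>p. snd p *\<^sub>R g p)"
      by (intro continuous_on_scaleR continuous_on_snd continuous_on_id)
    then show ?thesis by (simp add: case_prod_beta)
  qed
  have "continuous_on \<Omega> (\<lambda>y. u y t)" 
    using has_C1_partialsD(1)[OF C2_on_C1_partials(1)[OF C22_on_slice[OF u \<open>0 < t\<close>]]] .
  then show "continuous_on \<Omega> U0"
    unfolding U0_def using parametric_integral_continuous[OF c] by (intro continuous_intros)
  assume y: "y \<in> \<Omega>"
  have ibp: "integral {\<epsilon> n..t} (u y) = t *\<^sub>R u y t - \<epsilon> n *\<^sub>R u y (\<epsilon> n) - integral {\<epsilon> n..t} (\<lambda>s. s *\<^sub>R g (y, s))" for n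
  proof -
    have "((\<lambda>s. u y s + s *\<^sub>R td u y s) has_integral t *\<^sub>R u y t - \<epsilon> n *\<^sub>R u y (\<epsilon> n)) {\<epsilon> n..t}"
    proof (rule fundamental_theorem_of_calculus)
      fix s assume s: "s \<in> {\<epsilon> n..t}"
      then have "s > 0" using \<epsilon>(2)[of n] by auto
      then have "((\<lambda>s. s *\<^sub>R u y s) has_vector_derivative (s *\<^sub>R td u y s + 1 *\<^sub>R u y s)) (at s)"
        by (intro has_vector_derivative_scaleR C22_on_td(1)[OF u y]) (auto intro!: derivative_eq_intros)
      then show "((\<lambda>s. s *\<^sub>R u y s) has_vector_derivative u y s + s *\<^sub>R td u y s) (at s within {\<epsilon> n..t})"
        by (simp add: add.commute has_vector_derivative_at_within)
    qed (use \<epsilon>(3)[of n] in simp)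
    moreover have "((\<lambda>s. s *\<^sub>R td u y s) has_integral integral {\<epsilon> n..t} (\<lambda>s. s *\<^sub>R g (y, s))) {\<epsilon> n..t}"
    proof (rule has_integral_eq[of _ "\<lambda>s. s *\<^sub>R g (y, s)"])
      have "continuous_on {\<epsilon> n..t} (\<lambda>s. s *\<^sub>R g (y, s))"
        by (rule continuous_on_subset[OF continuous_on_slices(1)[OF c y]]) (use \<epsilon>(2)[of n] in auto)
      then show "((\<lambda>s. s *\<^sub>R g (y, s)) has_integral integral {\<epsilon> n..t} (\<lambda>s. s *\<^sub>R g (y, s))) {\<epsilon> n..t}"
        by (intro integrable_integral integrable_continuous_real)
    qed (use g[OF y] \<epsilon>(2)[of n] in auto)
    ultimately have "((\<lambda>s. (u y s + s *\<^sub>R td u y s) - s *\<^sub>R td u y s) has_integral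
        (t *\<^sub>R u y t - \<epsilon> n *\<^sub>R u y (\<epsilon> n)) - integral {\<epsilon> n..t} (\<lambda>s. s *\<^sub>R g (y, s))) {\<epsilon> n..t}"
      by (rule has_integral_diff)
    then show ?thesis by (simp add: integral_unique)
  qed
  obtain B where B: "B \<ge> 0" "\<And>s. 0 < s \<Longrightarrow> s \<le> t \<Longrightarrow> norm (u y s) \<le> B"
    by (rule bounded_near_initial_time[OF u _ _ \<open>0 < t\<close> gc g, of "{y}"]) (use y in auto)
  have "(\<lambda>n. \<epsilon> n *\<^sub>R u y (\<epsilon> n)) \<longlonglongrightarrow> 0"
  proof (rule Lim_null_comparison)
    show "\<forall>\<^sub>F n in sequentially. norm (\<epsilon> n *\<^sub>R u y (\<epsilon> n)) \<le> \<epsilon> n * B"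
      using B(2)[OF \<epsilon>(2) less_imp_le[OF \<epsilon>(3)]] \<epsilon>(2)
      by (intro always_eventually allI) (simp add: mult_left_mono less_imp_le)
    show "(\<lambda>n. \<epsilon> n * B) \<longlonglongrightarrow> 0" using tendsto_mult_left_zero[OF \<epsilon>(1)] .
  qed
  moreover have "(\<lambda>n. integral {\<epsilon> n..t} (\<lambda>s. s *\<^sub>R g (y, s))) \<longlonglongrightarrow> integral {0..t} (\<lambda>s. s *\<^sub>R g (y, s))"
    by (rule integral_lower_limit[OF integrable_continuous_real[OF continuous_on_slices(1)[OF c y]] \<epsilon>])
  ultimately have "(\<lambda>n. t *\<^sub>R u y t - \<epsilon> n *\<^sub>R u y (\<epsilon> n) - integral {\<epsilon> n..t} (\<lambda>s. s *\<^sub>R g (y, s)))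
      \<longlonglongrightarrow> t *\<^sub>R u y t - 0 - integral {0..t} (\<lambda>s. s *\<^sub>R g (y, s))"
    by (intro tendsto_diff tendsto_const)
  then show "(\<lambda>n. integral {\<epsilon> n..t} (u y)) \<longlonglongrightarrow> U0 y" by (simp add: ibp U0_def)
qed

section \<open>Potentials with partial derivatives\<close>

lemma corr_shift_indicator:
  fixes f :: "'a::euclidean_space \<Rightarrow> 'b::euclidean_space"
  assumes [measurable]: "a \<in> borel_measurable borel" "(\<lambda>y. indicator S y *\<^sub>R f y) \<in> borel_measurable borel"
    and supp: "\<And>z. norm z > r \<Longrightarrow> a z = 0" and sub: "cball x r \<subseteq> S"
  shows "(a \<star> f) x = (\<integral>y. a (y - x) *\<^sub>R (indicator S y *\<^sub>R f y) \<partial>lborel)"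
proof -
  have "(\<integral>z. a ((x + z) - x) *\<^sub>R (indicator S (x + z) *\<^sub>R f (x + z)) \<partial>lborel)
      = (\<integral>y. a (y - x) *\<^sub>R (indicator S y *\<^sub>R f y) \<partial>lborel)"
    by (rule integral_shift[of "\<lambda>y. a (y - x) *\<^sub>R (indicator S y *\<^sub>R f y)" x]) measurable
  moreover have "a ((x + z) - x) *\<^sub>R (indicator S (x + z) *\<^sub>R f (x + z)) = a z *\<^sub>R f (x + z)" for z
  proof (cases "norm z > r")
    case False
    then have "x + z \<in> S" using sub by (auto simp: dist_norm)
    then show ?thesis by simp
  qed (use supp in simp)
  ultimately show ?thesis by (simp only: corr_def)
qed

lemma corr_smooth_has_dirderiv:
  fixes f :: "'a::euclidean_space \<Rightarrow> 'b::euclidean_space"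
  assumes "0 < r" "r < R" and f: "continuous_on (cball x R) f"
    and supp: "\<And>z. norm z \<ge> r \<Longrightarrow> a z = 0" and supp': "\<And>z. norm z \<ge> r \<Longrightarrow> a' z = 0"
    and der: "\<And>z. has_dirderiv a z e (a' z)"
    and ca: "continuous_on UNIV a" and ca': "continuous_on UNIV a'"
  shows "has_dirderiv (a \<star> f) x e (- (a' \<star> f) x)"
proof -
  define W where "W y = indicator (cball x R) y *\<^sub>R f y" for y
  have Wm: "W \<in> borel_measurable borel"
    unfolding W_def[abs_def] by (rule borel_measurable_continuous_on_indicator) (use f in auto)
  obtain C where C: "C \<ge> 0" "\<And>z. z \<in> cball x R \<Longrightarrow> norm (f z) \<le> C"
    using continuous_on_compact_norm_bound[OF f compact_cball] by blast
  have Wi: "integrable lborel W"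
    by (rule integrableI_bounded_set[where A = "cball x R" and B = C])
      (use Wm C emeasure_bounded_finite[OF bounded_cball, of x R] in \<open>auto simp: W_def\<close>)
  have W0: "W y = 0" if "norm y > norm x + R" for y
    using that norm_triangle_ineq2[of y x] by (auto simp: W_def indicator_def dist_norm norm_minus_commute)
  have m: "a \<in> borel_measurable borel" "a' \<in> borel_measurable borel"
    using ca ca' by (auto intro: borel_measurable_continuous_onI)
  have eq: "(b \<star> f) y = (\<integral>z. b (z - y) *\<^sub>R W z \<partial>lborel)"
    if "y \<in> ball x (R - r)" "b \<in> borel_measurable borel" "\<And>z. norm z \<ge> r \<Longrightarrow> b z = 0" for b y
    unfolding W_def
  proof (rule corr_shift_indicator[where r = r, OF that(2) Wm[unfolded W_def[abs_def]]])
    show "cball y r \<subseteq> cball x R"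
      using that(1) by (auto simp: dist_norm intro: norm_triangle_le_diff)
        (smt (verit) dist_norm dist_triangle2 dist_commute)
  qed (use that(3) in auto)
  have x: "x \<in> ball x (R - r)" using assms by simp
  have "has_dirderiv (\<lambda>y. \<integral>z. a (z - y) *\<^sub>R W z \<partial>lborel) x e (- (\<integral>z. a' (z - x) *\<^sub>R W z \<partial>lborel))"
    by (rule smooth_kernel_has_dirderiv[OF Wi W0 der ca ca'])
  then have "has_dirderiv (a \<star> f) x e (- (\<integral>z. a' (z - x) *\<^sub>R W z \<partial>lborel))"
    by (rule has_dirderiv_cong_open[OF _ open_ball x]) (use eq m supp in simp)
  then show ?thesis using eq[OF x m(2) supp'] by simp
qed

lemma corr_tendsto:
  fixes f :: "'a::euclidean_space \<Rightarrow> 'b::euclidean_space"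
  assumes a: "integrable lborel a" and supp: "\<And>z. norm z > r \<Longrightarrow> a z = 0"
    and c: "\<And>n. continuous_on (cball x r) (f' n)" "continuous_on (cball x r) f"
    and B: "\<And>n y. y \<in> cball x r \<Longrightarrow> norm (f' n y) \<le> B"
    and lim: "\<And>y. y \<in> cball x r \<Longrightarrow> (\<lambda>n. f' n y) \<longlonglongrightarrow> f y"
  shows "(\<lambda>n::nat. (a \<star> f' n) x) \<longlonglongrightarrow> (a \<star> f) x"
  unfolding corr_def
proof (rule integral_dominated_convergence[where w = "\<lambda>z. \<bar>a z\<bar> * B"])
  have m: "a \<in> borel_measurable borel" using a by auto
  show "(\<lambda>z. a z *\<^sub>R f (x + z)) \<in> borel_measurable lborel"
    using shift_mult_measurable[OF m supp c(2)] by simp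
  show "(\<lambda>z. a z *\<^sub>R f' n (x + z)) \<in> borel_measurable lborel" for n
    using shift_mult_measurable[OF m supp c(1)] by simp
  show "integrable lborel (\<lambda>z. \<bar>a z\<bar> * B)" using a by simp
  show "AE z in lborel. (\<lambda>n. a z *\<^sub>R f' n (x + z)) \<longlonglongrightarrow> a z *\<^sub>R f (x + z)"
  proof (intro AE_I2)
    fix z show "(\<lambda>n. a z *\<^sub>R f' n (x + z)) \<longlonglongrightarrow> a z *\<^sub>R f (x + z)"
    proof (cases "norm z > r")
      case False
      then show ?thesis by (intro tendsto_scaleR tendsto_const lim) (simp add: dist_norm)
    qed (use supp in simp)
  qed
  show "AE z in lborel. norm (a z *\<^sub>R f' n (x + z)) \<le> \<bar>a z\<bar> * B" for n
  proof (intro AE_I2)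
    fix z show "norm (a z *\<^sub>R f' n (x + z)) \<le> \<bar>a z\<bar> * B"
    proof (cases "norm z > r")
      case False
      then show ?thesis unfolding norm_scaleR by (intro mult_left_mono B) (simp_all add: dist_norm)
    qed (use supp in simp)
  qed
qed

lemma corr_cong:
  assumes "\<And>z. norm z > r \<Longrightarrow> a z = 0" "\<And>y. y \<in> cball x r \<Longrightarrow> f y = g y"
  shows "(a \<star> f) x = (a \<star> g) x"
proof -
  have "a z *\<^sub>R f (x + z) = a z *\<^sub>R g (x + z)" for z
    using assms(1)[of z] assms(2)[of "x + z"] by (cases "norm z > r") (auto simp: dist_norm)
  then show ?thesis by (simp only: corr_def)
qed

lemma corr_diff:
  fixes f :: "'a::euclidean_space \<Rightarrow> 'b::euclidean_space"
  assumes "integrable lborel a" "\<And>z. norm z > r \<Longrightarrow> a z = 0"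
    and "continuous_on (cball x r) f" "continuous_on (cball x r) g"
  shows "(a \<star> (\<lambda>y. f y - g y)) x = (a \<star> f) x - (a \<star> g) x"
  unfolding corr_def scaleR_diff_right
  by (rule Bochner_Integration.integral_diff[OF integrable_shift_mult[OF assms(1,2,3)]
        integrable_shift_mult[OF assms(1,2,4)]])

lemma corr_sum:
  fixes f :: "'i \<Rightarrow> 'a::euclidean_space \<Rightarrow> 'b::euclidean_space"
  assumes "integrable lborel a" "\<And>z. norm z > r \<Longrightarrow> a z = 0"
    and "\<And>i. i \<in> I \<Longrightarrow> continuous_on (cball x r) (f i)"
  shows "(a \<star> (\<lambda>y. \<Sum>i\<in>I. f i y)) x = (\<Sum>i\<in>I. (a \<star> f i) x)"
  unfolding corr_def scaleR_sum_right
  by (rule Bochner_Integration.integral_sum) (rule integrable_shift_mult[OF assms(1,2) assms(3)])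

lemma bump_laplacian:
  fixes G :: "real^3 \<Rightarrow> 'b::euclidean_space"
  assumes "0 < r" "r < R" and G: "C2_on (ball x R) G"
  shows "(bump r \<star> laplacian G) x = - (\<Sum>j\<in>UNIV. (bump' r j \<star> pd j G) x)"
    and "(bump r \<star> laplacian G) x = (\<Sum>j\<in>UNIV. (bump'' r j j \<star> G) x)"
proof -
  have sub: "cball x r \<subseteq> ball x R" using assms by auto
  have "(bump r \<star> laplacian G) x = (\<Sum>j\<in>UNIV. (bump r \<star> pd j (pd j G)) x)"
    unfolding laplacian_def
    by (rule corr_sum[where r = r, OF integrable_bump(1)[OF assms(1)] bump_support(1)[OF assms(1) less_imp_le]])
      (use continuous_on_subset[OF has_C1_partialsD(2)[OF C2_on_C1_partials(2)[OF G]] sub] in auto)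
  also have "\<dots> = - (\<Sum>j\<in>UNIV. (bump' r j \<star> pd j G) x)"
    by (simp add: corr_bump_by_parts(1)[OF assms(1,2) C2_on_C1_partials(2)[OF G]] sum_negf)
  finally show 1: "(bump r \<star> laplacian G) x = - (\<Sum>j\<in>UNIV. (bump' r j \<star> pd j G) x)" .
  then show "(bump r \<star> laplacian G) x = (\<Sum>j\<in>UNIV. (bump'' r j j \<star> G) x)"
    by (simp add: corr_bump_by_parts(2)[OF assms(1,2) C2_on_C1_partials(1)[OF G]] sum_negf)
qed

lemma C2_on_diff:
  fixes f g :: "real^3 \<Rightarrow> 'b::real_normed_vector"
  assumes "open S" and f: "C2_on S f" and g: "C2_on S g"
  shows "C2_on S (\<lambda>y. f y - g y)"
proof -
  have d1: "has_dirderiv (\<lambda>y. f y - g y) x (axis j 1) (pd j f x - pd j g x)" if "x \<in> S" for x j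
    by (intro has_dirderiv_diff C2_on_has_dirderiv(1)[OF f that] C2_on_has_dirderiv(1)[OF g that])
  note p1 = has_dirderiv_imp_pdiff(2)[OF d1]
  have d2: "has_dirderiv (pd j (\<lambda>y. f y - g y)) x (axis k 1) (pd k (pd j f) x - pd k (pd j g) x)"
    if "x \<in> S" for x j k
  proof (rule has_dirderiv_cong_open[OF _ assms(1) that])
    show "has_dirderiv (\<lambda>y. pd j f y - pd j g y) x (axis k 1) (pd k (pd j f) x - pd k (pd j g) x)"
      by (intro has_dirderiv_diff C2_on_has_dirderiv(2)[OF f that] C2_on_has_dirderiv(2)[OF g that])
  qed (simp add: p1)
  note p2 = has_dirderiv_imp_pdiff(2)[OF d2]
  note c = C2_on_C1_partials[OF f, THEN has_C1_partialsD(1)] C2_on_C1_partials[OF g, THEN has_C1_partialsD(1)]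
  note c2 = has_C1_partialsD(2)[OF C2_on_C1_partials(2)[OF f]] has_C1_partialsD(2)[OF C2_on_C1_partials(2)[OF g]]
  show ?thesis
    unfolding C2_on_def
  proof (intro conjI allI ballI)
    show "continuous_on S (\<lambda>y. f y - g y)" by (intro continuous_on_diff c)
    show "pdiff j (\<lambda>y. f y - g y) x" if "x \<in> S" for j x using has_dirderiv_imp_pdiff(1)[OF d1[OF that]] .
    show "continuous_on S (pd j (\<lambda>y. f y - g y))" for j
      by (subst continuous_on_cong[OF refl p1]) (auto intro: continuous_on_diff c)
    show "pdiff k (pd j (\<lambda>y. f y - g y)) x" if "x \<in> S" for j k x
      using has_dirderiv_imp_pdiff(1)[OF d2[OF that]] .
    show "continuous_on S (pd k (pd j (\<lambda>y. f y - g y)))" for j k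
      by (subst continuous_on_cong[OF refl p2]) (auto intro: continuous_on_diff c2)
  qed
qed

lemma C2_on_subset:
  "C2_on S f \<Longrightarrow> T \<subseteq> S \<Longrightarrow> C2_on T f"
proof -
  assume f: "C2_on S f" and T: "T \<subseteq> S"
  have c: "continuous_on T g" if "continuous_on S g" for g :: "real^3 \<Rightarrow> 'a"
    using that T by (rule continuous_on_subset)
  show ?thesis
    unfolding C2_on_def
    by (intro conjI allI ballI c; use f T in \<open>unfold C2_on_def, blast\<close>)
qed

lemma C2_on_continuous_laplacian: "C2_on S f \<Longrightarrow> continuous_on S (laplacian f)"
  unfolding laplacian_def[abs_def]
  by (intro continuous_on_sum has_C1_partialsD(2)[OF C2_on_C1_partials(2)])

text \<open>
  For $a$ merely continuous, $p_j \star a$ need not have partial derivatives. It has them for $a = g - \Delta G$,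
  because \<open>parametrix_representation\<close> turns $p_j \star \Delta G$ into $\partial_j G + \partial_j \rho \star G$ with the bump $\rho$. The matrix
  $Y$ is the Jacobian matrix of the field $p \star a$.
\<close>

lemma parametrix_potential_partials:
  fixes a :: "real^3 \<Rightarrow> 'b::euclidean_space"
  assumes "0 < r" "r < R" and g: "C2_on (ball x R) g" and G: "C2_on (ball x R) G"
    and a: "\<And>y. y \<in> ball x R \<Longrightarrow> a y = g y - laplacian G y"
  obtains Y where "\<And>j k. has_dirderiv (parametrix r j \<star> a) x (axis k 1) (Y j k)"
    "\<And>j k. Y j k = Y k j" "(\<Sum>j\<in>UNIV. Y j j) = a x - (bump r \<star> a) x"
proof -
  note ip = integrable_parametrix[OF assms(1)] and sp = parametrix_support(1)[OF assms(1) less_imp_le]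
  note ib = integrable_bump[OF assms(1)] and sb = bump_support[OF assms(1) less_imp_le]
  have Rx: "x \<in> ball x (R - r)" "x \<in> ball x R" using assms by auto
  have split: "(b \<star> a) y = (b \<star> g) y - (b \<star> laplacian G) y"
    if y: "y \<in> ball x (R - r)" and b: "integrable lborel b" "\<And>z. norm z > r \<Longrightarrow> b z = 0" for y and b :: "real^3 \<Rightarrow> real"
  proof -
    have sub: "cball y r \<subseteq> ball x R"
    proof
      fix z assume "z \<in> cball y r"
      then show "z \<in> ball x R" using y dist_triangle[of x z y] by simp
    qed
    have "(b \<star> a) y = (b \<star> (\<lambda>y. g y - laplacian G y)) y"
      by (rule corr_cong[where r = r, OF b(2)]) (use a sub in auto)
    also have "\<dots> = (b \<star> g) y - (b \<star> laplacian G) y"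
      by (rule corr_diff[OF b]) 
        (use g C2_on_continuous_laplacian[OF G] continuous_on_subset[OF _ sub] in \<open>auto simp: C2_on_def\<close>)
    finally show ?thesis .
  qed
  have rep: "(parametrix r j \<star> a) y = (parametrix r j \<star> g) y - (pd j G y + (bump' r j \<star> G) y)"
    if y: "y \<in> ball x (R - r)" for y j
  proof -
    have sub: "ball y (R - dist x y) \<subseteq> ball x R"
    proof
      fix z assume "z \<in> ball y (R - dist x y)"
      then show "z \<in> ball x R" using dist_triangle[of x z y] by simp
    qed
    have "pd j G y = (parametrix r j \<star> laplacian G) y - (bump' r j \<star> G) y"
      by (rule parametrix_representation[OF assms(1) _ C2_on_subset[OF G sub]]) (use y in simp)
    then show ?thesis using split[OF y ip sp] by simp
  qed
  define Y where "Y j k = (parametrix r j \<star> pd k g) x - (pd k (pd j G) x + (bump' r j \<star> pd k G) x)" for j k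
  show ?thesis
  proof (rule that[of Y])
    note g1 = C2_on_C1_partials(1)[OF g] and G1 = C2_on_C1_partials(1)[OF G]
    fix j k
    have "has_dirderiv (\<lambda>y. (parametrix r j \<star> g) y - (pd j G y + (bump' r j \<star> G) y)) x (axis k 1) (Y j k)"
      unfolding Y_def
    proof (intro has_dirderiv_diff has_dirderiv_add)
      show "has_dirderiv (parametrix r j \<star> g) x (axis k 1) ((parametrix r j \<star> pd k g) x)"
        by (rule corr_has_dirderiv[OF assms(1,2) ip sp has_C1_partialsD(3)[OF g1] has_C1_partialsD(1)[OF g1] has_C1_partialsD(2)[OF g1]])
      show "has_dirderiv (pd j G) x (axis k 1) (pd k (pd j G) x)"
        using C2_on_has_dirderiv(2)[OF G Rx(2)] .
      show "has_dirderiv (bump' r j \<star> G) x (axis k 1) ((bump' r j \<star> pd k G) x)"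
        by (rule corr_has_dirderiv[OF assms(1,2) ib(2) sb(2) has_C1_partialsD(3)[OF G1] has_C1_partialsD(1)[OF G1] has_C1_partialsD(2)[OF G1]])
    qed
    then show "has_dirderiv (parametrix r j \<star> a) x (axis k 1) (Y j k)"
      by (rule has_dirderiv_cong_open[OF _ open_ball Rx(1)]) (simp add: rep)
    have "(bump' r j \<star> pd k G) x = (bump' r k \<star> pd j G) x"
      using bump''_sym by (metis corr_bump_by_parts(2)[OF assms(1,2) G1] ext)
    then show "Y j k = Y k j"
      unfolding Y_def
      using parametrix_symmetric[OF assms(1,2) g1, of j k] C2_on_commute[OF G open_ball Rx(2), of j k] by simp
  next
    have "(\<Sum>j\<in>UNIV. Y j j) = (\<Sum>j\<in>UNIV. (parametrix r j \<star> pd j g) x)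
        - (laplacian G x + (\<Sum>j\<in>UNIV. (bump' r j \<star> pd j G) x))"
      by (simp add: Y_def sum_subtractf sum.distrib laplacian_def)
    also have "\<dots> = (g x - (bump r \<star> g) x) - (laplacian G x - (bump r \<star> laplacian G) x)"
      using parametrix_div[OF assms(1,2) C2_on_C1_partials(1)[OF g]] bump_laplacian(1)[OF assms(1,2) G] by simp
    also have "\<dots> = a x - (bump r \<star> a) x"
      using split[OF Rx(1) ib(1) sb(1)] a[OF Rx(2)] by simp
    finally show "(\<Sum>j\<in>UNIV. Y j j) = a x - (bump r \<star> a) x" .
  qed
qed

section \<open>Quaternions and the Teodorescu transform\<close>

definition qunit :: "3 \<Rightarrow> real^4" where "qunit j = vec_quat (axis j 1)"

lemma bounded_linear_qmult_right: "bounded_linear (\<lambda>q::real^4. p \<odot> q)"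
  unfolding linear_conv_bounded_linear[symmetric]
  by (rule linearI) (simp_all add: quat_eq_iff qmult_def algebra_simps)

lemma qunit_simps: "qunit 1 = e1" "qunit 2 = e2" "qunit 3 = e3"
  by (simp_all add: qunit_def vec_quat_def axis_def quat_eq_iff)

lemma dirac_eq_sum: "dirac f x = (\<Sum>j\<in>UNIV. qunit j \<odot> pd j f x)"
  by (simp add: dirac_def sum_3 qunit_simps)

lemma grad_eq_sum: "grad \<phi> x = (\<Sum>j\<in>UNIV. qunit j \<odot> (pd j \<phi> x *\<^sub>R e0))"
  by (simp add: grad_def sum_3 qunit_simps qmult_def quat_eq_iff)

lemma cauchy_kernel_qmult: "cauchy_kernel z \<odot> q = (\<Sum>k\<in>UNIV. qunit k \<odot> (newton_field k z *\<^sub>R q))"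
proof -
  define c where "c = - (1 / (4 * pi * norm z ^ 3))"
  have "newton_field k z = c * z$k" for k by (simp add: newton_field_def c_def)
  then show ?thesis
    unfolding cauchy_kernel_def c_def[symmetric]
    by (simp add: vec_quat_def sum_3 qunit_simps qmult_def quat_eq_iff)
qed

text \<open>
  Euler's four-square identity.
\<close>

lemma norm_qmult: "norm (p \<odot> q) = norm p * norm (q :: real^4)"
proof -
  have n: "norm p ^ 2 = p$0 * p$0 + p$1 * p$1 + p$2 * p$2 + p$3 * p$3" for p :: "real^4"
    unfolding power2_norm_eq_inner inner_vec_def UNIV_4_from_0 by simp
  have "norm (p \<odot> q) ^ 2 = (norm p * norm q) ^ 2"
    unfolding power_mult_distrib n by (simp add: qmult_def) algebra
  then show ?thesis by (simp add: power2_eq_iff_nonneg)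
qed

lemma norm_cauchy_kernel: "norm (cauchy_kernel z) = 1 / (4 * pi * norm z ^ 2)"
proof -
  have "norm (vec_quat y) ^ 2 = norm y ^ 2" for y
    unfolding norm_sq_components power2_norm_eq_inner[of "vec_quat y"] inner_vec_def UNIV_4_from_0
    by (simp add: vec_quat_def)
  then have v: "norm (vec_quat y) = norm y" for y by (simp add: power2_eq_iff_nonneg)
  have "norm (cauchy_kernel z) = \<bar>1 / (4 * pi * norm z ^ 3)\<bar> * norm z"
    by (simp only: cauchy_kernel_def v norm_scaleR abs_minus_cancel)
  also have "\<dots> = 1 / (4 * pi * norm z ^ 2)"
    by (cases "z = 0") (simp_all add: abs_of_nonneg eval_nat_numeral)
  finally show ?thesis .
qed

text \<open>
  In $D \sum_j e_j X_j$ the products $e_k e_j$ with $k \ne j$ anticommute and cancel against the symmetric Jacobian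
  matrix; the squares $e_j^2 = -1$ leave minus the divergence.
\<close>

lemma dirac_of_field:
  fixes X :: "3 \<Rightarrow> real^3 \<Rightarrow> real^4"
  assumes "\<And>j k. has_dirderiv (X j) x (axis k 1) (Y j k)" and sym: "\<And>j k. Y j k = Y k j"
    and S: "open S" "x \<in> S" and f: "\<And>y. y \<in> S \<Longrightarrow> f y = (\<Sum>j\<in>UNIV. qunit j \<odot> X j y)"
  shows "pdiff k f x" and "dirac f x = - (\<Sum>j\<in>UNIV. Y j j)"
proof -
  have d: "has_dirderiv f x (axis k 1) (\<Sum>j\<in>UNIV. qunit j \<odot> Y j k)" for k
    by (rule has_dirderiv_cong_open[where f = "\<lambda>y. \<Sum>j\<in>UNIV. qunit j \<odot> X j y" and S = S])
      (auto intro!: has_dirderiv_sum has_dirderiv_bounded_linear[OF bounded_linear_qmult_right] assms(1) S simp: f)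
  then show "pdiff k f x" by (rule has_dirderiv_imp_pdiff)
  have "dirac f x = (\<Sum>k\<in>UNIV. qunit k \<odot> (\<Sum>j\<in>UNIV. qunit j \<odot> Y j k))"
    unfolding dirac_eq_sum using has_dirderiv_imp_pdiff(2)[OF d] by simp
  also have "\<dots> = - (\<Sum>j\<in>UNIV. Y j j)"
    using sym[of 2 1] sym[of 3 1] sym[of 3 2]
    by (simp add: sum_3 qunit_simps qmult_def quat_eq_iff)
  finally show "dirac f x = - (\<Sum>j\<in>UNIV. Y j j)" .
qed

lemma initial_value_eq:
  assumes gc: "continuous_on (\<Omega> \<times> {0..}) g" and g: "\<And>x t. x \<in> \<Omega> \<Longrightarrow> t > 0 \<Longrightarrow> g (x, t) = f x t"
    and "x \<in> \<Omega>"
  shows "initial_value f x = g (x, 0)"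
proof -
  have "continuous_on {0..} (\<lambda>t. g (x, t))"
    using continuous_on_slices(1)[of \<Omega> "{0..}" "\<lambda>x t. g (x, t)"] gc \<open>x \<in> \<Omega>\<close> by simp
  then have "((\<lambda>t. g (x, t)) \<longlongrightarrow> g (x, 0)) (at 0 within {0..})" by (simp add: continuous_on_def)
  then have "((\<lambda>t. g (x, t)) \<longlongrightarrow> g (x, 0)) (at_right 0)" by (rule tendsto_within_subset) auto
  moreover have "\<forall>\<^sub>F t in at_right 0. g (x, t) = f x t"
    using g[OF \<open>x \<in> \<Omega>\<close>] by (auto simp: eventually_at_filter)
  ultimately have "(f x \<longlongrightarrow> g (x, 0)) (at_right 0)" by (rule Lim_transform_eventually)
  then show ?thesis unfolding initial_value_def by (rule tendsto_Lim[OF trivial_limit_at_right_real])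
qed

text \<open>
  On the bounded set $\Omega$ the Cauchy kernel with pole $x$ is bounded away from 0 off its pole, so the existence of
  the transform at a single point makes the density integrable.
\<close>

lemma teodorescu_density_integrable:
  assumes "open \<Omega>" "bounded \<Omega>" and w: "continuous_on \<Omega> w" and ex: "teodorescu_exists \<Omega> w x"
  shows "integrable lborel (\<lambda>y. indicator \<Omega> y *\<^sub>R w y)"
proof -
  obtain M where M: "\<And>y. y \<in> \<Omega> \<Longrightarrow> norm y \<le> M" using assms(2) by (auto simp: bounded_iff)
  define W where "W y = indicator \<Omega> y *\<^sub>R w y" for y
  have [measurable]: "W \<in> borel_measurable borel"
    unfolding W_def[abs_def] using assms(1) w by (intro borel_measurable_continuous_on_indicator) auto
  have "integrable lebesgue W"
  proof (rule Bochner_Integration.integrable_bound)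
    show "integrable lebesgue (\<lambda>y. (4 * pi * (M + norm x)^2) *\<^sub>R (indicator \<Omega> y *\<^sub>R (cauchy_kernel (y - x) \<odot> w y)))"
      using ex unfolding teodorescu_exists_def set_integrable_def by (intro integrable_scaleR_right) auto
    show "W \<in> borel_measurable lebesgue" by (intro measurable_completion) simp
    have le: "norm (W y) \<le> norm ((4 * pi * (M + norm x)^2) *\<^sub>R (indicator \<Omega> y *\<^sub>R (cauchy_kernel (y - x) \<odot> w y)))"
      if "y \<noteq> x" for y
    proof (cases "y \<in> \<Omega>")
      case True
      have "norm (y - x) \<le> M + norm x" using norm_triangle_ineq4[of y x] M[OF True] by simp
      then have "norm (y - x)^2 \<le> (M + norm x)^2" by (intro power_mono) auto
      then have "1 \<le> (M + norm x)^2 / norm (y - x)^2" using that by simp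
      then have "1 * norm (w y) \<le> ((M + norm x)^2 / norm (y - x)^2) * norm (w y)" by (rule mult_right_mono) simp
      then show ?thesis using True by (simp add: W_def norm_qmult norm_cauchy_kernel)
    qed (simp add: W_def)
    have "AE y in lborel. norm (y - x) \<noteq> 0"
    proof -
      have "{x} \<in> null_sets lborel" by (rule finite_imp_null_set_lborel) simp
      then show ?thesis by (rule AE_I') auto
    qed
    then have "AE y in lebesgue. norm (y - x) \<noteq> 0" by (rule AE_completion)
    then show "AE y in lebesgue. norm (W y) \<le> norm ((4 * pi * (M + norm x)^2) *\<^sub>R (indicator \<Omega> y *\<^sub>R (cauchy_kernel (y - x) \<odot> w y)))"
      by eventually_elim (use le in auto)
  qed
  then have "integrable lborel W" by (subst (asm) integrable_completion) auto
  then show ?thesis by (simp add: W_def[abs_def])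
qed

text \<open>
  The density enters through its local part $p_k \star w$, the only one that can fail to be differentiable, and
  through an integral with a smooth kernel.
\<close>

lemma teodorescu_decomposition:
  fixes w :: "real^3 \<Rightarrow> real^4"
  assumes "open \<Omega>" "bounded \<Omega>" and w: "continuous_on \<Omega> w" and ex: "teodorescu_exists \<Omega> w x"
    and "0 < r" "cball x r \<subseteq> \<Omega>"
  shows "teodorescu \<Omega> w x = - (\<Sum>k\<in>UNIV. qunit k \<odot> ((parametrix r k \<star> w) x
      + (\<integral>y. smooth_field r k (y - x) *\<^sub>R (indicator \<Omega> y *\<^sub>R w y) \<partial>lborel)))"
proof -
  obtain M where M: "\<And>y. y \<in> \<Omega> \<Longrightarrow> norm y \<le> M" using assms(2) by (auto simp: bounded_iff)
  define W where "W y = indicator \<Omega> y *\<^sub>R w y" for y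
  have Wm: "W \<in> borel_measurable borel"
    unfolding W_def[abs_def] using assms(1) w by (intro borel_measurable_continuous_on_indicator) auto
  note [measurable] = Wm
  have Wi: "integrable lborel W"
    using teodorescu_density_integrable[OF assms(1,2) w ex] by (simp add: W_def[abs_def])
  have W0: "norm y > M \<Longrightarrow> W y = 0" for y using M[of y] by (auto simp: W_def indicator_def)
  have pm: "parametrix r k \<in> borel_measurable borel" for k using \<open>0 < r\<close> by simp
  have ip: "integrable lborel (\<lambda>y. parametrix r k (y - x) *\<^sub>R W y)" for k
  proof -
    have "continuous_on (cball x r) W"
      by (rule continuous_on_eq[OF continuous_on_subset[OF w assms(6)]]) (use assms(6) in \<open>auto simp: W_def\<close>)
    then have "integrable lborel (\<lambda>z. parametrix r k z *\<^sub>R W (x + z))"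
      by (intro integrable_shift_mult[where f = W and x = x, OF integrable_parametrix[OF \<open>0 < r\<close>, of k]])
        (use parametrix_support(1)[OF \<open>0 < r\<close>] in auto)
    from integrable_shift[OF this, of "- x"] show ?thesis by simp
  qed
  have ik: "integrable lborel (\<lambda>y. smooth_field r k (y - x) *\<^sub>R W y)" for k
    by (rule smooth_kernel_integrable[OF Wi W0 kernel_continuous(1)[OF \<open>0 < r\<close>]])
  have corr: "(parametrix r k \<star> w) x = (\<integral>y. parametrix r k (y - x) *\<^sub>R W y \<partial>lborel)" for k
    unfolding W_def
    by (rule corr_shift_indicator[where r = r, OF pm Wm[unfolded W_def[abs_def]] parametrix_support(1)[OF \<open>0 < r\<close> less_imp_le] assms(6)])
  have in': "integrable lborel (\<lambda>y. newton_field k (y - x) *\<^sub>R W y)"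
    and nf: "(\<integral>y. newton_field k (y - x) *\<^sub>R W y \<partial>lborel) = (parametrix r k \<star> w) x + (\<integral>y. smooth_field r k (y - x) *\<^sub>R W y \<partial>lborel)" for k
  proof -
    have e: "newton_field k (y - x) *\<^sub>R W y = parametrix r k (y - x) *\<^sub>R W y + smooth_field r k (y - x) *\<^sub>R W y" for y
      by (simp add: parametrix_def algebra_simps)
    show "integrable lborel (\<lambda>y. newton_field k (y - x) *\<^sub>R W y)" unfolding e using ip ik by simp
    show "(\<integral>y. newton_field k (y - x) *\<^sub>R W y \<partial>lborel) = (parametrix r k \<star> w) x + (\<integral>y. smooth_field r k (y - x) *\<^sub>R W y \<partial>lborel)"
      unfolding e corr using ip ik by simp
  qed
  have ib: "integrable lborel (\<lambda>y. qunit k \<odot> (newton_field k (y - x) *\<^sub>R W y))" for k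
    by (rule integrable_bounded_linear[OF bounded_linear_qmult_right in'])
  have "integral \<Omega> (\<lambda>y. cauchy_kernel (y - x) \<odot> w y) = (LINT y:\<Omega>|lebesgue. cauchy_kernel (y - x) \<odot> w y)"
    using ex unfolding teodorescu_exists_def by (rule set_lebesgue_integral_eq_integral(2)[symmetric])
  also have "\<dots> = (\<integral>y. (\<Sum>k\<in>UNIV. qunit k \<odot> (newton_field k (y - x) *\<^sub>R W y)) \<partial>lebesgue)"
    unfolding set_lebesgue_integral_def
    by (rule Bochner_Integration.integral_cong) (auto simp: W_def cauchy_kernel_qmult indicator_def linear_0[OF bounded_linear.linear[OF bounded_linear_qmult_right]])
  also have "\<dots> = (\<integral>y. (\<Sum>k\<in>UNIV. qunit k \<odot> (newton_field k (y - x) *\<^sub>R W y)) \<partial>lborel)"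
    using ib by (intro integral_completion borel_measurable_sum) auto
  also have "\<dots> = (\<Sum>k\<in>UNIV. qunit k \<odot> (\<integral>y. newton_field k (y - x) *\<^sub>R W y \<partial>lborel))"
    using ib in' by (simp add: Bochner_Integration.integral_sum integral_bounded_linear[OF bounded_linear_qmult_right])
  finally show ?thesis unfolding teodorescu_def nf by (simp add: W_def)
qed

section \<open>The conjugate field\<close>

text \<open>
  With $U_n = \int_{\varepsilon_n}^t u\, ds$ one has
  $\Delta U_n = \partial_t u(\cdot, t) - \partial_t u(\cdot, \varepsilon_n)$, and \<open>parametrix_representation\<close> expresses $D U_n$ by this
  Laplacian and by $U_n$. Both converge boundedly near $x$ as $\varepsilon_n \to 0$, whereas of $D U_n$ itself only
  the pointwise convergence to the integral over $[0, t]$ is known. The second identity is the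
  limit of $\rho \star \Delta U_n = \Delta \rho \star U_n$ for the bump $\rho$.
\<close>

lemma dirac_time_integral_eq:
  fixes u :: "real^3 \<Rightarrow> real \<Rightarrow> real^4"
  assumes "open \<Omega>" and u: "C22_on \<Omega> u" and "0 < t" "0 < r" "r < R" and sub: "ball x R \<subseteq> \<Omega>"
    and wave: "\<And>x t. x \<in> \<Omega> \<Longrightarrow> t > 0 \<Longrightarrow> laplacian (\<lambda>y. u y t) x = td (td u) x t"
    and gc: "continuous_on (\<Omega> \<times> {0..}) g" and g: "\<And>x t. x \<in> \<Omega> \<Longrightarrow> t > 0 \<Longrightarrow> g (x, t) = td u x t"
    and int: "(\<lambda>s. dirac (\<lambda>y. u y s) x) integrable_on {0..t}"
  defines "U0 \<equiv> \<lambda>y. t *\<^sub>R u y t - integral {0..t} (\<lambda>s. s *\<^sub>R g (y, s))"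
  shows "integral {0..t} (\<lambda>s. dirac (\<lambda>y. u y s) x) =
      (\<Sum>j\<in>UNIV. qunit j \<odot> ((parametrix r j \<star> (\<lambda>y. td u y t)) x - (parametrix r j \<star> (\<lambda>y. g (y, 0))) x
        - (bump' r j \<star> U0) x))"
    and "(bump r \<star> (\<lambda>y. td u y t)) x - (bump r \<star> (\<lambda>y. g (y, 0))) x = (\<Sum>j\<in>UNIV. (bump'' r j j \<star> U0) x)"
proof -
  let ?a = "\<lambda>y. td u y t" and ?w = "\<lambda>y. g (y, 0)" and ?Du = "\<lambda>s. dirac (\<lambda>y. u y s) x"
  define \<epsilon> where "\<epsilon> n = t / real (n + 2)" for n
  have \<epsilon>: "\<epsilon> \<longlonglongrightarrow> 0" "\<And>n. 0 < \<epsilon> n" "\<And>n. \<epsilon> n < t"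
    unfolding \<epsilon>_def using shrinking_scale[OF \<open>0 < t\<close>] shrinking_scale_tendsto by blast+
  define U where "U n y = integral {\<epsilon> n..t} (u y)" for n y
  have xO: "x \<in> \<Omega>" using sub assms(4,5) by auto
  have subc: "cball x r \<subseteq> \<Omega>" using sub assms(5) by auto
  note par = C2_on_parametric_integral[OF assms(1) u \<epsilon>(2) continuous_on_const[of _ 1], simplified]
  have U2: "C2_on \<Omega> (U n)" for n using par(1) by (simp add: U_def[abs_def])
  note U2R = C2_on_subset[OF U2 sub]
  have lapU: "laplacian (U n) y = td u y t - g (y, \<epsilon> n)" if "y \<in> \<Omega>" for n y
    using wave_laplacian_integral(1)[OF assms(1) u that \<epsilon>(2) less_imp_le[OF \<epsilon>(3)] wave] g[OF that \<epsilon>(2)]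
    by (simp add: U_def[abs_def])
  have pdU: "(\<Sum>j\<in>UNIV. qunit j \<odot> pd j (U n) x) = integral {\<epsilon> n..t} ?Du" for n
  proof -
    have ci: "(\<lambda>s. pd j (\<lambda>y. u y s) x) integrable_on {\<epsilon> n..t}" for j
    proof (rule integrable_continuous_real)
      have "continuous_on (\<Omega> \<times> {0<..}) (\<lambda>(x, t). pd j (\<lambda>y. u y t) x)" using u by (simp add: C22_on_def)
      from continuous_on_slices(1)[OF this xO]
      show "continuous_on {\<epsilon> n..t} (\<lambda>s. pd j (\<lambda>y. u y s) x)"
        by (rule continuous_on_subset) (use \<epsilon>(2)[of n] in auto)
    qed
    have "integral {\<epsilon> n..t} ?Du = (\<Sum>j\<in>UNIV. integral {\<epsilon> n..t} (\<lambda>s. qunit j \<odot> pd j (\<lambda>y. u y s) x))"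
      unfolding dirac_eq_sum
      by (rule Henstock_Kurzweil_Integration.integral_sum)
        (auto intro: integrable_linear[OF ci bounded_linear_qmult_right, unfolded o_def])
    also have "\<dots> = (\<Sum>j\<in>UNIV. qunit j \<odot> integral {\<epsilon> n..t} (\<lambda>s. pd j (\<lambda>y. u y s) x))"
      using integral_linear[OF ci bounded_linear_qmult_right] by (simp add: o_def)
    finally show ?thesis using par(2)[OF xO] by (simp add: U_def[abs_def])
  qed
  obtain B where B: "B \<ge> 0" "\<And>y s. y \<in> cball x r \<Longrightarrow> 0 \<le> s \<Longrightarrow> s \<le> t \<Longrightarrow> norm (g (y, s)) \<le> B"
    "\<And>y s. y \<in> cball x r \<Longrightarrow> 0 < s \<Longrightarrow> s \<le> t \<Longrightarrow> norm (u y s) \<le> B"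
    using bounded_near_initial_time[OF u compact_cball subc \<open>0 < t\<close> gc g] by metis
  have BU: "norm (U n y) \<le> B * t" if y: "y \<in> cball x r" for n y
  proof -
    have yO: "y \<in> \<Omega>" using y subc by auto
    have "continuous_on (\<Omega> \<times> {0<..}) (\<lambda>(x, t). u x t)" using u by (simp add: C22_on_def)
    from continuous_on_slices(1)[OF this yO]
    have "continuous_on {\<epsilon> n..t} (u y)"
      by (rule continuous_on_subset) (use \<epsilon>(2)[of n] in auto)
    then have "norm (U n y) \<le> B * (t - \<epsilon> n)"
      unfolding U_def using B(3)[OF y] \<epsilon>(2,3)[of n] by (intro integral_bound) auto
    also have "\<dots> \<le> B * t" using B(1) \<epsilon>(2)[of n] by (intro mult_left_mono) auto
    finally show ?thesis .
  qed
  have lim: "continuous_on \<Omega> U0" "y \<in> \<Omega> \<Longrightarrow> (\<lambda>n. U n y) \<longlonglongrightarrow> U0 y" for y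
    using time_integral_initial_limit[OF u \<open>0 < t\<close> gc g \<epsilon>] by (simp_all add: U0_def U_def)
  have cU: "continuous_on (cball x r) (U n)" for n
    using continuous_on_subset[OF has_C1_partialsD(1)[OF C2_on_C1_partials(1)[OF U2]] subc] .
  have cU0: "continuous_on (cball x r) U0" by (rule continuous_on_subset[OF lim(1) subc])
  have cg: "continuous_on \<Omega> (\<lambda>y. g (y, s))" if "s \<ge> 0" for s
    using continuous_on_slices(2)[of \<Omega> "{0..}" "\<lambda>y s. g (y, s)"] gc that by simp
  have cgr: "continuous_on (cball x r) (\<lambda>y. g (y, s))" if "s \<ge> 0" for s
    by (rule continuous_on_subset[OF cg[OF that] subc])
  have cd: "continuous_on (cball x r) ?a"
    by (rule continuous_on_eq[OF cgr[of t]]) (use g subc \<open>0 < t\<close> in auto)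
  have glim: "(\<lambda>n. g (y, \<epsilon> n)) \<longlonglongrightarrow> g (y, 0)" if "y \<in> cball x r" for y
  proof -
    have yO: "y \<in> \<Omega>" using that subc by auto
    have "continuous_on {0..} (\<lambda>s. g (y, s))"
      using continuous_on_slices(1)[of \<Omega> "{0..}" "\<lambda>y s. g (y, s)"] gc yO by simp
    then show ?thesis
      by (rule continuous_on_tendsto_compose[OF _ \<epsilon>(1)]) (auto simp: less_imp_le[OF \<epsilon>(2)])
  qed
  have corr_g: "(\<lambda>n. (a \<star> (\<lambda>y. g (y, \<epsilon> n))) x) \<longlonglongrightarrow> (a \<star> ?w) x"
    if a: "integrable lborel a" "\<And>z. norm z > r \<Longrightarrow> a z = 0" for a
    by (rule corr_tendsto[where B = B, OF a])
      (use cgr B(2) glim less_imp_le[OF \<epsilon>(2)] less_imp_le[OF \<epsilon>(3)] in auto)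
  have corr_U: "(\<lambda>n. (a \<star> U n) x) \<longlonglongrightarrow> (a \<star> U0) x"
    if a: "integrable lborel a" "\<And>z. norm z > r \<Longrightarrow> a z = 0" for a
    by (rule corr_tendsto[where B = "B * t", OF a cU cU0 BU]) (use lim(2) subc in auto)
  have corr_lap: "(a \<star> laplacian (U n)) x = (a \<star> ?a) x - (a \<star> (\<lambda>y. g (y, \<epsilon> n))) x"
    if a: "integrable lborel a" "\<And>z. norm z > r \<Longrightarrow> a z = 0" for a n
  proof -
    have "(a \<star> laplacian (U n)) x = (a \<star> (\<lambda>y. td u y t - g (y, \<epsilon> n))) x"
      by (rule corr_cong[where r = r, OF a(2)]) (use lapU subc in auto)
    also have "\<dots> = (a \<star> ?a) x - (a \<star> (\<lambda>y. g (y, \<epsilon> n))) x"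
      by (rule corr_diff[OF a cd cgr]) (use less_imp_le[OF \<epsilon>(2)] in auto)
    finally show ?thesis .
  qed
  note ip = integrable_parametrix[OF \<open>0 < r\<close>] and sp = parametrix_support(1)[OF \<open>0 < r\<close> less_imp_le]
  note ib = integrable_bump[OF \<open>0 < r\<close>] and sb = bump_support[OF \<open>0 < r\<close> less_imp_le]
  have rep: "pd j (U n) x = (parametrix r j \<star> ?a) x - (parametrix r j \<star> (\<lambda>y. g (y, \<epsilon> n))) x
      - (bump' r j \<star> U n) x" for j n
    using parametrix_representation[OF \<open>0 < r\<close> \<open>r < R\<close> U2R] corr_lap[OF ip sp] by simp
  have "(\<lambda>n. pd j (U n) x) \<longlonglongrightarrow> (parametrix r j \<star> ?a) x - (parametrix r j \<star> ?w) x
      - (bump' r j \<star> U0) x" for j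
    unfolding rep by (intro tendsto_diff tendsto_const corr_g[OF ip sp] corr_U[OF ib(2) sb(2)])
  then have "(\<lambda>n. \<Sum>j\<in>UNIV. qunit j \<odot> pd j (U n) x) \<longlonglongrightarrow>
     (\<Sum>j\<in>UNIV. qunit j \<odot> ((parametrix r j \<star> ?a) x - (parametrix r j \<star> ?w) x
      - (bump' r j \<star> U0) x))"
    by (intro tendsto_sum bounded_linear.tendsto[OF bounded_linear_qmult_right])
  moreover have "(\<lambda>n. integral {\<epsilon> n..t} ?Du) \<longlonglongrightarrow> integral {0..t} ?Du"
    by (rule integral_lower_limit[OF int \<epsilon>])
  ultimately show "integral {0..t} ?Du =
      (\<Sum>j\<in>UNIV. qunit j \<odot> ((parametrix r j \<star> ?a) x - (parametrix r j \<star> ?w) x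
        - (bump' r j \<star> U0) x))"
    unfolding pdU by (rule LIMSEQ_unique[rotated])
  have "(bump r \<star> ?a) x - (bump r \<star> (\<lambda>y. g (y, \<epsilon> n))) x = (\<Sum>j\<in>UNIV. (bump'' r j j \<star> U n) x)" for n
    using bump_laplacian(2)[OF \<open>0 < r\<close> \<open>r < R\<close> U2R] corr_lap[OF ib(1) sb(1)] by simp
  moreover have "(\<lambda>n. (bump r \<star> ?a) x - (bump r \<star> (\<lambda>y. g (y, \<epsilon> n))) x)
      \<longlonglongrightarrow> (bump r \<star> ?a) x - (bump r \<star> ?w) x"
    by (intro tendsto_diff tendsto_const corr_g[OF ib(1) sb(1)])
  moreover have "(\<lambda>n. \<Sum>j\<in>UNIV. (bump'' r j j \<star> U n) x) \<longlonglongrightarrow> (\<Sum>j\<in>UNIV. (bump'' r j j \<star> U0) x)"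
    by (intro tendsto_sum corr_U[OF ib(3) sb(3)])
  ultimately show "(bump r \<star> ?a) x - (bump r \<star> ?w) x = (\<Sum>j\<in>UNIV. (bump'' r j j \<star> U0) x)"
    by (auto intro: LIMSEQ_unique)
qed

text \<open>
  The terms $p_j \star w$ of the time integral and of the Teodorescu transform cancel, and
  $v = \sum_j e_j X_j$ with differentiable fields $X_j$. The divergence of $p \star \partial_t u$ is
  $\partial_t u - \rho \star \partial_t u$; the smooth kernels contribute $\Delta \rho \star U_0 + \rho \star w$, which compensates
  $\rho \star \partial_t u$, and the harmonic function contributes 0.
\<close>

lemma dirac_conjugate_field:
  fixes u v :: "real^3 \<Rightarrow> real \<Rightarrow> real^4"
  assumes \<Omega>: "open \<Omega>" "bounded \<Omega>" and u: "C22_on \<Omega> u"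
    and wave: "\<And>x t. x \<in> \<Omega> \<Longrightarrow> t > 0 \<Longrightarrow> laplacian (\<lambda>y. u y t) x = td (td u) x t"
    and trace: "has_initial_values \<Omega> (td u)"
    and time_integral:
      "\<And>x t. x \<in> \<Omega> \<Longrightarrow> t > 0 \<Longrightarrow> (\<lambda>s. dirac (\<lambda>y. u y s) x) integrable_on {0..t}"
    and space_integral: "\<And>x. x \<in> \<Omega> \<Longrightarrow> teodorescu_exists \<Omega> (initial_value (td u)) x"
    and \<phi>: "harmonic_on \<Omega> \<phi>"
    and v: "\<And>x t. x \<in> \<Omega> \<Longrightarrow> t > 0 \<Longrightarrow>
      v x t = integral {0..t} (\<lambda>s. dirac (\<lambda>y. u y s) x)
        - teodorescu \<Omega> (initial_value (td u)) x + grad \<phi> x"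
    and x: "x \<in> \<Omega>" and t: "0 < t"
  shows "pdiff k (\<lambda>y. v y t) x" and "dirac (\<lambda>y. v y t) x = - td u x t"
proof -
  obtain g where gc: "continuous_on (\<Omega> \<times> {0..}) g" and g: "\<And>x t. x \<in> \<Omega> \<Longrightarrow> t > 0 \<Longrightarrow> g (x, t) = td u x t"
    using trace by (auto simp: has_initial_values_def)
  define w where "w = initial_value (td u)"
  have w: "w y = g (y, 0)" if "y \<in> \<Omega>" for y
    unfolding w_def by (rule initial_value_eq[OF gc g that])
  have "continuous_on \<Omega> (\<lambda>y. g (y, 0))"
    using continuous_on_slices(2)[of \<Omega> "{0..}" "\<lambda>y s. g (y, s)"] gc by simp
  then have cw: "continuous_on \<Omega> w" by (rule continuous_on_eq) (simp add: w)
  define W where "W y = indicator \<Omega> y *\<^sub>R w y" for y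
  have Wi: "integrable lborel W"
    using teodorescu_density_integrable[OF \<Omega> cw space_integral[OF x, folded w_def]] by (simp add: W_def[abs_def])
  obtain M where M: "\<And>y. y \<in> \<Omega> \<Longrightarrow> norm y \<le> M" using \<Omega>(2) by (auto simp: bounded_iff)
  have W0: "norm y > M \<Longrightarrow> W y = 0" for y using M[of y] by (auto simp: W_def indicator_def)
  obtain R where R: "R > 0" "ball x R \<subseteq> \<Omega>" using \<Omega>(1) x open_contains_ball by blast
  \<comment> \<open>For $y$ within $r$ of $x$ the ball of radius $R/2 > r$ around $y$ stays in $\Omega$, so that the
    parametrix identities hold at all points near $x$.\<close>
  define r where "r = R / 4"
  have r: "0 < r" "r < R / 2" "r < R" using R by (auto simp: r_def)
  have sub: "ball y (R / 2) \<subseteq> \<Omega>" if "y \<in> ball x r" for y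
  proof
    fix z assume "z \<in> ball y (R / 2)"
    then have "dist x z < R" using that dist_triangle[of x z y] r by simp
    then show "z \<in> \<Omega>" using R by auto
  qed
  have cb: "cball y r \<subseteq> \<Omega>" if "y \<in> ball x r" for y
  proof -
    have "cball y r \<subseteq> ball y (R / 2)" using r by auto
    then show ?thesis using sub[OF that] by blast
  qed
  have inO: "y \<in> \<Omega>" if "y \<in> ball x r" for y using that r R by auto
  have xr: "x \<in> ball x r" using r by simp
  define a where "a y = td u y t" for y
  define U0 where "U0 y = t *\<^sub>R u y t - integral {0..t} (\<lambda>s. s *\<^sub>R g (y, s))" for y
  define Z where "Z j y = (\<integral>q. smooth_field r j (q - y) *\<^sub>R W q \<partial>lborel)" for j y
  have bulk: "integral {0..t} (\<lambda>s. dirac (\<lambda>y. u y s) y) =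
      (\<Sum>j\<in>UNIV. qunit j \<odot> ((parametrix r j \<star> a) y - (parametrix r j \<star> (\<lambda>y. g (y, 0))) y - (bump' r j \<star> U0) y))"
    "(bump r \<star> a) y - (bump r \<star> (\<lambda>y. g (y, 0))) y = (\<Sum>j\<in>UNIV. (bump'' r j j \<star> U0) y)"
    if y: "y \<in> ball x r" for y
    unfolding U0_def[abs_def] a_def[abs_def]
    by (rule dirac_time_integral_eq[OF \<Omega>(1) u t r(1,2) sub[OF y] wave gc g time_integral[OF inO[OF y] t]];
        assumption)+
  have corr_w: "(b \<star> (\<lambda>y. g (y, 0))) y = (b \<star> w) y"
    if "y \<in> ball x r" "\<And>z. norm z \<ge> r \<Longrightarrow> b z = 0" for b y
  proof (rule corr_cong[where r = r])
    show "g (q, 0) = w q" if "q \<in> cball y r" for q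
      using w subsetD[OF cb[OF \<open>y \<in> ball x r\<close>] that] by simp
  qed (use that(2) in simp)
  \<comment> \<open>What remains of the three terms of $v$ after the cancellation of $p_j \star w$.\<close>
  define X where "X j y = (parametrix r j \<star> a) y - (bump' r j \<star> U0) y + Z j y + pd j \<phi> y *\<^sub>R e0" for j y
  have vX: "v y t = (\<Sum>j\<in>UNIV. qunit j \<odot> X j y)" if y: "y \<in> ball x r" for y
  proof -
    note T = teodorescu_decomposition[OF \<Omega> cw space_integral[OF inO[OF y], folded w_def] r(1) cb[OF y]]
    have q: "qunit j \<odot> X j y = qunit j \<odot> ((parametrix r j \<star> a) y - (parametrix r j \<star> w) y - (bump' r j \<star> U0) y)
        + qunit j \<odot> ((parametrix r j \<star> w) y + Z j y) + qunit j \<odot> (pd j \<phi> y *\<^sub>R e0)" for j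
    proof -
      interpret L: bounded_linear "\<lambda>q. qunit j \<odot> q" by (rule bounded_linear_qmult_right)
      show ?thesis unfolding L.add[symmetric] X_def by (simp add: algebra_simps)
    qed
    show ?thesis
      unfolding v[OF inO[OF y] t] w_def[symmetric] T bulk(1)[OF y]
        grad_eq_sum q sum.distrib
      by (simp add: corr_w[OF y parametrix_support(1)[OF r(1)]] Z_def W_def)
  qed
  \<comment> \<open>Taylor's formula on $[t, t + 1]$ writes $\partial_t u(\cdot, t)$ in the form $g - \Delta G$.\<close>
  define G where "G y = integral {t..t + 1} (\<lambda>s. (t + 1 - s) *\<^sub>R u y s)" for y
  have G2: "C2_on \<Omega> G"
    unfolding G_def[abs_def] by (rule C2_on_parametric_integral(1)[OF \<Omega>(1) u t]) (intro continuous_intros)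
  have g2: "C2_on \<Omega> (\<lambda>y. u y (t + 1) - u y t)"
    using t by (intro C2_on_diff \<Omega>(1) C22_on_slice[OF u]) auto
  have aG: "a y = (u y (t + 1) - u y t) - laplacian G y" if "y \<in> \<Omega>" for y
    using wave_laplacian_integral(2)[OF \<Omega>(1) u that t _ wave, of "t + 1"] by (simp add: G_def[abs_def] a_def)
  obtain Y where Y: "\<And>j k. has_dirderiv (parametrix r j \<star> a) x (axis k 1) (Y j k)"
    "\<And>j k. Y j k = Y k j" "(\<Sum>j\<in>UNIV. Y j j) = a x - (bump r \<star> a) x"
    by (rule parametrix_potential_partials[OF r(1,3) C2_on_subset[OF g2 R(2)] C2_on_subset[OF G2 R(2)], of a])
      (use aG R in blast)+
  \<comment> \<open>The derivative of $X_j$ in direction $k$. Smooth kernels depend on $y - x$, hence the signs.\<close>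
  define YX where "YX j k = Y j k - (- (bump'' r k j \<star> U0) x)
      + (- (\<integral>q. smooth_field' r k j (q - x) *\<^sub>R W q \<partial>lborel)) + pd k (pd j \<phi>) x *\<^sub>R e0" for j k
  have cU0: "continuous_on (cball x (R / 2)) U0"
  proof -
    have "continuous_on \<Omega> U0"
      unfolding U0_def[abs_def]
      by (rule time_integral_initial_limit(1)[OF u t gc g shrinking_scale_tendsto shrinking_scale[OF t]])
    then show ?thesis by (rule continuous_on_subset) (use R in auto)
  qed
  have \<phi>2: "C2_on \<Omega> \<phi>" and \<phi>0: "laplacian \<phi> x = 0" using \<phi> x by (auto simp: harmonic_on_def)
  have dX: "has_dirderiv (X j) x (axis k 1) (YX j k)" for j k
    unfolding X_def[abs_def] YX_def
  proof (intro has_dirderiv_add has_dirderiv_diff Y(1))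
    show "has_dirderiv (bump' r j \<star> U0) x (axis k 1) (- (bump'' r k j \<star> U0) x)"
      by (rule corr_smooth_has_dirderiv[OF r(1,2) cU0 bump_support(2)[OF r(1)] bump_support(3)[OF r(1)]
            bump'_dirderiv[OF r(1)] kernel_continuous(4)[OF r(1)] kernel_continuous(5)[OF r(1)]])
    show "has_dirderiv (Z j) x (axis k 1) (- (\<integral>q. smooth_field' r k j (q - x) *\<^sub>R W q \<partial>lborel))"
      unfolding Z_def[abs_def]
      by (rule smooth_kernel_has_dirderiv[OF Wi W0 smooth_field_dirderiv[OF r(1)]
            kernel_continuous(1)[OF r(1)] kernel_continuous(2)[OF r(1)]])
    show "has_dirderiv (\<lambda>y. pd j \<phi> y *\<^sub>R e0) x (axis k 1) (pd k (pd j \<phi>) x *\<^sub>R e0)"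
      by (rule has_dirderiv_bounded_linear[OF bounded_linear_scaleR_left C2_on_has_dirderiv(2)[OF \<phi>2 x]])
  qed
  have sX: "YX j k = YX k j" for j k
    unfolding YX_def Y(2)[of j k] C2_on_commute[OF \<phi>2 \<Omega>(1) x, of k j]
    using bump''_sym[of r k j] smooth_field'_sym[of r k j] by (simp add: ext[of "bump'' r k j" "bump'' r j k"] bump''_sym)
  note fin = dirac_of_field[OF dX sX open_ball xr vX]
  show "pdiff k (\<lambda>y. v y t) x" by (rule fin(1))
  have "(\<Sum>j\<in>UNIV. YX j j) = (\<Sum>j\<in>UNIV. Y j j) + (\<Sum>j\<in>UNIV. (bump'' r j j \<star> U0) x)
      - (\<Sum>j\<in>UNIV. \<integral>q. smooth_field' r j j (q - x) *\<^sub>R W q \<partial>lborel) + laplacian \<phi> x *\<^sub>R e0"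
    by (simp add: YX_def sum.distrib sum_subtractf sum_negf laplacian_def scaleR_sum_left)
  also have "(\<Sum>j\<in>UNIV. \<integral>q. smooth_field' r j j (q - x) *\<^sub>R W q \<partial>lborel)
      = (\<integral>q. (\<Sum>j\<in>UNIV. smooth_field' r j j (q - x) *\<^sub>R W q) \<partial>lborel)"
    by (rule Bochner_Integration.integral_sum[symmetric])
      (rule smooth_kernel_integrable[OF Wi W0 kernel_continuous(2)[OF r(1)]])
  also have "\<dots> = - (\<integral>q. bump r (q - x) *\<^sub>R W q \<partial>lborel)"
    by (simp add: scaleR_sum_left[symmetric] smooth_field_div[OF r(1)])
  also have "(\<integral>q. bump r (q - x) *\<^sub>R W q \<partial>lborel) = (bump r \<star> w) x"
    unfolding W_def
  proof (rule corr_shift_indicator[where r = r, symmetric])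
    show "bump r \<in> borel_measurable borel" using r by simp
    show "(\<lambda>y. indicator \<Omega> y *\<^sub>R w y) \<in> borel_measurable borel"
      using borel_measurable_integrable[OF Wi] by (simp add: W_def[abs_def])
    show "bump r z = 0" if "norm z > r" for z using bump_support(1)[OF r(1), of z] that by simp
    show "cball x r \<subseteq> \<Omega>" using r R by auto
  qed
  also have "(\<Sum>j\<in>UNIV. (bump'' r j j \<star> U0) x) = (bump r \<star> a) x - (bump r \<star> w) x"
    using bulk(2)[OF xr] corr_w[OF xr bump_support(1)[OF r(1)]] by simp
  finally have "(\<Sum>j\<in>UNIV. YX j j) = a x" using Y(3) \<phi>0 by simp
  then show "dirac (\<lambda>y. v y t) x = - td u x t" using fin(2) by (simp add: a_def)
qed

lemma time_derivative_conjugate_field: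
  fixes u v :: "real^3 \<Rightarrow> real \<Rightarrow> real^4"
  assumes u: "C22_on \<Omega> u" and x: "x \<in> \<Omega>" and t: "0 < t"
    and int: "\<And>t. t > 0 \<Longrightarrow> (\<lambda>s. dirac (\<lambda>y. u y s) x) integrable_on {0..t}"
    and v: "\<And>t. t > 0 \<Longrightarrow> v x t = integral {0..t} (\<lambda>s. dirac (\<lambda>y. u y s) x) + c"
  shows "(v x has_vector_derivative dirac (\<lambda>y. u y t) x) (at t)"
proof -
  have "continuous_on {0<..} (\<lambda>s. dirac (\<lambda>y. u y s) x)"
    unfolding dirac_eq_sum
  proof (intro continuous_on_sum bounded_linear.continuous_on[OF bounded_linear_qmult_right])
    fix j
    have "continuous_on (\<Omega> \<times> {0<..}) (\<lambda>(x, t). pd j (\<lambda>y. u y t) x)" using u by (simp add: C22_on_def)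
    from continuous_on_slices(1)[OF this x] show "continuous_on {0<..} (\<lambda>s. pd j (\<lambda>y. u y s) x)" .
  qed
  then have cont: "isCont (\<lambda>s. dirac (\<lambda>y. u y s) x) t"
    using t continuous_on_eq_continuous_at[OF open_greaterThan] by blast
  have "((\<lambda>q. integral {0..q} (\<lambda>s. dirac (\<lambda>y. u y s) x)) has_vector_derivative dirac (\<lambda>y. u y t) x)
      (at t within {0..t + 1} - {})"
    by (rule integral_has_vector_derivative_continuous_at[OF int _ _ continuous_at_imp_continuous_at_within[OF cont]])
      (use t in simp_all)
  moreover have "at t within {0..t + 1} - {} = at t"
    using t by (intro at_within_interior) simp
  ultimately have "((\<lambda>q. integral {0..q} (\<lambda>s. dirac (\<lambda>y. u y s) x) + c) has_vector_derivative dirac (\<lambda>y. u y t) x + 0) (at t)"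
    by (intro has_vector_derivative_add has_vector_derivative_const) simp
  then have "((\<lambda>q. integral {0..q} (\<lambda>s. dirac (\<lambda>y. u y s) x) + c) has_vector_derivative dirac (\<lambda>y. u y t) x) (at t)"
    by simp
  then show ?thesis
    by (rule has_vector_derivative_transform_within_open[where S = "{0<..}"]) (use t v in auto)
qed

lemma bounded_linear_biquat: "bounded_linear biquat"
  unfolding linear_conv_bounded_linear[symmetric]
  by (rule linearI) (simp_all add: vec_eq_iff biquat_def scaleR_conv_of_real[where 'a = complex])

lemma bounded_linear_scalar_mult: "bounded_linear (\<lambda>q::complex^4. c *s q)"
  unfolding linear_conv_bounded_linear[symmetric]
  by (rule linearI) (simp_all add: vec_eq_iff algebra_simps)

text \<open>
  With $c^2 = -1$ the expression $(D + c\, \partial_t)(u + c v)$ equals $Du - \partial_t v + c\,(Dv + \partial_t u)$, so that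
  $c = i$ and $c = -i$ are the same computation.
\<close>

lemma in_Ker_dirac_dt:
  fixes u v :: "real^3 \<Rightarrow> real \<Rightarrow> real^4"
  assumes c: "c * c = -1"
    and pu: "\<And>x t j. x \<in> \<Omega> \<Longrightarrow> t > 0 \<Longrightarrow> pdiff j (\<lambda>y. u y t) x"
    and pv: "\<And>x t j. x \<in> \<Omega> \<Longrightarrow> t > 0 \<Longrightarrow> pdiff j (\<lambda>y. v y t) x"
    and tu: "\<And>x t. x \<in> \<Omega> \<Longrightarrow> t > 0 \<Longrightarrow> (u x has_vector_derivative td u x t) (at t)"
    and tv: "\<And>x t. x \<in> \<Omega> \<Longrightarrow> t > 0 \<Longrightarrow> (v x has_vector_derivative dirac (\<lambda>y. u y t) x) (at t)"
    and Dv: "\<And>x t. x \<in> \<Omega> \<Longrightarrow> t > 0 \<Longrightarrow> dirac (\<lambda>y. v y t) x = - td u x t"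
  shows "(\<lambda>x t. biquat (u x t) + c *s biquat (v x t)) \<in> Ker_dirac_dt \<Omega> c"
  unfolding Ker_dirac_dt_def mem_Collect_eq
proof (intro ballI allI impI conjI)
  fix x t assume x: "x \<in> \<Omega>" and t: "(0::real) < t"
  define L where "L = (\<lambda>q. c *s biquat q)"
  have L: "bounded_linear L"
    unfolding L_def by (rule bounded_linear_compose[OF bounded_linear_scalar_mult bounded_linear_biquat])
  let ?f = "\<lambda>x t. biquat (u x t) + c *s biquat (v x t)"
  have d: "has_dirderiv (\<lambda>y. ?f y t) x (axis j 1) (biquat (pd j (\<lambda>y. u y t) x) + c *s biquat (pd j (\<lambda>y. v y t) x))" for j
    using has_dirderiv_add[OF has_dirderiv_bounded_linear[OF bounded_linear_biquat pdiff_has_dirderiv[OF pu[OF x t]]]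
        has_dirderiv_bounded_linear[OF L pdiff_has_dirderiv[OF pv[OF x t]]]] by (simp add: L_def)
  then show "pdiff j (\<lambda>y. ?f y t) x" for j by (rule has_dirderiv_imp_pdiff)
  have dt: "(?f x has_vector_derivative biquat (td u x t) + c *s biquat (dirac (\<lambda>y. u y t) x)) (at t)"
    using has_vector_derivative_add[OF bounded_linear.has_vector_derivative[OF bounded_linear_biquat tu[OF x t]]
        bounded_linear.has_vector_derivative[OF L tv[OF x t]]] by (simp add: L_def)
  then show "?f x differentiable (at t)" by (rule differentiableI_vector)
  have D: "dirac (\<lambda>y. ?f y t) x = biquat (dirac (\<lambda>y. u y t) x) + c *s biquat (dirac (\<lambda>y. v y t) x)"
    unfolding dirac_def has_dirderiv_imp_pdiff(2)[OF d]
    by (simp add: quat_eq_iff qmult_def biquat_def algebra_simps)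
  have T: "td ?f x t = biquat (td u x t) + c *s biquat (dirac (\<lambda>y. u y t) x)"
    unfolding td_def by (rule vector_derivative_at[OF dt[unfolded td_def]])
  have cc: "c * (c * z) = - z" for z using c by (simp flip: mult.assoc)
  show "dirac (\<lambda>y. ?f y t) x + c *s td ?f x t = 0"
    unfolding D T Dv[OF x t] by (simp add: vec_eq_iff biquat_def algebra_simps cc)
qed

theorem proposition5:
  fixes \<Omega> :: "(real^3) set"
    and u v :: "real^3 \<Rightarrow> real \<Rightarrow> real^4"
    and \<phi> :: "real^3 \<Rightarrow> real"
  assumes "open \<Omega>" and "connected \<Omega>" and "bounded \<Omega>" and "\<Omega> \<noteq> {}"
    and "C22_on \<Omega> u"
    and wave: "\<And>x t. x \<in> \<Omega> \<Longrightarrow> t > 0 \<Longrightarrow> - laplacian (\<lambda>y. u y t) x + td (td u) x t = 0"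
    and trace: "has_initial_values \<Omega> (td u)"
    and time_integral:
      "\<And>x t. x \<in> \<Omega> \<Longrightarrow> t > 0 \<Longrightarrow> (\<lambda>s. dirac (\<lambda>y. u y s) x) integrable_on {0..t}"
    and space_integral: "\<And>x. x \<in> \<Omega> \<Longrightarrow> teodorescu_exists \<Omega> (initial_value (td u)) x"
    and "harmonic_on \<Omega> \<phi>"
    and v: "\<And>x t. x \<in> \<Omega> \<Longrightarrow> t > 0 \<Longrightarrow>
      v x t = integral {0..t} (\<lambda>s. dirac (\<lambda>y. u y s) x)
        - teodorescu \<Omega> (initial_value (td u)) x + grad \<phi> x"
  shows "(\<lambda>x t. biquat (u x t) + \<i> *s biquat (v x t)) \<in> Ker_dirac_dt \<Omega> \<i>
    \<and> (\<lambda>x t. biquat (u x t) - \<i> *s biquat (v x t)) \<in> Ker_dirac_dt \<Omega> (- \<i>)"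
proof -
  have wave': "laplacian (\<lambda>y. u y t) x = td (td u) x t" if "x \<in> \<Omega>" "t > 0" for x t
    using wave[OF that] by simp
  note conj = dirac_conjugate_field[OF \<open>open \<Omega>\<close> \<open>bounded \<Omega>\<close> \<open>C22_on \<Omega> u\<close> wave' trace time_integral
      space_integral \<open>harmonic_on \<Omega> \<phi>\<close> v]
  have pu: "pdiff j (\<lambda>y. u y t) x" if "x \<in> \<Omega>" "t > 0" for x t j
    using has_dirderiv_imp_pdiff(1)[OF C2_on_has_dirderiv(1)[OF C22_on_slice[OF \<open>C22_on \<Omega> u\<close> that(2)] that(1)]] .
  have tv: "(v x has_vector_derivative dirac (\<lambda>y. u y t) x) (at t)" if "x \<in> \<Omega>" "t > 0" for x t
    by (rule time_derivative_conjugate_field[OF \<open>C22_on \<Omega> u\<close> that time_integral[OF that(1)],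
          where c = "- teodorescu \<Omega> (initial_value (td u)) x + grad \<phi> x"])
      (use v[OF that(1)] in auto)
  have "(\<lambda>x t. biquat (u x t) + c *s biquat (v x t)) \<in> Ker_dirac_dt \<Omega> c" if "c * c = -1" for c
    by (rule in_Ker_dirac_dt[OF that pu conj(1) C22_on_td(1)[OF \<open>C22_on \<Omega> u\<close>] tv conj(2)])
  from this[of \<i>] this[of "- \<i>"] show ?thesis by simp
qed

end
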